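(* Let $\mathbb{T}$ be a countable geometric theory, i.e. one with a countable number of sorts, relation symbols and axioms. Then the localic groupoid $G^{\mathbb{T}}$ described in the context is spatial (its locale of objects $G^{\mathbb{T}}_0$, its locale of morphisms $G^{\mathbb{T}}_1$ and the locale $G^{\mathbb{T}}_1\times_{G^{\mathbb{T}}_0}G^{\mathbb{T}}_1$ of composable pairs are all spatial) and thus arises from a topological groupoid.
   Context: A locale is spatial if it is isomorphic to the locale of opens of a topological space. **Geometric theories.** A (first-order) geometric theory $\mathbb{T}$ consists of a set of sorts, a set of relation symbols $R \subseteq X^1 \times \dots \times X^k$ ($k \ge 0$; there are no function symbols, functions being treated as relations), and a set of axioms, which are sequents $\phi \vdash_{x_1\colon X^1,\dots,x_k\colon X^k} \psi$ between geometric formulae, i.e. formulae built from relation symbols and equality using finite conjunctions, arbitrary (set-indexed) disjunctions and $\exists$. It is propositional if it has no sorts. The classifying locale of a propositional geometric theory is the locale whose frame is presented by the basic propositions as generators and a relation $\phi\le\psi$ for each axiom $\phi\vdash\psi$. $f^*\colon \mathcal{O}Y\to\mathcal{O}X$ denotes the frame homomorphism of a locale map $f\colon X\to Y$. **The propositional theory $P[\mathbb{T}]$.** It has the following basic propositions and axioms. (1) For each sort $X$ of $\mathbb{T}$: a basic proposition $[n\sim^X m]$ for all $n,m\in\mathbb{N}$, and axioms $[n\sim^X m]\vdash[m\sim^X n]$ and $[n\sim^X m]\wedge[m\sim^X \ell]\vdash[n\sim^X\ell]$ for all $n,m,\ell\in\mathbb{N}$. (2) For each relation symbol $R\subseteq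 X^1\times\dots\times X^k$ of $\mathbb{T}$ (not including equality) and all $n_1,\dots,n_k,m_1,\dots,m_k\in\mathbb{N}$: a basic proposition $[(n_1,\dots,n_k)\in R]$ and axioms $[(n_1,\dots,n_k)\in R]\wedge[n_1\sim^{X^1}m_1]\wedge\dots\wedge[n_k\sim^{X^k}m_k]\vdash[(m_1,\dots,m_k)\in R]$ and $[(n_1,\dots,n_k)\in R]\vdash[n_1\sim^{X^1}n_1]\wedge\dots\wedge[n_k\sim^{X^k}n_k]$. (3) For each axiom $\phi\vdash_{x_1\colon X^1,\dots,x_k\colon X^k}\psi$ of $\mathbb{T}$ and all $n_1,\dots,n_k\in\mathbb{N}$: the axiom $\bigwedge_{i=1}^k[n_i\sim^{X^i}n_i]\wedge\phi_{n_1,\dots,n_k}\vdash\psi_{n_1,\dots,n_k}$, where $\phi_{n_1,\dots,n_k},\psi_{n_1,\dots,n_k}$ are obtained from $\phi,\psi$ by replacing each free variable $x_i$ by $n_i$, each quantifier $\exists x\colon X.\ \chi(x,\dots)$ by $\bigvee_{n_x\in\mathbb{N}}\big([n_x\sim^X n_x]\wedge\chi(n_x,\dots)\big)$, each subformula $(y_1,\dots,y_\ell)\in R$ by $[(y_1,\dots,y_\ell)\in R]$, and each subformula $x=_X y$ by $[x\sim^X y]$. **The theory $\mathbb{T}_{\cong}$** of isomorphisms of $\mathbb{T}$-models. It has: two copies of $\mathbb{T}$ (sorts $X_1,X_2$, relation symbols $R_1,R_2$, and both copies of each axiom, the subscript-$i$ copy being over the subscript-$i$ sorts); for each sort $X$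 of $\mathbb{T}$ a relation symbol $\alpha^X\subseteq X_1\times X_2$ with the axioms $(x,y)\in\alpha^X\wedge(x',y')\in\alpha^X\wedge x=_{X_1}x'\ \dashv\vdash_{x,x'\colon X_1,\,y,y'\colon X_2}\ (x,y)\in\alpha^X\wedge(x',y')\in\alpha^X\wedge y=_{X_2}y'$, $\ \vdash_{y\colon X_2}\exists x\colon X_1.\,(x,y)\in\alpha^X$, and $\ \vdash_{x\colon X_1}\exists y\colon X_2.\,(x,y)\in\alpha^X$; and for each relation symbol $R\subseteq X^1\times\dots\times X^k$ of $\mathbb{T}$ the axioms $\bigwedge_{i=1}^k(x_i,y_i)\in\alpha^{X^i}\wedge(x_1,\dots,x_k)\in R_1\ \dashv\vdash_{\vec x,\vec y}\ \bigwedge_{i=1}^k(x_i,y_i)\in\alpha^{X^i}\wedge(y_1,\dots,y_k)\in R_2$. ($\dashv\vdash$ denotes a sequent in both directions.) In $P[\mathbb{T}_{\cong}]$ we write $[\alpha^X(n)=m]$ for $[(n,m)\in\alpha^X]$. **The localic groupoid $G^{\mathbb{T}}$** (an internal groupoid in the category of locales). $G^{\mathbb{T}}_0$ is the classifying locale of $P[\mathbb{T}]$ and $G^{\mathbb{T}}_1$ that of $P[\mathbb{T}_{\cong}]$. The structure maps are given by the following frame homomorphisms on generators (where $R$ may also be equality $=_X$, with $[(n,m)\in {=_X}]$ meaning $[n\sim^X m]$, and $\vec n=(n_1,\dots,n_k)$): - source: $s^*[\vec n\in R]=[\vec n\in R_1]$; target: $t^*[\vec n\in R]=[\vec n\in R_2]$;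 - identity: $e^*[\vec n\in R_1]=e^*[\vec n\in R_2]=[\vec n\in R]$, $e^*[\alpha^X(n)=m]=[n\sim^X m]$; - inversion: $i^*[\vec n\in R_1]=[\vec n\in R_2]$, $i^*[\vec n\in R_2]=[\vec n\in R_1]$, $i^*[\alpha^X(n)=m]=[\alpha^X(m)=n]$; - composition: $G^{\mathbb{T}}_1\times_{G^{\mathbb{T}}_0}G^{\mathbb{T}}_1$ (pairs with the target of the first equal to the source of the second) is the classifying locale of $P[\mathbb{T}_{\cong,\cong}]$, where $\mathbb{T}_{\cong,\cong}$ is like $\mathbb{T}_{\cong}$ but with three copies of $\mathbb{T}$ and two relation symbols $\beta^X\subseteq X_1\times X_2$, $\gamma^X\subseteq X_2\times X_3$ for each sort $X$, each family encoding an isomorphism of $\mathbb{T}$-models; then $m^*[\vec n\in R_1]=[\vec n\in R_1]$, $m^*[\vec n\in R_2]=[\vec n\in R_3]$, $m^*[\alpha^X(n)=p]=\bigvee_{q\in\mathbb{N}}[\beta^X(n)=q]\wedge[\gamma^X(q)=p]$. *)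

theory Defs
  imports "HOL-Algebra.Complete_Lattice" "HOL-Analysis.Analysis"
begin

section \<open>Frames and locales\<close>

text \<open>A locale is given by its frame (a complete lattice in the sense of HOL-Algebra); a map of
  locales \<open>X \<rightarrow> Y\<close> is given by the frame homomorphism from the frame of \<open>Y\<close> to that of \<open>X\<close>.\<close>

locale frame = complete_lattice L for L (structure) +
  assumes meet_sup_distrib:
    "\<lbrakk>x \<in> carrier L; A \<subseteq> carrier L\<rbrakk> \<Longrightarrow> x \<sqinter> \<Squnion>A = \<Squnion>((\<lambda>a. x \<sqinter> a) ` A)"

definition frame_hom :: "'a gorder \<Rightarrow> 'b gorder \<Rightarrow> ('a \<Rightarrow> 'b) \<Rightarrow> bool" where
  "frame_hom L M f \<longleftrightarrow>
     f \<in> carrier L \<rightarrow> carrier M \<and>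
     f \<top>\<^bsub>L\<^esub> = \<top>\<^bsub>M\<^esub> \<and>
     (\<forall>x\<in>carrier L. \<forall>y\<in>carrier L. f (x \<sqinter>\<^bsub>L\<^esub> y) = f x \<sqinter>\<^bsub>M\<^esub> f y) \<and>
     (\<forall>A\<subseteq>carrier L. f (\<Squnion>\<^bsub>L\<^esub>A) = \<Squnion>\<^bsub>M\<^esub>(f ` A))"

definition frame_iso :: "'a gorder \<Rightarrow> 'b gorder \<Rightarrow> ('a \<Rightarrow> 'b) \<Rightarrow> bool" where
  "frame_iso L M f \<longleftrightarrow> frame_hom L M f \<and> bij_betw f (carrier L) (carrier M)"

definition opens :: "'p topology \<Rightarrow> 'p set gorder" where
  "opens X = \<lparr>carrier = {U. openin X U}, eq = (=), le = (\<subseteq>)\<rparr>"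

text \<open>The type of the points of the space is fixed, since a definition cannot quantify over types;
  \<open>'a set\<close> is large enough for the space of completely prime filters, and lemma
  \<open>spatialI\<close> below shows that a space with points of any other type may be used as well.\<close>

definition spatial :: "'a gorder \<Rightarrow> bool" where
  "spatial L \<longleftrightarrow> (\<exists>(X :: 'a set topology) f. frame_iso L (opens X) f)"


section \<open>Propositional geometric theories and their classifying locales\<close>

text \<open>A relation symbol of a theory without sorts is nullary, so that a formula of such a theory
  is built from basic propositions and contains neither variables, equality nor quantifiers.
  In \<open>PDisj I F\<close>, only the values of \<open>F\<close> on the index set \<open>I\<close> matter.\<close>

datatype ('g, 'j) pform =
    PBasic 'g
  | PTrue
  | PAnd "('g, 'j) pform" "('g, 'j) pform"
  | PDisj "'j set" "'j \<Rightarrow> ('g, 'j) pform"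

definition PConj :: "('g, 'j) pform list \<Rightarrow> ('g, 'j) pform" where
  "PConj \<phi>s = foldr PAnd \<phi>s PTrue"

record ('g, 'j) ptheory =
  basics :: "'g set"
  paxioms :: "(('g, 'j) pform \<times> ('g, 'j) pform) set"

primrec psat :: "'g set \<Rightarrow> ('g, 'j) pform \<Rightarrow> bool" where
  "psat S (PBasic g) \<longleftrightarrow> g \<in> S"
| "psat S PTrue \<longleftrightarrow> True"
| "psat S (PAnd \<phi> \<psi>) \<longleftrightarrow> psat S \<phi> \<and> psat S \<psi>"
| "psat S (PDisj I F) \<longleftrightarrow> (\<exists>i\<in>I. psat S (F i))"

text \<open>The free frame on a set \<open>B\<close> consists of the upward closed sets of finite subsets of \<open>B\<close>, a
  finite set \<open>S\<close> standing for the meet of its elements; it interprets a formula \<open>\<phi>\<close> by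
  \<open>{S \<in> Fpow B. psat S \<phi>}\<close>. The frame presented by a set of relations \<open>\<phi> \<le> \<psi>\<close> is the quotient of
  the free frame by the least congruence enforcing them. Each congruence class is represented by
  its greatest element, and these elements are the \<open>D\<close> such that \<open>c \<inter> \<psi> \<subseteq> D\<close> implies
  \<open>c \<inter> \<phi> \<subseteq> D\<close> for all relations and all \<open>c\<close>; below, \<open>c\<close> is taken principal, which suffices.
  That this is the presented frame is confirmed by lemmas \<open>frame_classifying_frame\<close>,
  \<open>classifying_frame_relations\<close> and \<open>classifying_frame_universal\<close>.\<close>

definition pclosed :: "('g, 'j) ptheory \<Rightarrow> 'g set set \<Rightarrow> bool" where
  "pclosed P D \<longleftrightarrow>
     D \<subseteq> Fpow (basics P) \<and>
     (\<forall>S\<in>D. \<forall>T\<in>Fpow (basics P). S \<subseteq> T \<longrightarrow> T \<in> D) \<and>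
     (\<forall>(\<phi>, \<psi>)\<in>paxioms P. \<forall>S\<in>Fpow (basics P).
        psat S \<phi> \<and> (\<forall>T\<in>Fpow (basics P). S \<subseteq> T \<and> psat T \<psi> \<longrightarrow> T \<in> D) \<longrightarrow> S \<in> D)"

definition classifying_frame :: "('g, 'j) ptheory \<Rightarrow> 'g set set gorder" where
  "classifying_frame P = \<lparr>carrier = Collect (pclosed P), eq = (=), le = (\<subseteq>)\<rparr>"

definition pgen :: "('g, 'j) ptheory \<Rightarrow> 'g \<Rightarrow> 'g set set" where
  "pgen P g = \<Inter>{D. pclosed P D \<and> {g} \<in> D}"

text \<open>The frame homomorphism from a presented frame to \<open>L\<close> determined by its values \<open>f\<close> on
  generators (if these respect the relations, as in \<open>classifying_frame_universal\<close>).\<close>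

definition frame_lift :: "'a gorder \<Rightarrow> ('g \<Rightarrow> 'a) \<Rightarrow> 'g set set \<Rightarrow> 'a" where
  "frame_lift L f D = \<Squnion>\<^bsub>L\<^esub>((\<lambda>S. \<Sqinter>\<^bsub>L\<^esub>(f ` S)) ` D)"


section \<open>Geometric theories\<close>

text \<open>Variables are natural numbers. An equation carries the sort of its two sides, an existential
  quantifier its bound variable and the sort of that variable. The type \<open>'i\<close> indexes the
  disjunctions; as it is arbitrary, so is the size of the disjunctions.\<close>

datatype ('s, 'r, 'i) gform =
    GRel 'r "nat list"
  | GEq 's nat nat
  | GTrue
  | GAnd "('s, 'r, 'i) gform" "('s, 'r, 'i) gform"
  | GDisj "'i set" "'i \<Rightarrow> ('s, 'r, 'i) gform"
  | GEx nat 's "('s, 'r, 'i) gform"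

definition GConj :: "('s, 'r, 'i) gform list \<Rightarrow> ('s, 'r, 'i) gform" where
  "GConj \<phi>s = foldr GAnd \<phi>s GTrue"

text \<open>\<open>Sequent [(x1, X1), \<dots>, (xk, Xk)] \<phi> \<psi>\<close> is the sequent \<open>\<phi> \<turnstile> \<psi>\<close> in the context
  \<open>x1 : X1, \<dots>, xk : Xk\<close>.\<close>

datatype ('s, 'r, 'i) sequent =
  Sequent "(nat \<times> 's) list" "('s, 'r, 'i) gform" "('s, 'r, 'i) gform"

record ('s, 'r, 'i) gtheory =
  sorts :: "'s set"
  rels :: "'r set"
  arity :: "'r \<Rightarrow> 's list"
  axioms :: "('s, 'r, 'i) sequent set"

primrec wf_gform ::
  "('s, 'r, 'i) gtheory \<Rightarrow> ('s, 'r, 'i) gform \<Rightarrow> (nat \<Rightarrow> 's option) \<Rightarrow> bool" where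
  "wf_gform T (GRel R xs) = (\<lambda>\<Gamma>. R \<in> rels T \<and> map \<Gamma> xs = map Some (arity T R))"
| "wf_gform T (GEq X x y) = (\<lambda>\<Gamma>. X \<in> sorts T \<and> \<Gamma> x = Some X \<and> \<Gamma> y = Some X)"
| "wf_gform T GTrue = (\<lambda>\<Gamma>. True)"
| "wf_gform T (GAnd \<phi> \<psi>) = (\<lambda>\<Gamma>. wf_gform T \<phi> \<Gamma> \<and> wf_gform T \<psi> \<Gamma>)"
| "wf_gform T (GDisj I F) = (\<lambda>\<Gamma>. \<forall>i\<in>I. wf_gform T (F i) \<Gamma>)"
| "wf_gform T (GEx x X \<phi>) = (\<lambda>\<Gamma>. X \<in> sorts T \<and> wf_gform T \<phi> (\<Gamma>(x \<mapsto> X)))"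

fun wf_sequent :: "('s, 'r, 'i) gtheory \<Rightarrow> ('s, 'r, 'i) sequent \<Rightarrow> bool" where
  "wf_sequent T (Sequent \<Gamma> \<phi> \<psi>) \<longleftrightarrow>
     distinct (map fst \<Gamma>) \<and> snd ` set \<Gamma> \<subseteq> sorts T \<and>
     wf_gform T \<phi> (map_of \<Gamma>) \<and> wf_gform T \<psi> (map_of \<Gamma>)"

definition geometric_theory :: "('s, 'r, 'i) gtheory \<Rightarrow> bool" where
  "geometric_theory T \<longleftrightarrow>
     (\<forall>R\<in>rels T. set (arity T R) \<subseteq> sorts T) \<and> (\<forall>\<sigma>\<in>axioms T. wf_sequent T \<sigma>)"

definition countable_theory :: "('s, 'r, 'i) gtheory \<Rightarrow> bool" where
  "countable_theory T \<longleftrightarrow> countable (sorts T) \<and> countable (rels T) \<and> countable (axioms T)"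


section \<open>The propositional theory of a geometric theory\<close>

datatype ('s, 'r) bprop = BSim 's nat nat | BRel 'r "nat list"

text \<open>\<open>prop_form \<phi> \<nu>\<close> replaces each free variable \<open>x\<close> of \<open>\<phi>\<close> by the number \<open>\<nu> x\<close>. The type
  \<open>'i + nat\<close> indexes both the disjunctions in \<open>\<phi>\<close> and those that replace quantifiers.\<close>

primrec prop_form ::
  "('s, 'r, 'i) gform \<Rightarrow> (nat \<Rightarrow> nat) \<Rightarrow> (('s, 'r) bprop, 'i + nat) pform" where
  "prop_form (GRel R xs) = (\<lambda>\<nu>. PBasic (BRel R (map \<nu> xs)))"
| "prop_form (GEq X x y) = (\<lambda>\<nu>. PBasic (BSim X (\<nu> x) (\<nu> y)))"
| "prop_form GTrue = (\<lambda>\<nu>. PTrue)"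
| "prop_form (GAnd \<phi> \<psi>) = (\<lambda>\<nu>. PAnd (prop_form \<phi> \<nu>) (prop_form \<psi> \<nu>))"
| "prop_form (GDisj I F) =
     (\<lambda>\<nu>. PDisj (Inl ` I) (case_sum (\<lambda>i. prop_form (F i) \<nu>) (\<lambda>_. PTrue)))"
| "prop_form (GEx x X \<phi>) =
     (\<lambda>\<nu>. PDisj (range Inr)
        (case_sum (\<lambda>_. PTrue) (\<lambda>n. PAnd (PBasic (BSim X n n)) (prop_form \<phi> (\<nu>(x := n))))))"

definition assign :: "(nat \<times> 's) list \<Rightarrow> nat list \<Rightarrow> nat \<Rightarrow> nat" where
  "assign \<Gamma> ns = (\<lambda>x. the (map_of (zip (map fst \<Gamma>) ns) x))"

definition all_sim :: "'s list \<Rightarrow> nat list \<Rightarrow> nat list \<Rightarrow> (('s, 'r) bprop, 'j) pform" where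
  "all_sim Xs ns ms = PConj (map (\<lambda>(X, n, m). PBasic (BSim X n m)) (zip Xs (zip ns ms)))"

definition prop_theory ::
  "('s, 'r, 'i) gtheory \<Rightarrow> (('s, 'r) bprop, 'i + nat) ptheory" where
  "prop_theory T =
    \<lparr>basics =
       {BSim X n m | X n m. X \<in> sorts T} \<union>
       {BRel R ns | R ns. R \<in> rels T \<and> length ns = length (arity T R)},
     paxioms =
       {(PBasic (BSim X n m), PBasic (BSim X m n)) | X n m. X \<in> sorts T} \<union>
       {(PAnd (PBasic (BSim X n m)) (PBasic (BSim X m l)), PBasic (BSim X n l)) | X n m l.
          X \<in> sorts T} \<union>
       {(PAnd (PBasic (BRel R ns)) (all_sim (arity T R) ns ms), PBasic (BRel R ms)) | R ns ms.
          R \<in> rels T \<and> length ns = length (arity T R) \<and> length ms = length (arity T R)} \<union>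
       {(PBasic (BRel R ns), all_sim (arity T R) ns ns) | R ns.
          R \<in> rels T \<and> length ns = length (arity T R)} \<union>
       {(PAnd (all_sim (map snd \<Gamma>) ns ns) (prop_form \<phi> (assign \<Gamma> ns)),
         prop_form \<psi> (assign \<Gamma> ns)) | \<Gamma> \<phi> \<psi> ns.
          Sequent \<Gamma> \<phi> \<psi> \<in> axioms T \<and> length ns = length \<Gamma>}\<rparr>"


section \<open>Theories of isomorphisms\<close>

text \<open>\<open>iso_chain k T\<close> is the theory of \<open>k + 1\<close> models of \<open>T\<close> and isomorphisms between consecutive
  ones: the copies of \<open>T\<close> are numbered \<open>1, \<dots>, k + 1\<close>, the pair \<open>(X, j)\<close> is the \<open>j\<close>-th copy of the
  sort \<open>X\<close>, and \<open>Iso j X\<close> is the component at \<open>X\<close> of the isomorphism from the \<open>j\<close>-th model to the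
  next. So \<open>iso_chain 1 T\<close> is the theory of isomorphisms of \<open>T\<close>-models, with \<open>\<alpha> = Iso 1\<close>, and
  \<open>iso_chain 2 T\<close> is that of composable pairs, with \<open>\<beta> = Iso 1\<close> and \<open>\<gamma> = Iso 2\<close>.\<close>

datatype ('s, 'r) chain_rel = Copy nat 'r | Iso nat 's

definition iso_sort_axioms :: "nat \<Rightarrow> 's \<Rightarrow> ('s \<times> nat, ('s, 'r) chain_rel, 'i) sequent set" where
  "iso_sort_axioms j X =
    (let x = 0; x' = 1; y = 2; y' = 3;
         \<Gamma> = [(x, (X, j)), (x', (X, j)), (y, (X, Suc j)), (y', (X, Suc j))];
         \<phi> = GConj [GRel (Iso j X) [x, y], GRel (Iso j X) [x', y'], GEq (X, j) x x'];
         \<psi> = GConj [GRel (Iso j X) [x, y], GRel (Iso j X) [x', y'], GEq (X, Suc j) y y']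
     in {Sequent \<Gamma> \<phi> \<psi>, Sequent \<Gamma> \<psi> \<phi>,
         Sequent [(y, (X, Suc j))] GTrue (GEx x (X, j) (GRel (Iso j X) [x, y])),
         Sequent [(x, (X, j))] GTrue (GEx y (X, Suc j) (GRel (Iso j X) [x, y]))})"

definition iso_rel_axioms ::
  "nat \<Rightarrow> 'r \<Rightarrow> 's list \<Rightarrow> ('s \<times> nat, ('s, 'r) chain_rel, 'i) sequent set" where
  "iso_rel_axioms j R Xs =
    (let k = length Xs; xs = [0..<k]; ys = [k..<2 * k];
         \<Gamma> = zip xs (map (\<lambda>X. (X, j)) Xs) @ zip ys (map (\<lambda>X. (X, Suc j)) Xs);
         \<alpha> = GConj (map (\<lambda>(X, x, y). GRel (Iso j X) [x, y]) (zip Xs (zip xs ys)));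
         \<phi> = GAnd \<alpha> (GRel (Copy j R) xs);
         \<psi> = GAnd \<alpha> (GRel (Copy (Suc j) R) ys)
     in {Sequent \<Gamma> \<phi> \<psi>, Sequent \<Gamma> \<psi> \<phi>})"

definition iso_chain ::
  "nat \<Rightarrow> ('s, 'r, 'i) gtheory \<Rightarrow> ('s \<times> nat, ('s, 'r) chain_rel, 'i) gtheory" where
  "iso_chain k T =
    \<lparr>sorts = sorts T \<times> {1..k + 1},
     rels = {Copy j R | j R. j \<in> {1..k + 1} \<and> R \<in> rels T} \<union>
            {Iso j X | j X. j \<in> {1..k} \<and> X \<in> sorts T},
     arity = (\<lambda>Q. case Q of Copy j R \<Rightarrow> map (\<lambda>X. (X, j)) (arity T R)
                           | Iso j X \<Rightarrow> [(X, j), (X, Suc j)]),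
     axioms = (\<Union>j\<in>{1..k + 1}. map_sequent (\<lambda>X. (X, j)) (Copy j) ` axioms T) \<union>
              (\<Union>j\<in>{1..k}. \<Union>X\<in>sorts T. iso_sort_axioms j X) \<union>
              (\<Union>j\<in>{1..k}. \<Union>R\<in>rels T. iso_rel_axioms j R (arity T R))\<rparr>"


section \<open>Localic and topological groupoids\<close>

text \<open>The structure of a localic groupoid: the frames of the locales of objects, of morphisms and of
  composable pairs (target of the first equal to source of the second), and the frame
  homomorphisms of source, target, identity, inversion, composition and the two projections
  from composable pairs to morphisms.\<close>

record ('a, 'b, 'c) localic_groupoid =
  Obj :: "'a gorder"
  Mor :: "'b gorder"
  Comp :: "'c gorder"
  src :: "'a \<Rightarrow> 'b"
  tgt :: "'a \<Rightarrow> 'b"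
  ident :: "'b \<Rightarrow> 'a"
  invert :: "'b \<Rightarrow> 'b"
  compose :: "'b \<Rightarrow> 'c"
  proj1 :: "'b \<Rightarrow> 'c"
  proj2 :: "'b \<Rightarrow> 'c"

definition localic_groupoid_iso ::
  "('a, 'b, 'c) localic_groupoid \<Rightarrow> ('d, 'e, 'f) localic_groupoid \<Rightarrow> bool" where
  "localic_groupoid_iso G H \<longleftrightarrow>
    (\<exists>f0 f1 f2.
       frame_iso (Obj G) (Obj H) f0 \<and>
       frame_iso (Mor G) (Mor H) f1 \<and>
       frame_iso (Comp G) (Comp H) f2 \<and>
       (\<forall>u\<in>carrier (Obj G). f1 (src G u) = src H (f0 u)) \<and>
       (\<forall>u\<in>carrier (Obj G). f1 (tgt G u) = tgt H (f0 u)) \<and>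
       (\<forall>u\<in>carrier (Mor G). f0 (ident G u) = ident H (f1 u)) \<and>
       (\<forall>u\<in>carrier (Mor G). f1 (invert G u) = invert H (f1 u)) \<and>
       (\<forall>u\<in>carrier (Mor G). f2 (compose G u) = compose H (f1 u)) \<and>
       (\<forall>u\<in>carrier (Mor G). f2 (proj1 G u) = proj1 H (f1 u)) \<and>
       (\<forall>u\<in>carrier (Mor G). f2 (proj2 G u) = proj2 H (f1 u)))"

definition spatial_groupoid :: "('a, 'b, 'c) localic_groupoid \<Rightarrow> bool" where
  "spatial_groupoid G \<longleftrightarrow> spatial (Obj G) \<and> spatial (Mor G) \<and> spatial (Comp G)"

record ('p, 'q) top_groupoid =
  objects :: "'p topology"
  arrows :: "'q topology"
  source :: "'q \<Rightarrow> 'p"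
  target :: "'q \<Rightarrow> 'p"
  identity :: "'p \<Rightarrow> 'q"
  inversion :: "'q \<Rightarrow> 'q"
  composition :: "'q \<times> 'q \<Rightarrow> 'q"

definition composable :: "('p, 'q) top_groupoid \<Rightarrow> ('q \<times> 'q) topology" where
  "composable H =
     subtopology (prod_topology (arrows H) (arrows H)) {(f, g). target H f = source H g}"

locale topological_groupoid =
  fixes H :: "('p, 'q) top_groupoid"
  assumes continuous_source: "continuous_map (arrows H) (objects H) (source H)"
    and continuous_target: "continuous_map (arrows H) (objects H) (target H)"
    and continuous_identity: "continuous_map (objects H) (arrows H) (identity H)"
    and continuous_inversion: "continuous_map (arrows H) (arrows H) (inversion H)"
    and continuous_composition: "continuous_map (composable H) (arrows H) (composition H)"
    and source_identity: "x \<in> topspace (objects H) \<Longrightarrow> source H (identity H x) = x"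
    and target_identity: "x \<in> topspace (objects H) \<Longrightarrow> target H (identity H x) = x"
    and source_composition:
      "(f, g) \<in> topspace (composable H) \<Longrightarrow> source H (composition H (f, g)) = source H f"
    and target_composition:
      "(f, g) \<in> topspace (composable H) \<Longrightarrow> target H (composition H (f, g)) = target H g"
    and composition_assoc:
      "\<lbrakk>(f, g) \<in> topspace (composable H); (g, h) \<in> topspace (composable H)\<rbrakk> \<Longrightarrow>
       composition H (composition H (f, g), h) = composition H (f, composition H (g, h))"
    and identity_composition:
      "f \<in> topspace (arrows H) \<Longrightarrow> composition H (identity H (source H f), f) = f"
    and composition_identity:
      "f \<in> topspace (arrows H) \<Longrightarrow> composition H (f, identity H (target H f)) = f"
    and source_inversion: "f \<in> topspace (arrows H) \<Longrightarrow> source H (inversion H f) = target H f"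
    and target_inversion: "f \<in> topspace (arrows H) \<Longrightarrow> target H (inversion H f) = source H f"
    and composition_inversion:
      "f \<in> topspace (arrows H) \<Longrightarrow> composition H (f, inversion H f) = identity H (source H f)"
    and inversion_composition:
      "f \<in> topspace (arrows H) \<Longrightarrow> composition H (inversion H f, f) = identity H (target H f)"

definition opens_groupoid ::
  "('p, 'q) top_groupoid \<Rightarrow> ('p set, 'q set, ('q \<times> 'q) set) localic_groupoid" where
  "opens_groupoid H =
    \<lparr>Obj = opens (objects H),
     Mor = opens (arrows H),
     Comp = opens (composable H),
     src = (\<lambda>U. {f \<in> topspace (arrows H). source H f \<in> U}),
     tgt = (\<lambda>U. {f \<in> topspace (arrows H). target H f \<in> U}),
     ident = (\<lambda>U. {x \<in> topspace (objects H). identity H x \<in> U}),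
     invert = (\<lambda>U. {f \<in> topspace (arrows H). inversion H f \<in> U}),
     compose = (\<lambda>U. {p \<in> topspace (composable H). composition H p \<in> U}),
     proj1 = (\<lambda>U. {p \<in> topspace (composable H). fst p \<in> U}),
     proj2 = (\<lambda>U. {p \<in> topspace (composable H). snd p \<in> U})\<rparr>"


section \<open>The localic groupoid of a geometric theory\<close>

type_synonym ('s, 'r) chain_prop = "('s \<times> nat, ('s, 'r) chain_rel) bprop"

fun copy_prop :: "nat \<Rightarrow> ('s, 'r) bprop \<Rightarrow> ('s, 'r) chain_prop" where
  "copy_prop j (BSim X n m) = BSim (X, j) n m"
| "copy_prop j (BRel R ns) = BRel (Copy j R) ns"

fun ident_prop :: "('s, 'r) chain_prop \<Rightarrow> ('s, 'r) bprop" where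
  "ident_prop (BSim (X, j) n m) = BSim X n m"
| "ident_prop (BRel (Copy j R) ns) = BRel R ns"
| "ident_prop (BRel (Iso j X) [n, m]) = BSim X n m"

text \<open>Swaps the two copies, numbered 1 and 2.\<close>

fun invert_prop :: "('s, 'r) chain_prop \<Rightarrow> ('s, 'r) chain_prop" where
  "invert_prop (BSim (X, j) n m) = BSim (X, 3 - j) n m"
| "invert_prop (BRel (Copy j R) ns) = BRel (Copy (3 - j) R) ns"
| "invert_prop (BRel (Iso j X) [n, m]) = BRel (Iso j X) [m, n]"

fun shift_prop :: "('s, 'r) chain_prop \<Rightarrow> ('s, 'r) chain_prop" where
  "shift_prop (BSim (X, j) n m) = BSim (X, Suc j) n m"
| "shift_prop (BRel (Copy j R) ns) = BRel (Copy (Suc j) R) ns"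
| "shift_prop (BRel (Iso j X) ns) = BRel (Iso (Suc j) X) ns"

text \<open>The first and second copy in the theory of isomorphisms become the first and third copy in
  the theory of composable pairs.\<close>

fun compose_gen :: "(('s, 'r) chain_prop, 'j) ptheory \<Rightarrow> ('s, 'r) chain_prop \<Rightarrow>
    ('s, 'r) chain_prop set set" where
  "compose_gen P (BSim (X, j) n m) = pgen P (BSim (X, if j = 1 then 1 else 3) n m)"
| "compose_gen P (BRel (Copy j R) ns) = pgen P (BRel (Copy (if j = 1 then 1 else 3) R) ns)"
| "compose_gen P (BRel (Iso j X) [n, p]) =
     \<Squnion>\<^bsub>classifying_frame P\<^esub>
       (range (\<lambda>q. pgen P (BRel (Iso 1 X) [n, q]) \<sqinter>\<^bsub>classifying_frame P\<^esub> pgen P (BRel (Iso 2 X) [q, p])))"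

definition theory_groupoid :: "('s, 'r, 'i) gtheory \<Rightarrow>
    (('s, 'r) bprop set set, ('s, 'r) chain_prop set set, ('s, 'r) chain_prop set set)
      localic_groupoid" where
  "theory_groupoid T =
    (let P0 = prop_theory T;
         P1 = prop_theory (iso_chain 1 T);
         P2 = prop_theory (iso_chain 2 T);
         G0 = classifying_frame P0;
         G1 = classifying_frame P1;
         G2 = classifying_frame P2
     in \<lparr>Obj = G0,
         Mor = G1,
         Comp = G2,
         src = frame_lift G1 (\<lambda>g. pgen P1 (copy_prop 1 g)),
         tgt = frame_lift G1 (\<lambda>g. pgen P1 (copy_prop 2 g)),
         ident = frame_lift G0 (\<lambda>g. pgen P0 (ident_prop g)),
         invert = frame_lift G1 (\<lambda>g. pgen P1 (invert_prop g)),
         compose = frame_lift G2 (compose_gen P2),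
         proj1 = frame_lift G2 (pgen P2),
         proj2 = frame_lift G2 (\<lambda>g. pgen P2 (shift_prop g))\<rparr>)"

section \<open>The presented frame and spatiality\<close>

text \<open>The value of a formula in a frame \<open>L\<close>, given values \<open>f\<close> of the basic propositions, and the set
  of basic propositions on which it depends.\<close>

primrec pinterp :: "'a gorder \<Rightarrow> ('g \<Rightarrow> 'a) \<Rightarrow> ('g, 'j) pform \<Rightarrow> 'a" where
  "pinterp L f (PBasic g) = f g"
| "pinterp L f PTrue = \<top>\<^bsub>L\<^esub>"
| "pinterp L f (PAnd \<phi> \<psi>) = pinterp L f \<phi> \<sqinter>\<^bsub>L\<^esub> pinterp L f \<psi>"
| "pinterp L f (PDisj I F) = \<Squnion>\<^bsub>L\<^esub>((\<lambda>i. pinterp L f (F i)) ` I)"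

primrec pbasics :: "('g, 'j) pform \<Rightarrow> 'g set" where
  "pbasics (PBasic g) = {g}"
| "pbasics PTrue = {}"
| "pbasics (PAnd \<phi> \<psi>) = pbasics \<phi> \<union> pbasics \<psi>"
| "pbasics (PDisj I F) = (\<Union>i\<in>I. pbasics (F i))"

lemma sup_unique:
  assumes "partial_order L" and "least L x (Upper L A)"
  shows "\<Squnion>\<^bsub>L\<^esub>A = x"
  unfolding sup_def using assms
  by (intro some_equality) (simp_all add: partial_order.least_unique)

lemma inf_unique:
  assumes "partial_order L" and "greatest L x (Lower L A)"
  shows "\<Sqinter>\<^bsub>L\<^esub>A = x"
  unfolding inf_def using assms
  by (intro some_equality) (simp_all add: partial_order.greatest_unique)

lemma psat_mono: "psat S \<phi> \<Longrightarrow> S \<subseteq> T \<Longrightarrow> psat T \<phi>"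
  by (induction \<phi>) auto

definition pclosure :: "('g, 'j) ptheory \<Rightarrow> 'g set set \<Rightarrow> 'g set set" where
  "pclosure P E = \<Inter>{D. pclosed P D \<and> E \<subseteq> D}"

lemma pgen_eq: "pgen P g = pclosure P {{g}}"
  by (simp add: pgen_def pclosure_def)

lemma pclosed_top: "pclosed P (Fpow (basics P))"
  unfolding pclosed_def by auto

lemma pclosedD:
  assumes "pclosed P D"
  shows "D \<subseteq> Fpow (basics P)"
    and "S \<in> D \<Longrightarrow> T \<in> Fpow (basics P) \<Longrightarrow> S \<subseteq> T \<Longrightarrow> T \<in> D"
    and "(\<phi>, \<psi>) \<in> paxioms P \<Longrightarrow> S \<in> Fpow (basics P) \<Longrightarrow> psat S \<phi> \<Longrightarrow>
         (\<And>T. T \<in> Fpow (basics P) \<Longrightarrow> S \<subseteq> T \<Longrightarrow> psat T \<psi> \<Longrightarrow> T \<in> D) \<Longrightarrow> S \<in> D"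
proof -
  show "D \<subseteq> Fpow (basics P)"
    using assms by (simp add: pclosed_def)
  show "S \<in> D \<Longrightarrow> T \<in> Fpow (basics P) \<Longrightarrow> S \<subseteq> T \<Longrightarrow> T \<in> D"
    using assms by (simp add: pclosed_def)
  assume ax: "(\<phi>, \<psi>) \<in> paxioms P"
  have "\<forall>(\<phi>, \<psi>)\<in>paxioms P. \<forall>S\<in>Fpow (basics P).
      psat S \<phi> \<and> (\<forall>T\<in>Fpow (basics P). S \<subseteq> T \<and> psat T \<psi> \<longrightarrow> T \<in> D) \<longrightarrow> S \<in> D"
    using assms by (simp add: pclosed_def)
  from bspec[OF this ax]
  show "S \<in> Fpow (basics P) \<Longrightarrow> psat S \<phi> \<Longrightarrow>
      (\<And>T. T \<in> Fpow (basics P) \<Longrightarrow> S \<subseteq> T \<Longrightarrow> psat T \<psi> \<Longrightarrow> T \<in> D) \<Longrightarrow> S \<in> D"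
    by simp
qed

lemma pclosedI:
  assumes "D \<subseteq> Fpow (basics P)"
    and "\<And>S T. S \<in> D \<Longrightarrow> T \<in> Fpow (basics P) \<Longrightarrow> S \<subseteq> T \<Longrightarrow> T \<in> D"
    and "\<And>\<phi> \<psi> S. (\<phi>, \<psi>) \<in> paxioms P \<Longrightarrow> S \<in> Fpow (basics P) \<Longrightarrow> psat S \<phi> \<Longrightarrow>
         (\<And>T. T \<in> Fpow (basics P) \<Longrightarrow> S \<subseteq> T \<Longrightarrow> psat T \<psi> \<Longrightarrow> T \<in> D) \<Longrightarrow> S \<in> D"
  shows "pclosed P D"
  unfolding pclosed_def
proof (intro conjI ballI impI allI)
  fix a
  assume "a \<in> paxioms P"
  then show "case a of (\<phi>, \<psi>) \<Rightarrow> \<forall>S\<in>Fpow (basics P).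
      psat S \<phi> \<and> (\<forall>T\<in>Fpow (basics P). S \<subseteq> T \<and> psat T \<psi> \<longrightarrow> T \<in> D) \<longrightarrow> S \<in> D"
    using assms(3) by (cases a) simp
qed (fact assms(1), rule assms(2))

lemma pclosed_Inter:
  assumes "\<A> \<noteq> {}" and "\<And>D. D \<in> \<A> \<Longrightarrow> pclosed P D"
  shows "pclosed P (\<Inter>\<A>)"
proof (rule pclosedI)
  show "\<Inter>\<A> \<subseteq> Fpow (basics P)"
    using assms pclosedD(1) by blast
  fix S T
  assume "S \<in> \<Inter>\<A>" "T \<in> Fpow (basics P)" "S \<subseteq> T"
  then show "T \<in> \<Inter>\<A>"
    using pclosedD(2)[OF assms(2)] by (meson InterI InterE)
next
  fix \<phi> \<psi> S
  assume ax: "(\<phi>, \<psi>) \<in> paxioms P" "S \<in> Fpow (basics P)" "psat S \<phi>"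
    and *: "\<And>T. T \<in> Fpow (basics P) \<Longrightarrow> S \<subseteq> T \<Longrightarrow> psat T \<psi> \<Longrightarrow> T \<in> \<Inter>\<A>"
  have "S \<in> D" if D: "D \<in> \<A>" for D
    by (rule pclosedD(3)[OF assms(2)[OF D] ax]) (use * D in blast)
  then show "S \<in> \<Inter>\<A>"
    by blast
qed

lemma pclosed_pclosure:
  assumes "E \<subseteq> Fpow (basics P)"
  shows "pclosed P (pclosure P E)"
  unfolding pclosure_def by (rule pclosed_Inter) (use assms pclosed_top in auto)

lemma pclosed_pclosure_Union:
  "A \<subseteq> Collect (pclosed P) \<Longrightarrow> pclosed P (pclosure P (\<Union>A))"
  by (rule pclosed_pclosure) (use pclosedD(1) in blast)

lemma pclosure_increasing: "E \<subseteq> pclosure P E"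
  by (auto simp: pclosure_def)

lemma pclosure_least: "pclosed P D \<Longrightarrow> E \<subseteq> D \<Longrightarrow> pclosure P E \<subseteq> D"
  by (auto simp: pclosure_def)

lemma classifying_frame_simps [simp]:
  "carrier (classifying_frame P) = Collect (pclosed P)"
  "le (classifying_frame P) = (\<subseteq>)"
  "eq (classifying_frame P) = (=)"
  by (simp_all add: classifying_frame_def)

lemma partial_order_classifying_frame: "partial_order (classifying_frame P)"
  by unfold_locales auto

lemma sup_classifying_frame_least:
  assumes A: "A \<subseteq> Collect (pclosed P)"
  shows "least (classifying_frame P) (pclosure P (\<Union>A)) (Upper (classifying_frame P) A)"
proof (rule least_UpperI)
  have "\<Union>A \<subseteq> Fpow (basics P)"
    using A pclosedD(1) by blast
  then show "pclosure P (\<Union>A) \<in> carrier (classifying_frame P)"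
    by (simp add: pclosed_pclosure)
  show "x \<sqsubseteq>\<^bsub>classifying_frame P\<^esub> pclosure P (\<Union>A)" if "x \<in> A" for x
    using that pclosure_increasing[of "\<Union>A" P] Union_upper[of x A]
    by (simp add: subset_trans)
  show "pclosure P (\<Union>A) \<sqsubseteq>\<^bsub>classifying_frame P\<^esub> y"
    if "y \<in> Upper (classifying_frame P) A" for y
  proof -
    have "pclosed P y" and "\<And>x. x \<in> A \<Longrightarrow> x \<subseteq> y"
      using that A unfolding Upper_def by simp_all blast
    then show ?thesis
      by (simp add: Sup_least pclosure_least)
  qed
  show "A \<subseteq> carrier (classifying_frame P)"
    using A by simp
qed

lemma inf_classifying_frame_greatest:
  assumes A: "A \<subseteq> Collect (pclosed P)"
  shows "greatest (classifying_frame P) (Fpow (basics P) \<inter> \<Inter>A) (Lower (classifying_frame P) A)"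
proof (rule greatest_LowerI)
  have "pclosed P (\<Inter>(insert (Fpow (basics P)) A))"
    by (rule pclosed_Inter) (use A pclosed_top in blast)+
  then show "Fpow (basics P) \<inter> \<Inter>A \<in> carrier (classifying_frame P)"
    by simp
  show "Fpow (basics P) \<inter> \<Inter>A \<sqsubseteq>\<^bsub>classifying_frame P\<^esub> x" if "x \<in> A" for x
    using that by (simp add: Inter_lower le_infI2)
  show "y \<sqsubseteq>\<^bsub>classifying_frame P\<^esub> (Fpow (basics P) \<inter> \<Inter>A)"
    if "y \<in> Lower (classifying_frame P) A" for y
  proof -
    have "pclosed P y" and "\<And>x. x \<in> A \<Longrightarrow> y \<subseteq> x"
      using that A unfolding Lower_def by simp_all blast
    then show ?thesis
      using pclosedD(1) by (simp add: Inf_greatest)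
  qed
  show "A \<subseteq> carrier (classifying_frame P)"
    using A by simp
qed

lemma complete_lattice_classifying_frame: "complete_lattice (classifying_frame P)"
proof -
  interpret partial_order "classifying_frame P"
    by (rule partial_order_classifying_frame)
  show ?thesis
  proof
    fix A
    assume "A \<subseteq> carrier (classifying_frame P)"
    then have "A \<subseteq> Collect (pclosed P)"
      by simp
    then show "\<exists>s. is_lub (classifying_frame P) s A" "\<exists>i. is_glb (classifying_frame P) i A"
      using sup_classifying_frame_least inf_classifying_frame_greatest by blast+
  qed
qed

lemma sup_classifying_frame:
  "A \<subseteq> Collect (pclosed P) \<Longrightarrow> \<Squnion>\<^bsub>classifying_frame P\<^esub>A = pclosure P (\<Union>A)"
  by (rule sup_unique[OF partial_order_classifying_frame sup_classifying_frame_least])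

lemma inf_classifying_frame:
  "A \<subseteq> Collect (pclosed P) \<Longrightarrow> \<Sqinter>\<^bsub>classifying_frame P\<^esub>A = Fpow (basics P) \<inter> \<Inter>A"
  by (rule inf_unique[OF partial_order_classifying_frame inf_classifying_frame_greatest])

lemma meet_classifying_frame:
  assumes "pclosed P D" and "pclosed P E"
  shows "D \<sqinter>\<^bsub>classifying_frame P\<^esub> E = D \<inter> E"
proof -
  have "D \<sqinter>\<^bsub>classifying_frame P\<^esub> E = Fpow (basics P) \<inter> \<Inter>{D, E}"
    unfolding meet_def by (rule inf_classifying_frame) (use assms in simp)
  then show ?thesis
    using pclosedD(1)[OF assms(1)] by blast
qed

lemma top_classifying_frame: "\<top>\<^bsub>classifying_frame P\<^esub> = Fpow (basics P)"
proof -
  interpret complete_lattice "classifying_frame P"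
    by (rule complete_lattice_classifying_frame)
  have "Fpow (basics P) \<in> carrier (classifying_frame P)"
    by (simp add: pclosed_top)
  moreover have "\<top>\<^bsub>classifying_frame P\<^esub> \<in> carrier (classifying_frame P)"
    by (rule top_closed)
  ultimately show ?thesis
    using top_higher[of "Fpow (basics P)"] by (simp add: pclosedD(1) subset_antisym)
qed

lemma pclosed_imp:
  assumes E: "pclosed P E"
    and x: "x \<subseteq> Fpow (basics P)"
      "\<And>S T. S \<in> x \<Longrightarrow> T \<in> Fpow (basics P) \<Longrightarrow> S \<subseteq> T \<Longrightarrow> T \<in> x"
  shows "pclosed P {S \<in> Fpow (basics P). \<forall>T\<in>x. S \<subseteq> T \<longrightarrow> T \<in> E}" (is "pclosed P ?D")
proof (rule pclosedI)
  show "T \<in> ?D" if "S \<in> ?D" "T \<in> Fpow (basics P)" "S \<subseteq> T" for S T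
    using that by blast
  fix \<phi> \<psi> S
  assume ax: "(\<phi>, \<psi>) \<in> paxioms P" and S: "S \<in> Fpow (basics P)" "psat S \<phi>"
    and *: "\<And>T. T \<in> Fpow (basics P) \<Longrightarrow> S \<subseteq> T \<Longrightarrow> psat T \<psi> \<Longrightarrow> T \<in> ?D"
  have "T \<in> E" if T: "T \<in> x" "S \<subseteq> T" for T
  proof (rule pclosedD(3)[OF E ax])
    show "T \<in> Fpow (basics P)"
      using T x by blast
    show "psat T \<phi>"
      using S T psat_mono by blast
    fix T'
    assume T': "T' \<in> Fpow (basics P)" "T \<subseteq> T'" "psat T' \<psi>"
    then have "T' \<in> ?D"
      using * T by blast
    moreover have "T' \<in> x"
      using x(2) T T' by blast
    ultimately show "T' \<in> E"
      by blast
  qed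
  then show "S \<in> ?D"
    using S by simp
qed blast

lemma frame_classifying_frame: "frame (classifying_frame P)"
proof -
  interpret complete_lattice "classifying_frame P"
    by (rule complete_lattice_classifying_frame)
  show ?thesis
  proof
    fix x A
    assume "x \<in> carrier (classifying_frame P)" and "A \<subseteq> carrier (classifying_frame P)"
    then have x: "pclosed P x" and A: "A \<subseteq> Collect (pclosed P)"
      by auto
    let ?A' = "(\<lambda>a. x \<sqinter>\<^bsub>classifying_frame P\<^esub> a) ` A"
    have A'_eq: "?A' = (\<lambda>a. x \<inter> a) ` A"
      by (intro image_cong refl meet_classifying_frame) (use x A in blast)+
    have A': "?A' \<subseteq> Collect (pclosed P)"
      using x A meet_closed by auto
    define E where "E = pclosure P (\<Union>?A')"
    have E: "pclosed P E"
      unfolding E_def using pclosed_pclosure_Union[OF A'] .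
    have sup_closed: "pclosed P (pclosure P (\<Union>A))"
      using pclosed_pclosure_Union[OF A] .
    define D where "D = {S \<in> Fpow (basics P). \<forall>T\<in>x. S \<subseteq> T \<longrightarrow> T \<in> E}"
    have "pclosed P D"
      unfolding D_def by (rule pclosed_imp) (use E pclosedD(1,2)[OF x] in blast)+
    moreover have "\<Union>A \<subseteq> D"
    proof
      fix S
      assume "S \<in> \<Union>A"
      then obtain a where a: "a \<in> A" "S \<in> a"
        by blast
      then have a_closed: "pclosed P a"
        using A by blast
      have "T \<in> E" if "T \<in> x" "S \<subseteq> T" for T
      proof -
        have "T \<in> x \<inter> a"
          using that a pclosedD(2)[OF a_closed] pclosedD(1)[OF x] by blast
        then show ?thesis
          using a pclosure_increasing[of "\<Union>?A'" P] unfolding E_def A'_eq by blast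
      qed
      then show "S \<in> D"
        using a pclosedD(1)[OF a_closed] unfolding D_def by blast
    qed
    ultimately have "pclosure P (\<Union>A) \<subseteq> D"
      by (rule pclosure_least)
    then have "x \<inter> pclosure P (\<Union>A) \<subseteq> E"
      by (auto simp: D_def)
    moreover have "E \<subseteq> x \<inter> pclosure P (\<Union>A)"
      unfolding E_def
    proof (rule pclosure_least)
      show "pclosed P (x \<inter> pclosure P (\<Union>A))"
        using pclosed_Inter[of "{x, pclosure P (\<Union>A)}" P] x sup_closed by auto
      show "\<Union>?A' \<subseteq> x \<inter> pclosure P (\<Union>A)"
        unfolding A'_eq using pclosure_increasing[of "\<Union>A" P] by auto
    qed
    ultimately show "x \<sqinter>\<^bsub>classifying_frame P\<^esub> \<Squnion>\<^bsub>classifying_frame P\<^esub>A =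
        \<Squnion>\<^bsub>classifying_frame P\<^esub>?A'"
      unfolding sup_classifying_frame[OF A] sup_classifying_frame[OF A']
      using meet_classifying_frame[OF x sup_closed] by (auto simp: E_def)
  qed
qed

lemma (in complete_lattice) inf_empty: "\<Sqinter>{} = \<top>"
  using weak.weak_inf_empty unfolding eq_is_equal .

lemma (in complete_lattice) inf_insert:
  "a \<in> carrier L \<Longrightarrow> A \<subseteq> carrier L \<Longrightarrow> \<Sqinter>(insert a A) = a \<sqinter> \<Sqinter>A"
  using weak.weak_inf_insert unfolding eq_is_equal .

lemma (in frame) meet_sup_sup_le:
  assumes X: "X \<subseteq> carrier L" and Y: "Y \<subseteq> carrier L" and u: "u \<in> carrier L"
    and le: "\<And>x y. x \<in> X \<Longrightarrow> y \<in> Y \<Longrightarrow> x \<sqinter> y \<sqsubseteq> u"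
  shows "\<Squnion>X \<sqinter> \<Squnion>Y \<sqsubseteq> u"
proof -
  have "\<Squnion>X \<sqinter> y \<sqsubseteq> u" if y: "y \<in> Y" for y
  proof -
    have yc: "y \<in> carrier L"
      using y Y by blast
    have "\<Squnion>X \<sqinter> y = \<Squnion>((\<lambda>x. y \<sqinter> x) ` X)"
      using meet_sup_distrib[OF yc X] by (simp add: meet_comm)
    also have "\<dots> \<sqsubseteq> u"
    proof (rule sup_least[OF _ u])
      show "(\<lambda>x. y \<sqinter> x) ` X \<subseteq> carrier L"
        using X yc by (auto intro!: meet_closed)
      show "z \<sqsubseteq> u" if z: "z \<in> (\<lambda>x. y \<sqinter> x) ` X" for z
      proof -
        obtain x where "x \<in> X" "z = y \<sqinter> x"
          using z by blast
        then show ?thesis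
          using le[OF _ y] by (simp add: meet_comm[of L y])
      qed
    qed
    finally show ?thesis .
  qed
  moreover have "\<Squnion>X \<sqinter> \<Squnion>Y = \<Squnion>((\<lambda>y. \<Squnion>X \<sqinter> y) ` Y)"
    using X Y by (intro meet_sup_distrib sup_closed)
  moreover have "(\<lambda>y. \<Squnion>X \<sqinter> y) ` Y \<subseteq> carrier L"
    using X Y by (auto intro!: meet_closed sup_closed)
  ultimately show ?thesis
    using u by (auto intro!: sup_least)
qed

locale frame_presentation = frame L for L :: "'a gorder" (structure) +
  fixes P :: "('g, 'j) ptheory" and f :: "'g \<Rightarrow> 'a"
  assumes f_closed: "\<And>g. g \<in> basics P \<Longrightarrow> f g \<in> carrier L"
    and axioms_basics: "\<And>\<phi> \<psi>. (\<phi>, \<psi>) \<in> paxioms P \<Longrightarrow> pbasics \<phi> \<union> pbasics \<psi> \<subseteq> basics P"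
    and axioms_hold: "\<And>\<phi> \<psi>. (\<phi>, \<psi>) \<in> paxioms P \<Longrightarrow> pinterp L f \<phi> \<sqsubseteq> pinterp L f \<psi>"
begin

definition M :: "'g set \<Rightarrow> 'a" where
  "M S = \<Sqinter>(f ` S)"

lemma image_closed: "S \<in> Fpow (basics P) \<Longrightarrow> f ` S \<subseteq> carrier L"
  using f_closed by (auto simp: Fpow_def)

lemma M_closed: "S \<in> Fpow (basics P) \<Longrightarrow> M S \<in> carrier L"
  unfolding M_def by (intro inf_closed image_closed)

lemma M_image_closed: "E \<subseteq> Fpow (basics P) \<Longrightarrow> M ` E \<subseteq> carrier L"
  using M_closed by blast

lemma frame_lift_eq: "frame_lift L f E = \<Squnion>(M ` E)"
  by (simp add: frame_lift_def M_def)

lemma lift_closed: "E \<subseteq> Fpow (basics P) \<Longrightarrow> \<Squnion>(M ` E) \<in> carrier L"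
  by (intro sup_closed M_image_closed)

lemma M_antimono:
  assumes "S \<subseteq> T" and "T \<in> Fpow (basics P)"
  shows "M T \<sqsubseteq> M S"
proof -
  have S: "S \<in> Fpow (basics P)"
    using assms finite_subset unfolding Fpow_def by blast
  show ?thesis
    unfolding M_def
  proof (rule inf_greatest)
    show "\<Sqinter>(f ` T) \<sqsubseteq> x" if "x \<in> f ` S" for x
      using that assms image_closed by (intro inf_lower) auto
  qed (use S assms image_closed in \<open>auto intro!: inf_closed\<close>)
qed

lemma Un_Fpow: "S \<in> Fpow B \<Longrightarrow> T \<in> Fpow B \<Longrightarrow> S \<union> T \<in> Fpow B"
  by (auto simp: Fpow_def)

lemma M_Un:
  assumes "S \<in> Fpow (basics P)" and "T \<in> Fpow (basics P)"
  shows "M S \<sqinter> M T \<sqsubseteq> M (S \<union> T)"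
proof -
  have c: "M S \<in> carrier L" "M T \<in> carrier L" "M S \<sqinter> M T \<in> carrier L"
    using assms M_closed meet_closed by blast+
  show ?thesis
    unfolding M_def[of "S \<union> T"]
  proof (rule inf_greatest[OF _ c(3)])
    show "f ` (S \<union> T) \<subseteq> carrier L"
      using assms by (intro image_closed Un_Fpow)
    fix x
    assume "x \<in> f ` (S \<union> T)"
    then consider "x \<in> f ` S" | "x \<in> f ` T"
      by blast
    then show "M S \<sqinter> M T \<sqsubseteq> x"
    proof cases
      case 1
      then have "M S \<sqsubseteq> x" "x \<in> carrier L"
        using assms image_closed unfolding M_def by (blast intro: inf_lower)+
      then show ?thesis
        using le_trans[OF meet_left[OF c(1,2)]] c by blast
    next
      case 2
      then have "M T \<sqsubseteq> x" "x \<in> carrier L"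
        using assms image_closed unfolding M_def by (blast intro: inf_lower)+
      then show ?thesis
        using le_trans[OF meet_right[OF c(1,2)]] c by blast
    qed
  qed
qed

lemma pinterp_closed: "pbasics \<phi> \<subseteq> basics P \<Longrightarrow> pinterp L f \<phi> \<in> carrier L"
proof (induction \<phi>)
  case (PDisj I F)
  then show ?case
    by (auto intro!: sup_closed)
qed (auto intro!: f_closed meet_closed)

lemma pinterp_image_closed:
  assumes "pbasics (PDisj I F) \<subseteq> basics P"
  shows "(\<lambda>i. pinterp L f (F i)) ` I \<subseteq> carrier L"
proof (rule image_subsetI)
  fix i
  assume "i \<in> I"
  then have "pbasics (F i) \<subseteq> basics P"
    using assms by auto
  then show "pinterp L f (F i) \<in> carrier L"
    by (rule pinterp_closed)
qed

lemma M_le_pinterp: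
  "pbasics \<phi> \<subseteq> basics P \<Longrightarrow> S \<in> Fpow (basics P) \<Longrightarrow> psat S \<phi> \<Longrightarrow> M S \<sqsubseteq> pinterp L f \<phi>"
proof (induction \<phi>)
  case (PBasic g)
  then show ?case
    using image_closed[of S] unfolding M_def by (auto intro!: inf_lower)
next
  case PTrue
  then show ?case
    using M_closed by auto
next
  case (PAnd \<phi> \<psi>)
  then show ?case
    using M_closed pinterp_closed by (auto intro!: meet_le)
next
  case (PDisj I F)
  then obtain i where i: "i \<in> I" "psat S (F i)"
    by auto
  have b: "pbasics (F i) \<subseteq> basics P"
    using PDisj.prems i by auto
  have le: "M S \<sqsubseteq> pinterp L f (F i)"
    by (rule PDisj.IH[OF rangeI b PDisj.prems(2) i(2)])
  have c: "(\<lambda>i. pinterp L f (F i)) ` I \<subseteq> carrier L"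
    by (rule pinterp_image_closed[OF PDisj.prems(1)])
  then have "pinterp L f (F i) \<sqsubseteq> \<Squnion>((\<lambda>i. pinterp L f (F i)) ` I)"
    using i by (intro sup_upper) auto
  then show ?case
    using le_trans[OF le] M_closed[OF PDisj.prems(2)] pinterp_closed[OF b] sup_closed[OF c]
    by simp
qed

lemma pinterp_le_lift:
  fixes \<phi> :: "('g, 'j) pform"
  shows "pbasics \<phi> \<subseteq> basics P \<Longrightarrow>
   pinterp L f \<phi> \<sqsubseteq> \<Squnion>(M ` {S \<in> Fpow (basics P). psat S \<phi>})"
proof (induction \<phi>)
  case (PBasic g)
  then have g: "{g} \<in> Fpow (basics P)"
    by (simp add: Fpow_def)
  have "M {g} \<sqsubseteq> \<Squnion>(M ` {S \<in> Fpow (basics P). psat S (PBasic g)})"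
    using g by (intro sup_upper M_image_closed) auto
  moreover have "M {g} = f g"
    using PBasic f_closed unfolding M_def by simp
  ultimately show ?case
    by simp
next
  case PTrue
  have e: "{} \<in> Fpow (basics P)"
    by (simp add: Fpow_def)
  have "\<top> \<sqsubseteq> M {}"
    unfolding M_def by (rule inf_greatest) auto
  moreover have "M {} \<sqsubseteq> \<Squnion>(M ` {S \<in> Fpow (basics P). psat S PTrue})"
    using e by (intro sup_upper M_image_closed) auto
  ultimately show ?case
    using le_trans[of \<top> "M {}"] M_closed[OF e]
      lift_closed[of "{S \<in> Fpow (basics P). psat S PTrue}"] by auto
next
  case (PAnd \<phi> \<psi>)
  let ?X = "\<lambda>\<phi>. {S \<in> Fpow (basics P). psat S \<phi>}"
  have b: "pbasics \<phi> \<subseteq> basics P" "pbasics \<psi> \<subseteq> basics P"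
    using PAnd.prems by auto
  have c: "\<Squnion>(M ` ?X \<xi>) \<in> carrier L" for \<xi> :: "('g, 'j) pform"
    by (rule lift_closed) blast
  note p = pinterp_closed[OF b(1)] pinterp_closed[OF b(2)]
  have "pinterp L f \<phi> \<sqinter> pinterp L f \<psi> \<sqsubseteq> \<Squnion>(M ` ?X \<phi>) \<sqinter> \<Squnion>(M ` ?X \<psi>)"
  proof (rule meet_le)
    show "pinterp L f \<phi> \<sqinter> pinterp L f \<psi> \<sqsubseteq> \<Squnion>(M ` ?X \<phi>)"
      by (rule le_trans[OF meet_left[OF p] PAnd.IH(1)[OF b(1)]]) (simp_all add: p c)
    show "pinterp L f \<phi> \<sqinter> pinterp L f \<psi> \<sqsubseteq> \<Squnion>(M ` ?X \<psi>)"
      by (rule le_trans[OF meet_right[OF p] PAnd.IH(2)[OF b(2)]]) (simp_all add: p c)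
  qed (simp_all add: p c)
  moreover have "\<Squnion>(M ` ?X \<phi>) \<sqinter> \<Squnion>(M ` ?X \<psi>) \<sqsubseteq> \<Squnion>(M ` ?X (PAnd \<phi> \<psi>))"
  proof (rule meet_sup_sup_le)
    fix x y
    assume "x \<in> M ` ?X \<phi>" and "y \<in> M ` ?X \<psi>"
    then obtain S T where S: "S \<in> ?X \<phi>" "x = M S" and T: "T \<in> ?X \<psi>" "y = M T"
      by blast
    have ST: "S \<union> T \<in> ?X (PAnd \<phi> \<psi>)"
      using S T Un_Fpow[of S "basics P" T] by (auto intro: psat_mono)
    have le: "M (S \<union> T) \<sqsubseteq> \<Squnion>(M ` ?X (PAnd \<phi> \<psi>))"
      using ST by (intro sup_upper M_image_closed) blast+
    have "M S \<sqinter> M T \<sqsubseteq> M (S \<union> T)"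
      using S T by (intro M_Un) auto
    then show "x \<sqinter> y \<sqsubseteq> \<Squnion>(M ` ?X (PAnd \<phi> \<psi>))"
      unfolding S(2) T(2)
      by (rule le_trans[OF _ le]) (use c[of "PAnd \<phi> \<psi>"] S T ST M_closed in simp_all)
  qed (use c[of "PAnd \<phi> \<psi>"] in \<open>auto intro!: M_closed\<close>)
  ultimately have "pinterp L f \<phi> \<sqinter> pinterp L f \<psi> \<sqsubseteq> \<Squnion>(M ` ?X (PAnd \<phi> \<psi>))"
    by (rule le_trans) (use c[of "PAnd \<phi> \<psi>"] in \<open>simp_all add: p c\<close>)
  then show ?case
    by simp
next
  case (PDisj I F)
  let ?X = "\<lambda>\<phi>. {S \<in> Fpow (basics P). psat S \<phi>}"
  have c: "\<Squnion>(M ` ?X \<xi>) \<in> carrier L" for \<xi> :: "('g, 'j) pform"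
    by (rule lift_closed) blast
  have "pinterp L f (F i) \<sqsubseteq> \<Squnion>(M ` ?X (PDisj I F))" if i: "i \<in> I" for i
  proof -
    have b: "pbasics (F i) \<subseteq> basics P"
      using PDisj.prems i by auto
    have "\<Squnion>(M ` ?X (F i)) \<sqsubseteq> \<Squnion>(M ` ?X (PDisj I F))"
    proof (rule sup_least[OF _ c])
      show "x \<sqsubseteq> \<Squnion>(M ` ?X (PDisj I F))" if "x \<in> M ` ?X (F i)" for x
        using that i by (intro sup_upper M_image_closed) auto
    qed (auto intro!: M_closed)
    then show ?thesis
      by (rule le_trans[OF PDisj.IH[OF rangeI b]])
        (use c[of "PDisj I F"] in \<open>simp_all add: pinterp_closed[OF b] c\<close>)
  qed
  then show ?case
    using c[of "PDisj I F"] pinterp_image_closed[OF PDisj.prems] by (auto intro!: sup_least)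
qed

lemma pclosed_below:
  assumes u: "u \<in> carrier L"
  shows "pclosed P {S \<in> Fpow (basics P). M S \<sqsubseteq> u}" (is "pclosed P ?D")
proof (rule pclosedI)
  show "T \<in> ?D" if S: "S \<in> ?D" and T: "T \<in> Fpow (basics P)" "S \<subseteq> T" for S T
  proof -
    have "S \<in> Fpow (basics P)" "M S \<sqsubseteq> u"
      using S by auto
    then show ?thesis
      using le_trans[OF M_antimono[OF T(2,1)], of u] M_closed T(1) u by simp
  qed
  fix \<phi> \<psi> S
  assume ax: "(\<phi>, \<psi>) \<in> paxioms P" and S: "S \<in> Fpow (basics P)" "psat S \<phi>"
    and *: "\<And>T. T \<in> Fpow (basics P) \<Longrightarrow> S \<subseteq> T \<Longrightarrow> psat T \<psi> \<Longrightarrow> T \<in> ?D"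
  let ?X = "{S \<in> Fpow (basics P). psat S \<psi>}"
  have b: "pbasics \<phi> \<subseteq> basics P" "pbasics \<psi> \<subseteq> basics P"
    using axioms_basics[OF ax] by auto
  note c = M_closed[OF S(1)] pinterp_closed[OF b(1)] pinterp_closed[OF b(2)]
  have X: "M ` ?X \<subseteq> carrier L"
    by (rule M_image_closed) blast
  have "M S \<sqsubseteq> pinterp L f \<psi>"
    by (rule le_trans[OF M_le_pinterp[OF b(1) S] axioms_hold[OF ax]]) (simp_all add: c)
  then have "M S \<sqsubseteq> \<Squnion>(M ` ?X)"
    by (rule le_trans[OF _ pinterp_le_lift[OF b(2)]]) (simp_all add: c sup_closed[OF X])
  then have "M S \<sqsubseteq> \<Squnion>{M S} \<sqinter> \<Squnion>(M ` ?X)"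
    using c X by (intro meet_le) (auto intro!: sup_closed)
  moreover have "\<Squnion>{M S} \<sqinter> \<Squnion>(M ` ?X) \<sqsubseteq> u"
  proof (rule meet_sup_sup_le[OF _ X u])
    fix x y
    assume "x \<in> {M S}" "y \<in> M ` ?X"
    then obtain T where T: "T \<in> Fpow (basics P)" "psat T \<psi>" and xy: "x = M S" "y = M T"
      by blast
    have "S \<union> T \<in> ?D"
      using S T by (intro * Un_Fpow) (auto intro: psat_mono)
    then show "x \<sqinter> y \<sqsubseteq> u"
      unfolding xy
      using le_trans[OF M_Un[OF S(1) T(1)], of u] M_closed[OF S(1)] M_closed[OF T(1)] u M_closed
      by simp
  qed (use c in blast)
  moreover have "\<Squnion>{M S} \<sqinter> \<Squnion>(M ` ?X) \<in> carrier L"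
    using c X by (intro meet_closed sup_closed) auto
  ultimately have "M S \<sqsubseteq> u"
    by (meson le_trans c(1) u)
  then show "S \<in> ?D"
    using S by blast
qed blast

lemma lift_mono:
  "D \<subseteq> E \<Longrightarrow> E \<subseteq> Fpow (basics P) \<Longrightarrow> \<Squnion>(M ` D) \<sqsubseteq> \<Squnion>(M ` E)"
  by (rule sup_least)
    (use M_image_closed[of E] M_image_closed[of D] lift_closed[of E] in \<open>auto intro!: sup_upper\<close>)

lemma lift_pclosure:
  assumes E: "E \<subseteq> Fpow (basics P)"
  shows "\<Squnion>(M ` pclosure P E) = \<Squnion>(M ` E)"
proof (rule le_antisym)
  have cl: "pclosure P E \<subseteq> Fpow (basics P)"
    using pclosed_pclosure[OF E] pclosedD(1) by blast
  note u = lift_closed[OF E]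
  have "pclosure P E \<subseteq> {S \<in> Fpow (basics P). M S \<sqsubseteq> \<Squnion>(M ` E)}"
    by (rule pclosure_least[OF pclosed_below[OF u]])
      (use E M_image_closed[OF E] in \<open>auto intro!: sup_upper\<close>)
  then show "\<Squnion>(M ` pclosure P E) \<sqsubseteq> \<Squnion>(M ` E)"
    using u M_image_closed[OF cl] by (intro sup_least) auto
  show "\<Squnion>(M ` E) \<sqsubseteq> \<Squnion>(M ` pclosure P E)"
    by (rule lift_mono[OF pclosure_increasing cl])
qed (simp_all add: lift_closed[OF E] lift_closed[OF pclosedD(1)[OF pclosed_pclosure[OF E]]])

lemma lift_top: "\<Squnion>(M ` Fpow (basics P)) = \<top>"
proof (rule le_antisym)
  have "\<top> \<sqsubseteq> M {}"
    unfolding M_def by (rule inf_greatest) auto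
  moreover have "M {} \<sqsubseteq> \<Squnion>(M ` Fpow (basics P))"
    by (intro sup_upper M_image_closed) (auto simp: Fpow_def)
  moreover have "M {} \<in> carrier L"
    by (rule M_closed) (simp add: Fpow_def)
  ultimately show "\<top> \<sqsubseteq> \<Squnion>(M ` Fpow (basics P))"
    using le_trans[of \<top> "M {}"] lift_closed[of "Fpow (basics P)"] by auto
qed (use lift_closed[of "Fpow (basics P)"] in auto)

lemma lift_Int:
  assumes D: "pclosed P D" and E: "pclosed P E"
  shows "\<Squnion>(M ` (D \<inter> E)) = \<Squnion>(M ` D) \<sqinter> \<Squnion>(M ` E)"
proof -
  note DF = pclosedD(1)[OF D] and EF = pclosedD(1)[OF E]
  have IF: "D \<inter> E \<subseteq> Fpow (basics P)"
    using DF by blast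
  note c = lift_closed[OF DF] lift_closed[OF EF] lift_closed[OF IF]
  show ?thesis
  proof (rule le_antisym)
    show "\<Squnion>(M ` (D \<inter> E)) \<sqsubseteq> \<Squnion>(M ` D) \<sqinter> \<Squnion>(M ` E)"
      using c by (intro meet_le lift_mono DF EF) auto
    show "\<Squnion>(M ` D) \<sqinter> \<Squnion>(M ` E) \<sqsubseteq> \<Squnion>(M ` (D \<inter> E))"
    proof (rule meet_sup_sup_le[OF M_image_closed[OF DF] M_image_closed[OF EF] c(3)])
      fix x y
      assume "x \<in> M ` D" "y \<in> M ` E"
      then obtain S T where S: "S \<in> D" "x = M S" and T: "T \<in> E" "y = M T"
        by blast
      have SF: "S \<in> Fpow (basics P)" and TF: "T \<in> Fpow (basics P)"
        using S T DF EF by blast+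
      have "S \<union> T \<in> D \<inter> E"
        using S T pclosedD(2)[OF D S(1)] pclosedD(2)[OF E T(1)] Un_Fpow[OF SF TF] by blast
      then have "M (S \<union> T) \<sqsubseteq> \<Squnion>(M ` (D \<inter> E))"
        using M_image_closed[OF IF] by (intro sup_upper) auto
      then show "x \<sqinter> y \<sqsubseteq> \<Squnion>(M ` (D \<inter> E))"
        unfolding S(2) T(2)
        by (rule le_trans[OF M_Un[OF SF TF]])
          (simp_all add: M_closed SF TF Un_Fpow c)
    qed
  qed (simp_all add: c)
qed

lemma lift_Union:
  assumes A: "\<And>D. D \<in> A \<Longrightarrow> D \<subseteq> Fpow (basics P)"
  shows "\<Squnion>(M ` \<Union>A) = \<Squnion>((\<lambda>D. \<Squnion>(M ` D)) ` A)"
proof -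
  have UF: "\<Union>A \<subseteq> Fpow (basics P)"
    using A by blast
  have c: "(\<lambda>D. \<Squnion>(M ` D)) ` A \<subseteq> carrier L"
    using A lift_closed by blast
  show ?thesis
  proof (rule le_antisym)
    show "\<Squnion>(M ` \<Union>A) \<sqsubseteq> \<Squnion>((\<lambda>D. \<Squnion>(M ` D)) ` A)"
    proof (rule sup_least[OF M_image_closed[OF UF] sup_closed[OF c]])
      fix x
      assume "x \<in> M ` \<Union>A"
      then obtain D S where D: "D \<in> A" "S \<in> D" "x = M S"
        by blast
      have le: "M S \<sqsubseteq> \<Squnion>(M ` D)"
        using D M_image_closed[OF A[OF D(1)]] by (intro sup_upper) auto
      have le': "\<Squnion>(M ` D) \<sqsubseteq> \<Squnion>((\<lambda>D. \<Squnion>(M ` D)) ` A)"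
        using D c by (intro sup_upper) auto
      have "M S \<in> carrier L"
        using D A M_closed by blast
      then show "x \<sqsubseteq> \<Squnion>((\<lambda>D. \<Squnion>(M ` D)) ` A)"
        unfolding D(3)
        by (rule le_trans[OF le le' _ lift_closed[OF A[OF D(1)]] sup_closed[OF c]])
    qed
    show "\<Squnion>((\<lambda>D. \<Squnion>(M ` D)) ` A) \<sqsubseteq> \<Squnion>(M ` \<Union>A)"
    proof (rule sup_least[OF c lift_closed[OF UF]])
      fix x
      assume "x \<in> (\<lambda>D. \<Squnion>(M ` D)) ` A"
      then show "x \<sqsubseteq> \<Squnion>(M ` \<Union>A)"
        using lift_mono[OF Union_upper UF] by blast
    qed
  qed (simp_all only: lift_closed[OF UF] sup_closed[OF c])
qed

lemma frame_hom_lift: "frame_hom (classifying_frame P) L (frame_lift L f)"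
  unfolding frame_hom_def
proof (intro conjI ballI allI impI)
  show "frame_lift L f \<in> carrier (classifying_frame P) \<rightarrow> carrier L"
    by (simp add: Pi_iff frame_lift_eq lift_closed[OF pclosedD(1)])
  show "frame_lift L f \<top>\<^bsub>classifying_frame P\<^esub> = \<top>"
    by (simp add: frame_lift_eq top_classifying_frame lift_top)
  show "frame_lift L f (x \<sqinter>\<^bsub>classifying_frame P\<^esub> y) = frame_lift L f x \<sqinter> frame_lift L f y"
    if "x \<in> carrier (classifying_frame P)" "y \<in> carrier (classifying_frame P)" for x y
    using that by (simp add: frame_lift_eq meet_classifying_frame lift_Int)
  show "frame_lift L f (\<Squnion>\<^bsub>classifying_frame P\<^esub>A) = \<Squnion>(frame_lift L f ` A)"
    if "A \<subseteq> carrier (classifying_frame P)" for A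
  proof -
    have A: "A \<subseteq> Collect (pclosed P)"
      using that by simp
    have AF: "\<And>D. D \<in> A \<Longrightarrow> D \<subseteq> Fpow (basics P)"
      using A pclosedD(1) by blast
    then have "\<Union>A \<subseteq> Fpow (basics P)"
      by blast
    then have "\<Squnion>(M ` pclosure P (\<Union>A)) = \<Squnion>((\<lambda>D. \<Squnion>(M ` D)) ` A)"
      by (simp only: lift_pclosure lift_Union[OF AF])
    then show ?thesis
      by (simp add: frame_lift_eq[abs_def] sup_classifying_frame[OF A])
  qed
qed

lemma lift_pgen:
  assumes "g \<in> basics P"
  shows "frame_lift L f (pgen P g) = f g"
proof -
  have "{{g}} \<subseteq> Fpow (basics P)"
    using assms by (simp add: Fpow_def)
  moreover have "\<Squnion>(M ` {{g}}) = f g"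
    using f_closed[OF assms] by (simp add: M_def)
  ultimately show ?thesis
    by (simp only: frame_lift_eq pgen_eq lift_pclosure)
qed

end

lemma pclosed_pgen: "g \<in> basics P \<Longrightarrow> pclosed P (pgen P g)"
  unfolding pgen_eq by (rule pclosed_pclosure) (simp add: Fpow_def)

lemma pgen_image_closed: "S \<in> Fpow (basics P) \<Longrightarrow> pgen P ` S \<subseteq> Collect (pclosed P)"
  by (auto simp: Fpow_def pclosed_pgen)

lemma mem_Inter_pgen:
  assumes S: "S \<in> Fpow (basics P)"
  shows "S \<in> \<Inter>(pgen P ` S)"
proof -
  have "S \<in> pgen P g" if g: "g \<in> S" for g
  proof -
    have b: "g \<in> basics P"
      using g S by (auto simp: Fpow_def)
    have "{g} \<in> pgen P g"
      using pclosure_increasing[of "{{g}}" P] by (simp add: pgen_eq)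
    then show ?thesis
      using pclosedD(2)[OF pclosed_pgen[OF b] _ S] g by simp
  qed
  then show ?thesis
    by blast
qed

lemma pclosure_singleton_Un:
  assumes S: "S \<in> Fpow (basics P)" and T: "T \<in> Fpow (basics P)"
  shows "pclosure P {S} \<inter> pclosure P {T} \<subseteq> pclosure P {S \<union> T}"
proof -
  have STF: "S \<union> T \<in> Fpow (basics P)"
    using S T by (auto simp: Fpow_def)
  define E where "E = pclosure P {S \<union> T}"
  have E: "pclosed P E" and STE: "S \<union> T \<in> E"
    using pclosed_pclosure[of "{S \<union> T}"] pclosure_increasing[of "{S \<union> T}" P] STF
    unfolding E_def by blast+
  let ?up = "{U \<in> Fpow (basics P). T \<subseteq> U}"
  have "pclosure P {S} \<subseteq> {S \<in> Fpow (basics P). \<forall>U\<in>?up. S \<subseteq> U \<longrightarrow> U \<in> E}"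
  proof (rule pclosure_least[OF pclosed_imp[OF E]])
    show "{S} \<subseteq> {S \<in> Fpow (basics P). \<forall>U\<in>?up. S \<subseteq> U \<longrightarrow> U \<in> E}"
      using S pclosedD(2)[OF E STE] by simp
  qed auto
  then have 1: "U \<in> E" if "R \<in> pclosure P {S}" "R \<subseteq> U" "T \<subseteq> U" "U \<in> Fpow (basics P)" for R U
    using that by blast
  note clS = pclosed_pclosure[of "{S}" P]
  have "pclosure P {T} \<subseteq>
      {R \<in> Fpow (basics P). \<forall>U\<in>pclosure P {S}. R \<subseteq> U \<longrightarrow> U \<in> E}"
  proof (rule pclosure_least[OF pclosed_imp[OF E]])
    have S': "pclosed P (pclosure P {S})"
      using S by (intro clS) simp
    show "pclosure P {S} \<subseteq> Fpow (basics P)"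
      by (rule pclosedD(1)[OF S'])
    then show "{T} \<subseteq> {R \<in> Fpow (basics P). \<forall>U\<in>pclosure P {S}. R \<subseteq> U \<longrightarrow> U \<in> E}"
      using T 1 by blast
    show "\<And>R U. R \<in> pclosure P {S} \<Longrightarrow> U \<in> Fpow (basics P) \<Longrightarrow> R \<subseteq> U \<Longrightarrow> U \<in> pclosure P {S}"
      by (rule pclosedD(2)[OF S'])
  qed
  then show ?thesis
    unfolding E_def by blast
qed

lemma Inter_pgen:
  "finite S \<Longrightarrow> S \<subseteq> basics P \<Longrightarrow> Fpow (basics P) \<inter> \<Inter>(pgen P ` S) \<subseteq> pclosure P {S}"
proof (induction S rule: finite_induct)
  case empty
  have "pclosed P (pclosure P {{}})" "{} \<in> pclosure P {{}}"
    using pclosed_pclosure[of "{{}}" P] pclosure_increasing[of "{{}}" P] by (auto simp: Fpow_def)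
  then show ?case
    using pclosedD(2) by blast
next
  case (insert g S)
  have "pclosure P {{g}} \<inter> pclosure P {S} \<subseteq> pclosure P {{g} \<union> S}"
    by (rule pclosure_singleton_Un) (use insert in \<open>auto simp: Fpow_def\<close>)
  then show ?case
    using insert by (auto simp: pgen_eq)
qed

lemma element_eq_sup_pgen:
  assumes D: "pclosed P D"
  shows "D = \<Squnion>\<^bsub>classifying_frame P\<^esub>((\<lambda>S. \<Sqinter>\<^bsub>classifying_frame P\<^esub>(pgen P ` S)) ` D)"
proof -
  note DF = pclosedD(1)[OF D]
  have g: "pgen P ` S \<subseteq> Collect (pclosed P)" if "S \<in> D" for S
    using that DF by (intro pgen_image_closed) blast
  have inf_eq: "\<Sqinter>\<^bsub>classifying_frame P\<^esub>(pgen P ` S) = Fpow (basics P) \<inter> \<Inter>(pgen P ` S)"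
    if "S \<in> D" for S
    by (rule inf_classifying_frame[OF g[OF that]])
  have sub: "Fpow (basics P) \<inter> \<Inter>(pgen P ` S) \<subseteq> D" if "S \<in> D" for S
  proof -
    have "Fpow (basics P) \<inter> \<Inter>(pgen P ` S) \<subseteq> pclosure P {S}"
      by (rule Inter_pgen) (use that DF in \<open>auto simp: Fpow_def\<close>)
    also have "\<dots> \<subseteq> D"
      using that D by (intro pclosure_least) auto
    finally show ?thesis .
  qed
  have mem: "S \<in> Fpow (basics P) \<inter> \<Inter>(pgen P ` S)" if "S \<in> D" for S
    using that DF mem_Inter_pgen by blast
  let ?A = "(\<lambda>S. \<Sqinter>\<^bsub>classifying_frame P\<^esub>(pgen P ` S)) ` D"
  have A: "?A \<subseteq> Collect (pclosed P)"
    using inf_classifying_frame_greatest[OF g] inf_eq by (force dest: greatest_closed)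
  have "\<Union>?A = D"
    using sub mem inf_eq by auto
  then have "\<Squnion>\<^bsub>classifying_frame P\<^esub>?A = pclosure P D"
    by (simp only: sup_classifying_frame[OF A])
  also have "\<dots> = D"
    using pclosure_least[OF D order_refl] pclosure_increasing[of D P] by blast
  finally show ?thesis ..
qed

lemma classifying_frame_universal:
  assumes "frame L"
    and f: "\<And>g. g \<in> basics P \<Longrightarrow> f g \<in> carrier L"
    and basics: "\<And>\<phi> \<psi>. (\<phi>, \<psi>) \<in> paxioms P \<Longrightarrow> pbasics \<phi> \<union> pbasics \<psi> \<subseteq> basics P"
    and hold: "\<And>\<phi> \<psi>. (\<phi>, \<psi>) \<in> paxioms P \<Longrightarrow> pinterp L f \<phi> \<sqsubseteq>\<^bsub>L\<^esub> pinterp L f \<psi>"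
  shows "frame_hom (classifying_frame P) L (frame_lift L f)"
    and "g \<in> basics P \<Longrightarrow> frame_lift L f (pgen P g) = f g"
    and "frame_hom (classifying_frame P) L h \<Longrightarrow>
         (\<And>g. g \<in> basics P \<Longrightarrow> h (pgen P g) = f g) \<Longrightarrow>
         D \<in> carrier (classifying_frame P) \<Longrightarrow> h D = frame_lift L f D"
proof -
  interpret frame L
    by fact
  interpret frame_presentation L P f
    by unfold_locales (use f basics hold in auto)
  show "frame_hom (classifying_frame P) L (frame_lift L f)"
    by (rule frame_hom_lift)
  show "g \<in> basics P \<Longrightarrow> frame_lift L f (pgen P g) = f g"
    by (rule lift_pgen)
  assume h: "frame_hom (classifying_frame P) L h"
    and h_pgen: "\<And>g. g \<in> basics P \<Longrightarrow> h (pgen P g) = f g"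
    and "D \<in> carrier (classifying_frame P)"
  then have D: "pclosed P D"
    by simp
  note DF = pclosedD(1)[OF D]
  interpret C: complete_lattice "classifying_frame P"
    by (rule complete_lattice_classifying_frame)
  have h_inf: "h (\<Sqinter>\<^bsub>classifying_frame P\<^esub>(pgen P ` S)) = \<Sqinter>\<^bsub>L\<^esub>(f ` S)"
    if "finite S" "S \<subseteq> basics P" for S
    using that
  proof (induction S rule: finite_induct)
    case empty
    then show ?case
      using h C.inf_empty inf_empty by (simp add: frame_hom_def)
  next
    case (insert g S)
    have c: "pgen P g \<in> carrier (classifying_frame P)"
        "pgen P ` S \<subseteq> carrier (classifying_frame P)"
      using insert.prems by (auto intro: pclosed_pgen)
    have c': "f g \<in> carrier L" "f ` S \<subseteq> carrier L"
      using insert.prems f by auto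
    have "h (pgen P g \<sqinter>\<^bsub>classifying_frame P\<^esub> \<Sqinter>\<^bsub>classifying_frame P\<^esub>(pgen P ` S)) =
        h (pgen P g) \<sqinter>\<^bsub>L\<^esub> h (\<Sqinter>\<^bsub>classifying_frame P\<^esub>(pgen P ` S))"
      using h c(1) C.inf_closed[OF c(2)] unfolding frame_hom_def by blast
    then show ?case
      using insert C.inf_insert[OF c] inf_insert[OF c'] h_pgen by simp
  qed
  let ?A = "(\<lambda>S. \<Sqinter>\<^bsub>classifying_frame P\<^esub>(pgen P ` S)) ` D"
  have A: "?A \<subseteq> carrier (classifying_frame P)"
  proof (rule image_subsetI)
    fix S
    assume "S \<in> D"
    then have "pgen P ` S \<subseteq> Collect (pclosed P)"
      using DF by (intro pgen_image_closed) blast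
    then have "pgen P ` S \<subseteq> carrier (classifying_frame P)"
      by simp
    then show "\<Sqinter>\<^bsub>classifying_frame P\<^esub>(pgen P ` S) \<in> carrier (classifying_frame P)"
      by (rule C.inf_closed)
  qed
  have "h D = h (\<Squnion>\<^bsub>classifying_frame P\<^esub>?A)"
    using element_eq_sup_pgen[OF D] by simp
  also have "\<dots> = \<Squnion>\<^bsub>L\<^esub>(h ` ?A)"
    using h A unfolding frame_hom_def by blast
  also have "h ` ?A = (\<lambda>S. \<Sqinter>\<^bsub>L\<^esub>(f ` S)) ` D"
    unfolding image_image by (rule image_cong[OF HOL.refl], rule h_inf) (use DF in \<open>auto simp: Fpow_def\<close>)
  finally show "h D = frame_lift L f D"
    by (simp add: frame_lift_def)
qed

lemma classifying_frame_relations: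
  assumes ax: "(\<phi>, \<psi>) \<in> paxioms P" and b: "pbasics \<phi> \<union> pbasics \<psi> \<subseteq> basics P"
  shows "pinterp (classifying_frame P) (pgen P) \<phi> \<subseteq> pinterp (classifying_frame P) (pgen P) \<psi>"
proof -
  interpret frame "classifying_frame P"
    by (rule frame_classifying_frame)
  define P' :: "('a, 'b) ptheory" where "P' = \<lparr>basics = basics P, paxioms = {}\<rparr>"
  interpret frame_presentation "classifying_frame P" P' "pgen P"
    by unfold_locales (auto simp: P'_def pclosed_pgen)
  have basics: "basics P' = basics P"
    by (simp add: P'_def)
  let ?E = "pinterp (classifying_frame P) (pgen P) \<psi>"
  have E: "pclosed P ?E"
    using pinterp_closed[of \<psi>] b by (simp add: basics)
  have M: "M S = Fpow (basics P) \<inter> \<Inter>(pgen P ` S)" if "S \<in> Fpow (basics P)" for S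
    unfolding M_def by (rule inf_classifying_frame[OF pgen_image_closed[OF that]])
  have mem: "S \<in> M S" if "S \<in> Fpow (basics P)" for S
    using M[OF that] mem_Inter_pgen[OF that] that by blast
  have \<psi>: "T \<in> ?E" if "T \<in> Fpow (basics P)" "psat T \<psi>" for T
    using M_le_pinterp[of \<psi> T] that b mem[of T] by (auto simp: basics)
  have \<phi>: "S \<in> ?E" if "S \<in> Fpow (basics P)" "psat S \<phi>" for S
    by (rule pclosedD(3)[OF E ax that]) (rule \<psi>)
  have "M S \<subseteq> ?E" if S: "S \<in> Fpow (basics P)" "psat S \<phi>" for S
  proof -
    have "M S \<subseteq> pclosure P {S}"
      unfolding M[OF S(1)] by (rule Inter_pgen) (use S in \<open>auto simp: Fpow_def\<close>)
    also have "\<dots> \<subseteq> ?E"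
      using \<phi>[OF S] by (intro pclosure_least[OF E]) simp
    finally show ?thesis .
  qed
  then have "\<Squnion>\<^bsub>classifying_frame P\<^esub>(M ` {S \<in> Fpow (basics P). psat S \<phi>})
      \<sqsubseteq>\<^bsub>classifying_frame P\<^esub> ?E"
    using M_image_closed[of "{S \<in> Fpow (basics P). psat S \<phi>}"] E
    by (intro sup_least) (auto simp: basics)
  then show ?thesis
    using pinterp_le_lift[of \<phi>] b by (auto simp: basics)
qed

lemma opens_simps [simp]:
  "carrier (opens X) = {U. openin X U}"
  "le (opens X) = (\<subseteq>)"
  "eq (opens X) = (=)"
  by (simp_all add: opens_def)

lemma partial_order_opens: "partial_order (opens X)"
  by unfold_locales auto

lemma sup_opens:
  assumes "A \<subseteq> Collect (openin X)"
  shows "\<Squnion>\<^bsub>opens X\<^esub>A = \<Union>A"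
proof (rule sup_unique[OF partial_order_opens], rule least_UpperI)
  show "\<Union>A \<in> carrier (opens X)"
    using assms by (auto intro!: openin_Union)
  show "\<Union>A \<sqsubseteq>\<^bsub>opens X\<^esub> y" if "y \<in> Upper (opens X) A" for y
    using that assms by (auto simp: Upper_def)
qed (use assms in auto)

lemma meet_opens:
  assumes "openin X U" and "openin X V"
  shows "U \<sqinter>\<^bsub>opens X\<^esub> V = U \<inter> V"
  unfolding meet_def
proof (rule inf_unique[OF partial_order_opens], rule greatest_LowerI)
  show "y \<sqsubseteq>\<^bsub>opens X\<^esub> U \<inter> V" if "y \<in> Lower (opens X) {U, V}" for y
    using that assms by (auto simp: Lower_def)
qed (use assms in auto)

lemma top_opens: "\<top>\<^bsub>opens X\<^esub> = topspace X"
proof -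
  have "greatest (opens X) (topspace X) (carrier (opens X))"
    by (auto simp: greatest_def dest: openin_subset)
  then show ?thesis
    unfolding top_def using partial_order.greatest_unique[OF partial_order_opens]
    by (intro some_equality) auto
qed

lemma spatialI:
  fixes X :: "'p topology" and L :: "'a gorder"
  assumes iso: "frame_iso L (opens X) f"
  shows "spatial L"
proof -
  define N where "N p = {u \<in> carrier L. p \<in> f u}" for p
  define Y where "Y = topology (\<lambda>V. V \<subseteq> N ` topspace X \<and> openin X {p \<in> topspace X. N p \<in> V})"
  have "istopology (\<lambda>V. V \<subseteq> N ` topspace X \<and> openin X {p \<in> topspace X. N p \<in> V})"
    unfolding istopology_def
  proof (intro conjI allI impI; (elim conjE)?)
    fix S T
    assume "openin X {p \<in> topspace X. N p \<in> S}" "openin X {p \<in> topspace X. N p \<in> T}"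
    then have "openin X ({p \<in> topspace X. N p \<in> S} \<inter> {p \<in> topspace X. N p \<in> T})"
      by (rule openin_Int)
    then show "openin X {p \<in> topspace X. N p \<in> S \<inter> T}"
      by (rule back_subst[of "openin X"]) blast
  next
    fix \<K>
    assume "\<forall>K\<in>\<K>. K \<subseteq> N ` topspace X \<and> openin X {p \<in> topspace X. N p \<in> K}"
    then have "openin X (\<Union>K\<in>\<K>. {p \<in> topspace X. N p \<in> K})"
      by (intro openin_Union) auto
    then show "openin X {p \<in> topspace X. N p \<in> \<Union>\<K>}"
      by (rule back_subst[of "openin X"]) blast
  qed auto
  then have Y: "openin Y V \<longleftrightarrow> V \<subseteq> N ` topspace X \<and> openin X {p \<in> topspace X. N p \<in> V}" for V
    unfolding Y_def by (simp add: topology_inverse')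
  have hom: "frame_hom L (opens X) f" and bij: "bij_betw f (carrier L) {U. openin X U}"
    using iso by (simp_all add: frame_iso_def)
  have sat: "p \<in> U \<longleftrightarrow> q \<in> U" if "openin X U" "N p = N q" for p q U
  proof -
    have "U \<in> f ` carrier L"
      using bij that(1) by (simp add: bij_betw_def)
    then obtain u where u: "u \<in> carrier L" "U = f u"
      by blast
    have "u \<in> N p \<longleftrightarrow> u \<in> N q"
      by (simp only: that(2))
    then show ?thesis
      using u by (simp add: N_def)
  qed
  have preimage: "{p \<in> topspace X. N p \<in> N ` U} = U" if "openin X U" for U
    using sat[OF that] openin_subset[OF that] by blast
  have image: "openin Y (N ` U)" if "openin X U" for U
    using that openin_subset[OF that] by (auto simp: Y preimage)
  have topspace: "topspace Y = N ` topspace X"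
    using image[OF openin_topspace] Y[of "topspace Y"] openin_subset by blast
  have "frame_iso L (opens Y) (\<lambda>u. N ` f u)"
    unfolding frame_iso_def
  proof
    have fo: "openin X (f u)" if "u \<in> carrier L" for u
      using hom that by (auto simp: frame_hom_def)
    show "frame_hom L (opens Y) (\<lambda>u. N ` f u)"
      unfolding frame_hom_def
    proof (intro conjI ballI allI impI)
      show "(\<lambda>u. N ` f u) \<in> carrier L \<rightarrow> carrier (opens Y)"
        using fo image by auto
      show "N ` f \<top>\<^bsub>L\<^esub> = \<top>\<^bsub>opens Y\<^esub>"
        using hom by (simp add: frame_hom_def top_opens topspace)
      show "N ` f (x \<sqinter>\<^bsub>L\<^esub> y) = N ` f x \<sqinter>\<^bsub>opens Y\<^esub> N ` f y"
        if "x \<in> carrier L" "y \<in> carrier L" for x y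
      proof -
        have "f (x \<sqinter>\<^bsub>L\<^esub> y) = f x \<inter> f y"
          using hom that fo by (simp add: frame_hom_def meet_opens)
        moreover have "N ` (f x \<inter> f y) = N ` f x \<inter> N ` f y"
          using sat[OF fo[OF that(1)]] by blast
        ultimately show ?thesis
          using image[OF fo] that by (simp add: meet_opens)
      qed
      show "N ` f (\<Squnion>\<^bsub>L\<^esub>A) = \<Squnion>\<^bsub>opens Y\<^esub>((\<lambda>u. N ` f u) ` A)" if A: "A \<subseteq> carrier L" for A
      proof -
        have "f (\<Squnion>\<^bsub>L\<^esub>A) = \<Union>(f ` A)"
          using hom A fo by (subst sup_opens[symmetric, of _ X]) (auto simp: frame_hom_def)
        moreover have "\<Squnion>\<^bsub>opens Y\<^esub>((\<lambda>u. N ` f u) ` A) = \<Union>((\<lambda>u. N ` f u) ` A)"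
          using A fo image by (intro sup_opens) blast
        ultimately show ?thesis
          by (simp add: image_Union image_image)
      qed
    qed
    have "bij_betw ((`) N) {U. openin X U} {V. openin Y V}"
    proof (rule bij_betw_byWitness[where f' = "\<lambda>V. {p \<in> topspace X. N p \<in> V}"])
      show "\<forall>V\<in>{V. openin Y V}. N ` {p \<in> topspace X. N p \<in> V} = V"
        unfolding Y by blast
    qed (use image preimage Y in auto)
    then show "bij_betw (\<lambda>u. N ` f u) (carrier L) (carrier (opens Y))"
      using bij_betw_trans[OF bij] by (simp add: comp_def)
  qed
  then show ?thesis
    unfolding spatial_def by blast
qed

end

theory Submission
  imports Defs
begin

text \<open>A locale is spatial if it has enough points, and the points of the classifying locale of a
  propositional theory are the models of the theory. For a theory with countably many axioms there
  are enough of them, by a Rasiowa--Sikorski argument (\<open>model_avoiding\<close>): an element \<open>D\<close> of the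
  presented frame is a closed set of finite sets of basic propositions, each standing for the meet
  of its elements, and a finite set outside \<open>D\<close> is enlarged step by step, always outside \<open>D\<close>, until
  all axioms are satisfied. Hence \<open>extent\<close>, which takes \<open>D\<close> to the set of models that satisfy it,
  is an isomorphism from the presented frame onto the open sets of the space of models
  (\<open>frame_iso_extent\<close>). If \<open>T\<close> has countably many sorts, relation symbols and axioms, then so have
  the theories of isomorphisms and of composable pairs, and the propositional theories of all three
  have countably many axioms, however large the disjunctions are. So the three locales are spatial.

  It remains to see that the spaces form a topological groupoid that induces the localic one. A
  model of \<open>P[T]\<close> is a model of \<open>T\<close> on subquotients of the natural numbers, and a model of the
  theory of isomorphisms is a pair of such models with an isomorphism, given as a relation between
  representatives (\<open>models_iso_chain\<close>). The arrows of the groupoid are thus isomorphisms, with the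
  composition of relations; representatives of equal elements being interchangeable, this satisfies
  the groupoid laws. A frame homomorphism defined on generators is, in terms of open sets, the
  preimage map of the evident map between models, provided that this map does send models to models
  (locale \<open>model_map\<close>). This yields at once the continuity of the structure maps and the agreement
  with those of the localic groupoid. The space of composable pairs, a subspace of a product, is
  homeomorphic to the space of models of the theory of composable pairs
  (\<open>homeomorphic_maps_composable\<close>).\<close>

section \<open>Models of a propositional theory\<close>

definition models :: "('g, 'j) ptheory \<Rightarrow> 'g set set" where
  "models P = {S. S \<subseteq> basics P \<and> (\<forall>(\<phi>, \<psi>)\<in>paxioms P. psat S \<phi> \<longrightarrow> psat S \<psi>)}"

text \<open>Geometric formulas have no infinite conjunctions, so that their truth is witnessed by finitely
  many basic propositions.\<close>

lemma psat_finite_support: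
  assumes "psat S \<phi>"
  obtains F where "finite F" "F \<subseteq> S" "psat F \<phi>"
proof -
  have "\<exists>F. finite F \<and> F \<subseteq> S \<and> psat F \<phi>"
    using assms
  proof (induction \<phi>)
    case (PBasic g)
    then show ?case
      by (intro exI[of _ "{g}"]) auto
  next
    case PTrue
    then show ?case
      by (intro exI[of _ "{}"]) auto
  next
    case (PAnd \<phi> \<psi>)
    then obtain F G where "finite F" "F \<subseteq> S" "psat F \<phi>" "finite G" "G \<subseteq> S" "psat G \<psi>"
      by auto
    then show ?case
      by (intro exI[of _ "F \<union> G"]) (auto intro: psat_mono)
  next
    case (PDisj I F)
    then show ?case
      by (metis psat.simps(4) rangeI)
  qed
  then show thesis
    using that by blast
qed

lemma finite_subset_chain_Union:
  fixes F :: "nat \<Rightarrow> 'a set"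
  assumes "mono F" "finite G" "G \<subseteq> (\<Union>n. F n)"
  shows "\<exists>n. G \<subseteq> F n"
  using assms(2,3)
proof (induction G rule: finite_induct)
  case (insert g G)
  then obtain n m where "G \<subseteq> F n" "g \<in> F m"
    by auto
  moreover have "F n \<subseteq> F (max n m)" "F m \<subseteq> F (max n m)"
    by (rule monoD[OF \<open>mono F\<close>]; simp)+
  ultimately show ?case
    by (intro exI[of _ "max n m"]) auto
qed auto

text \<open>The Rasiowa--Sikorski argument: by closedness of \<open>D\<close>, a finite set outside \<open>D\<close> that satisfies
  the premise of an axiom can be enlarged, outside \<open>D\<close>, so as to satisfy the conclusion. As there
  are only countably many axioms, each of them can be treated infinitely often along an increasing
  sequence. Its union is a model, since each formula true in the union is already true at some
  stage. Disjunctions of any size are dealt with at once, because the enlarged finite set satisfies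
  one particular disjunct.\<close>

lemma model_avoiding:
  assumes cnt: "countable (paxioms P)"
    and D: "pclosed P D"
    and F: "F \<in> Fpow (basics P)" "F \<notin> D"
  obtains S where "S \<in> models P" "F \<subseteq> S" "\<And>G. G \<in> D \<Longrightarrow> \<not> G \<subseteq> S"
proof -
  \<comment> \<open>The trivial axiom is added in order that there be something to enumerate.\<close>
  define ax where "ax = from_nat_into (insert (PTrue, PTrue) (paxioms P))"
  have ax_range: "range ax = insert (PTrue, PTrue) (paxioms P)"
    unfolding ax_def using cnt by (intro range_from_nat_into) auto
  define good where "good G \<longleftrightarrow> G \<in> Fpow (basics P) \<and> G \<notin> D" for G
  define step where "step n G H \<longleftrightarrow> G \<subseteq> H \<and>
      (psat G (fst (ax (fst (prod_decode n)))) \<longrightarrow> psat H (snd (ax (fst (prod_decode n)))))" for n G H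
  have "\<exists>f. \<forall>n. (good (f n) \<and> (n = 0 \<longrightarrow> f n = F)) \<and> step n (f n) (f (Suc n))"
  proof (rule dependent_nat_choice)
    show "\<exists>G. good G \<and> (0 = (0::nat) \<longrightarrow> G = F)"
      using F by (auto simp: good_def)
    fix G and n :: nat
    assume "good G \<and> (n = 0 \<longrightarrow> G = F)"
    then have G: "G \<in> Fpow (basics P)" "G \<notin> D"
      by (auto simp: good_def)
    obtain \<phi> \<psi> where a: "ax (fst (prod_decode n)) = (\<phi>, \<psi>)"
      by fastforce
    then have "(\<phi>, \<psi>) \<in> insert (PTrue, PTrue) (paxioms P)"
      using ax_range by (metis rangeI)
    then consider "\<phi> = PTrue" "\<psi> = PTrue" | "(\<phi>, \<psi>) \<in> paxioms P"
      by blast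
    then have "\<exists>H. good H \<and> G \<subseteq> H \<and> (psat G \<phi> \<longrightarrow> psat H \<psi>)"
    proof cases
      case 1
      then show ?thesis
        using G by (auto simp: good_def)
    next
      case 2
      then show ?thesis
        using pclosedD(3)[OF D 2 G(1)] G unfolding good_def by blast
    qed
    then show "\<exists>H. (good H \<and> (Suc n = 0 \<longrightarrow> H = F)) \<and> step n G H"
      by (simp add: step_def a)
  qed
  then obtain f where f: "\<And>n. good (f n)" "f 0 = F" "\<And>n. step n (f n) (f (Suc n))"
    by blast
  have mono: "mono f"
    using f(3) by (simp add: mono_iff_le_Suc step_def)
  define S where "S = (\<Union>n. f n)"
  have fS: "f n \<subseteq> S" for n
    by (auto simp: S_def)
  have stage: "\<exists>n. G \<subseteq> f n" if "finite G" "G \<subseteq> S" for G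
    using finite_subset_chain_Union[OF mono] that by (simp add: S_def)
  show thesis
  proof
    show "F \<subseteq> S"
      using fS[of 0] f(2) by simp
    show "\<not> G \<subseteq> S" if G: "G \<in> D" for G
    proof
      assume "G \<subseteq> S"
      moreover have "finite G"
        using G pclosedD(1)[OF D] by (auto simp: Fpow_def)
      ultimately obtain n where n: "G \<subseteq> f n"
        using stage by blast
      have "f n \<in> D"
        by (rule pclosedD(2)[OF D G _ n]) (use f(1)[of n] in \<open>simp add: good_def\<close>)
      then show False
        using f(1)[of n] by (simp add: good_def)
    qed
    have "psat S \<psi>" if a: "(\<phi>, \<psi>) \<in> paxioms P" and \<phi>: "psat S \<phi>" for \<phi> \<psi>
    proof -
      obtain G where G: "finite G" "G \<subseteq> S" "psat G \<phi>"
        using \<phi> by (rule psat_finite_support)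
      obtain n where "G \<subseteq> f n"
        using stage[OF G(1,2)] by blast
      then have n: "psat (f n) \<phi>"
        by (rule psat_mono[OF G(3)])
      obtain i where i: "ax i = (\<phi>, \<psi>)"
        using a ax_range by (metis imageE insertCI)
      \<comment> \<open>a stage after \<open>n\<close> at which this axiom is treated\<close>
      let ?m = "prod_encode (i, n)"
      have "psat (f ?m) \<phi>"
        by (rule psat_mono[OF n monoD[OF mono le_prod_encode_2]])
      then have "psat (f (Suc ?m)) \<psi>"
        using f(3)[of ?m] by (simp add: step_def i)
      then show ?thesis
        by (rule psat_mono[OF _ fS])
    qed
    moreover have "S \<subseteq> basics P"
      using f(1) by (auto simp: S_def good_def Fpow_def)
    ultimately show "S \<in> models P"
      by (auto simp: models_def)
  qed
qed


section \<open>The space of models\<close>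

text \<open>The open set of models given by an element of the classifying frame, and the greatest
  element of the classifying frame giving only models in \<open>U\<close>.\<close>

definition extent :: "('g, 'j) ptheory \<Rightarrow> 'g set set \<Rightarrow> 'g set set" where
  "extent P D = {S \<in> models P. \<exists>F\<in>D. F \<subseteq> S}"

definition forcing :: "('g, 'j) ptheory \<Rightarrow> 'g set set \<Rightarrow> 'g set set" where
  "forcing P U = {F \<in> Fpow (basics P). \<forall>S\<in>models P. F \<subseteq> S \<longrightarrow> S \<in> U}"

text \<open>The topology in which the sets \<open>{S \<in> models P. F \<subseteq> S}\<close> with \<open>F\<close> finite form a base.\<close>

definition model_space :: "('g, 'j) ptheory \<Rightarrow> 'g set topology" where
  "model_space P = topology (\<lambda>U. U \<subseteq> models P \<and>
     (\<forall>S\<in>U. \<exists>F. finite F \<and> F \<subseteq> S \<and> (\<forall>S'\<in>models P. F \<subseteq> S' \<longrightarrow> S' \<in> U)))"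

lemma openin_model_space:
  "openin (model_space P) U \<longleftrightarrow> U \<subseteq> models P \<and>
     (\<forall>S\<in>U. \<exists>F. finite F \<and> F \<subseteq> S \<and> (\<forall>S'\<in>models P. F \<subseteq> S' \<longrightarrow> S' \<in> U))"
proof -
  have "istopology (\<lambda>U. U \<subseteq> models P \<and>
     (\<forall>S\<in>U. \<exists>F. finite F \<and> F \<subseteq> S \<and> (\<forall>S'\<in>models P. F \<subseteq> S' \<longrightarrow> S' \<in> U)))"
    (is "istopology ?open")
    unfolding istopology_def
  proof (intro conjI allI impI)
    fix U V
    assume UV: "?open U" "?open V"
    show "U \<inter> V \<subseteq> models P"
      using UV by blast
    show "\<forall>S\<in>U \<inter> V. \<exists>F. finite F \<and> F \<subseteq> S \<and> (\<forall>S'\<in>models P. F \<subseteq> S' \<longrightarrow> S' \<in> U \<inter> V)"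
    proof
      fix S
      assume "S \<in> U \<inter> V"
      then obtain F G where
          "finite F" "F \<subseteq> S" "\<forall>S'\<in>models P. F \<subseteq> S' \<longrightarrow> S' \<in> U"
          "finite G" "G \<subseteq> S" "\<forall>S'\<in>models P. G \<subseteq> S' \<longrightarrow> S' \<in> V"
        using UV by blast
      then show "\<exists>F. finite F \<and> F \<subseteq> S \<and> (\<forall>S'\<in>models P. F \<subseteq> S' \<longrightarrow> S' \<in> U \<inter> V)"
        by (intro exI[of _ "F \<union> G"]) auto
    qed
  next
    fix \<K>
    assume \<K>: "\<forall>U\<in>\<K>. ?open U"
    show "\<Union>\<K> \<subseteq> models P"
      using \<K> by blast
    show "\<forall>S\<in>\<Union>\<K>. \<exists>F. finite F \<and> F \<subseteq> S \<and> (\<forall>S'\<in>models P. F \<subseteq> S' \<longrightarrow> S' \<in> \<Union>\<K>)"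
    proof
      fix S
      assume "S \<in> \<Union>\<K>"
      then obtain U where U: "U \<in> \<K>" "S \<in> U"
        by blast
      then obtain F where "finite F" "F \<subseteq> S" "\<forall>S'\<in>models P. F \<subseteq> S' \<longrightarrow> S' \<in> U"
        using \<K> by meson
      then show "\<exists>F. finite F \<and> F \<subseteq> S \<and> (\<forall>S'\<in>models P. F \<subseteq> S' \<longrightarrow> S' \<in> \<Union>\<K>)"
        using U by blast
    qed
  qed
  then show ?thesis
    unfolding model_space_def by (simp add: topology_inverse')
qed

lemma topspace_model_space [simp]: "topspace (model_space P) = models P"
proof
  show "topspace (model_space P) \<subseteq> models P"
    using openin_topspace openin_model_space by blast
  have "openin (model_space P) (models P)"
    unfolding openin_model_space by blast
  then show "models P \<subseteq> topspace (model_space P)"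
    by (rule openin_subset)
qed

lemma openin_extent:
  assumes "D \<subseteq> Fpow (basics P)"
  shows "openin (model_space P) (extent P D)"
  unfolding openin_model_space
proof (intro conjI ballI)
  show "extent P D \<subseteq> models P"
    by (auto simp: extent_def)
  fix S
  assume "S \<in> extent P D"
  then obtain F where "F \<in> D" "F \<subseteq> S"
    by (auto simp: extent_def)
  then show "\<exists>F. finite F \<and> F \<subseteq> S \<and> (\<forall>S'\<in>models P. F \<subseteq> S' \<longrightarrow> S' \<in> extent P D)"
    using assms by (intro exI[of _ F]) (auto simp: extent_def Fpow_def)
qed

lemma extent_forcing:
  assumes "openin (model_space P) U"
  shows "extent P (forcing P U) = U"
proof
  show "extent P (forcing P U) \<subseteq> U"
    by (auto simp: extent_def forcing_def)
  show "U \<subseteq> extent P (forcing P U)"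
  proof
    fix S
    assume S: "S \<in> U"
    then obtain F where F: "finite F" "F \<subseteq> S" "\<forall>S'\<in>models P. F \<subseteq> S' \<longrightarrow> S' \<in> U"
      using assms unfolding openin_model_space by blast
    have SM: "S \<in> models P"
      using S assms unfolding openin_model_space by blast
    have "F \<in> forcing P U"
      using F SM by (auto simp: forcing_def Fpow_def models_def)
    then show "S \<in> extent P (forcing P U)"
      using F SM by (auto simp: extent_def)
  qed
qed

text \<open>A model that extends \<open>F\<close> and satisfies \<open>\<psi>\<close> extends \<open>F \<union> G\<close> for a finite \<open>G\<close> satisfying \<open>\<psi>\<close>, by
  finite support. So the closure condition, which only concerns finite sets, holds as soon as all
  models satisfy the axiom.\<close>

lemma pclosed_forcing: "pclosed P (forcing P U)"
proof (rule pclosedI)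
  show "forcing P U \<subseteq> Fpow (basics P)"
    by (auto simp: forcing_def)
  show "H \<in> forcing P U" if "G \<in> forcing P U" "H \<in> Fpow (basics P)" "G \<subseteq> H" for G H
    using that by (auto simp: forcing_def)
  fix \<phi> \<psi> F
  assume ax: "(\<phi>, \<psi>) \<in> paxioms P" and F: "F \<in> Fpow (basics P)" "psat F \<phi>"
    and *: "\<And>G. G \<in> Fpow (basics P) \<Longrightarrow> F \<subseteq> G \<Longrightarrow> psat G \<psi> \<Longrightarrow> G \<in> forcing P U"
  have "S \<in> U" if S: "S \<in> models P" "F \<subseteq> S" for S
  proof -
    have "psat S \<phi>"
      using psat_mono[OF F(2) S(2)] .
    then have "psat S \<psi>"
      using S(1) ax by (auto simp: models_def)
    then obtain G where G: "finite G" "G \<subseteq> S" "psat G \<psi>"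
      by (rule psat_finite_support)
    have "F \<union> G \<in> forcing P U"
      using F G S by (intro *) (auto simp: Fpow_def models_def intro: psat_mono)
    then show "S \<in> U"
      using S G by (auto simp: forcing_def)
  qed
  then show "F \<in> forcing P U"
    using F by (simp add: forcing_def)
qed

text \<open>Completeness: a finite set outside \<open>D\<close> lies in a model that avoids \<open>D\<close>, so that an element of
  the classifying frame is determined by its models.\<close>

lemma forcing_extent:
  assumes "countable (paxioms P)" and D: "pclosed P D"
  shows "forcing P (extent P D) = D"
proof
  show "forcing P (extent P D) \<subseteq> D"
  proof
    fix F
    assume F: "F \<in> forcing P (extent P D)"
    show "F \<in> D"
    proof (rule ccontr)
      assume "F \<notin> D"
      then obtain S where "S \<in> models P" "F \<subseteq> S" "\<And>G. G \<in> D \<Longrightarrow> \<not> G \<subseteq> S"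
        using model_avoiding[OF assms, of F] F by (auto simp: forcing_def)
      then show False
        using F by (auto simp: forcing_def extent_def)
    qed
  qed
  show "D \<subseteq> forcing P (extent P D)"
    using pclosedD(1)[OF D] by (auto simp: forcing_def extent_def)
qed

text \<open>Passing to the closure, that is, imposing the relations of the frame, adds no models, since
  the sets forcing membership in \<open>extent P E\<close> form a closed set.\<close>

lemma extent_pclosure:
  assumes "E \<subseteq> Fpow (basics P)"
  shows "extent P (pclosure P E) = extent P E"
proof
  have "pclosure P E \<subseteq> forcing P (extent P E)"
    using assms by (intro pclosure_least pclosed_forcing) (auto simp: forcing_def extent_def)
  then show "extent P (pclosure P E) \<subseteq> extent P E"
    by (auto simp: forcing_def extent_def)
  show "extent P E \<subseteq> extent P (pclosure P E)"
    unfolding extent_def by (blast intro: subsetD[OF pclosure_increasing])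
qed

lemma extent_pgen: "g \<in> basics P \<Longrightarrow> extent P (pgen P g) = {S \<in> models P. g \<in> S}"
  by (simp add: pgen_eq extent_pclosure Fpow_def) (auto simp: extent_def)

lemma extent_Union: "extent P (\<Union>A) = \<Union>(extent P ` A)"
  by (auto simp: extent_def)

lemma extent_sup:
  assumes A: "A \<subseteq> Collect (pclosed P)"
  shows "extent P (\<Squnion>\<^bsub>classifying_frame P\<^esub>A) = \<Union>(extent P ` A)"
proof -
  have "\<Union>A \<subseteq> Fpow (basics P)"
    using A pclosedD(1) by blast
  then show ?thesis
    by (simp add: sup_classifying_frame[OF A] extent_pclosure extent_Union)
qed

text \<open>Witnesses in finitely many upward closed sets can be replaced by their union.\<close>

lemma extent_finite_inf:
  assumes A: "A \<subseteq> Collect (pclosed P)" and "finite A"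
  shows "extent P (\<Sqinter>\<^bsub>classifying_frame P\<^esub>A) = models P \<inter> \<Inter>(extent P ` A)"
proof -
  have "S \<in> extent P (Fpow (basics P) \<inter> \<Inter>A)"
    if S: "S \<in> models P" and "\<forall>D\<in>A. S \<in> extent P D" for S
  proof -
    have "\<forall>D\<in>A. \<exists>F. F \<in> D \<and> F \<subseteq> S"
      using that by (auto simp: extent_def)
    then obtain F where F: "\<And>D. D \<in> A \<Longrightarrow> F D \<in> D \<and> F D \<subseteq> S"
      by metis
    have "finite (F D)" if "D \<in> A" for D
      using F[OF that] A that pclosedD(1)[of P D] by (auto simp: Fpow_def)
    then have U: "(\<Union>D\<in>A. F D) \<in> Fpow (basics P)" "(\<Union>D\<in>A. F D) \<subseteq> S"
      using F S \<open>finite A\<close> by (auto simp: Fpow_def models_def)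
    have "(\<Union>D\<in>A. F D) \<in> D" if D: "D \<in> A" for D
    proof (rule pclosedD(2)[OF _ _ U(1)])
      show "pclosed P D" "F D \<in> D"
        using A D F by blast+
    qed (use D in blast)
    then show ?thesis
      using U S unfolding extent_def by blast
  qed
  then show ?thesis
    unfolding inf_classifying_frame[OF A] by (auto simp: extent_def)
qed

lemma extent_meet:
  assumes "pclosed P D" "pclosed P E"
  shows "extent P (D \<sqinter>\<^bsub>classifying_frame P\<^esub> E) = extent P D \<inter> extent P E"
  unfolding meet_def using assms
  by (subst extent_finite_inf) (auto simp: extent_def)

lemma frame_iso_extent:
  assumes "countable (paxioms P)"
  shows "frame_iso (classifying_frame P) (opens (model_space P)) (extent P)"
  unfolding frame_iso_def frame_hom_def
proof (intro conjI ballI allI impI)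
  show "extent P \<in> carrier (classifying_frame P) \<rightarrow> carrier (opens (model_space P))"
    by (auto simp: openin_extent pclosedD(1))
  show "extent P \<top>\<^bsub>classifying_frame P\<^esub> = \<top>\<^bsub>opens (model_space P)\<^esub>"
    by (auto simp: top_classifying_frame top_opens extent_def Fpow_def)
  show "extent P (D \<sqinter>\<^bsub>classifying_frame P\<^esub> E) = extent P D \<sqinter>\<^bsub>opens (model_space P)\<^esub> extent P E"
    if "D \<in> carrier (classifying_frame P)" "E \<in> carrier (classifying_frame P)" for D E
    using that by (simp add: extent_meet meet_opens openin_extent pclosedD(1))
  show "extent P (\<Squnion>\<^bsub>classifying_frame P\<^esub>A) = \<Squnion>\<^bsub>opens (model_space P)\<^esub>(extent P ` A)"
    if "A \<subseteq> carrier (classifying_frame P)" for A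
  proof -
    have A: "A \<subseteq> Collect (pclosed P)"
      using that by simp
    then have "extent P ` A \<subseteq> Collect (openin (model_space P))"
      using openin_extent pclosedD(1) by blast
    then show ?thesis
      by (simp only: extent_sup[OF A] sup_opens)
  qed
  show "bij_betw (extent P) (carrier (classifying_frame P)) (carrier (opens (model_space P)))"
    by (rule bij_betw_byWitness[where f' = "forcing P"])
      (auto simp: forcing_extent[OF assms] extent_forcing pclosed_forcing openin_extent pclosedD(1))
qed

lemma frame_iso_inverse:
  assumes "complete_lattice L" and f: "frame_iso L M f"
    and gf: "\<And>x. x \<in> carrier L \<Longrightarrow> g (f x) = x"
  shows "frame_iso M L g"
proof -
  interpret complete_lattice L
    by fact
  have hom: "f \<in> carrier L \<rightarrow> carrier M" "f \<top>\<^bsub>L\<^esub> = \<top>\<^bsub>M\<^esub>"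
      "\<And>x y. x \<in> carrier L \<Longrightarrow> y \<in> carrier L \<Longrightarrow> f (x \<sqinter>\<^bsub>L\<^esub> y) = f x \<sqinter>\<^bsub>M\<^esub> f y"
      "\<And>A. A \<subseteq> carrier L \<Longrightarrow> f (\<Squnion>\<^bsub>L\<^esub>A) = \<Squnion>\<^bsub>M\<^esub>(f ` A)"
    and bij: "bij_betw f (carrier L) (carrier M)"
    using f by (auto simp: frame_iso_def frame_hom_def)
  have range: "carrier M = f ` carrier L"
    using bij by (simp add: bij_betw_def)
  have "g \<top>\<^bsub>M\<^esub> = \<top>\<^bsub>L\<^esub>"
    using gf[OF top_closed] hom(2) by simp
  moreover have "g (x \<sqinter>\<^bsub>M\<^esub> y) = g x \<sqinter>\<^bsub>L\<^esub> g y" if xy: "x \<in> carrier M" "y \<in> carrier M" for x y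
  proof -
    obtain u v where "u \<in> carrier L" "v \<in> carrier L" "x = f u" "y = f v"
      using xy range by blast
    then show ?thesis
      using gf hom(3)[of u v, symmetric] by simp
  qed
  moreover have "g (\<Squnion>\<^bsub>M\<^esub>A) = \<Squnion>\<^bsub>L\<^esub>(g ` A)" if A: "A \<subseteq> carrier M" for A
  proof -
    obtain B where B: "B \<subseteq> carrier L" "A = f ` B"
      using A unfolding range subset_image_iff by blast
    have "g (f x) = x" if "x \<in> B" for x
      using gf B(1) that by blast
    then have "g ` A = B"
      by (simp add: B(2) image_image)
    moreover have "\<Squnion>\<^bsub>M\<^esub>A = f (\<Squnion>\<^bsub>L\<^esub>B)"
      by (simp add: hom(4)[OF B(1)] B(2))
    ultimately show ?thesis
      by (simp add: gf[OF sup_closed[OF B(1)]])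
  qed
  moreover have "g \<in> carrier M \<rightarrow> carrier L"
    using gf range by auto
  moreover have "bij_betw g (carrier M) (carrier L)"
    using bij gf range by (intro bij_betw_byWitness[where f' = f]) auto
  ultimately show ?thesis
    by (simp add: frame_iso_def frame_hom_def)
qed

lemma frame_iso_trans:
  assumes f: "frame_iso L M f" and g: "frame_iso M N g"
  shows "frame_iso L N (\<lambda>x. g (f x))"
proof -
  have fc: "f x \<in> carrier M" if "x \<in> carrier L" for x
    using f that by (auto simp: frame_iso_def frame_hom_def)
  have "bij_betw (g \<circ> f) (carrier L) (carrier N)"
    using f g by (auto simp: frame_iso_def intro: bij_betw_trans)
  moreover have "g (f (\<Squnion>\<^bsub>L\<^esub>A)) = \<Squnion>\<^bsub>N\<^esub>((\<lambda>x. g (f x)) ` A)" if A: "A \<subseteq> carrier L" for A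
  proof -
    have "f ` A \<subseteq> carrier M"
      using A fc by blast
    then show ?thesis
      using f g A by (simp add: frame_iso_def frame_hom_def image_image)
  qed
  ultimately show ?thesis
    using f g fc by (simp add: frame_iso_def frame_hom_def comp_def Pi_iff)
qed

lemma frame_iso_homeomorphic_maps:
  assumes pq: "homeomorphic_maps X Y p q"
  shows "frame_iso (opens Y) (opens X) (\<lambda>U. {x \<in> topspace X. p x \<in> U})"
proof -
  have p: "continuous_map X Y p" and q: "continuous_map Y X q"
    and qp: "\<And>x. x \<in> topspace X \<Longrightarrow> q (p x) = x" and pq: "\<And>y. y \<in> topspace Y \<Longrightarrow> p (q y) = y"
    using pq by (auto simp: homeomorphic_maps_def)
  have pt: "p x \<in> topspace Y" if "x \<in> topspace X" for x
    using p that by (auto simp: continuous_map_def)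
  have qt: "q y \<in> topspace X" if "y \<in> topspace Y" for y
    using q that by (auto simp: continuous_map_def)
  have o: "openin X {x \<in> topspace X. p x \<in> U}" if "openin Y U" for U
    using p that by (simp add: continuous_map_def)
  have o': "openin Y {y \<in> topspace Y. q y \<in> U}" if "openin X U" for U
    using q that by (simp add: continuous_map_def)
  have inv: "{x \<in> topspace X. p x \<in> {y \<in> topspace Y. q y \<in> U}} = U" if "openin X U" for U
    using openin_subset[OF that] qp pt by auto
  have inv': "{y \<in> topspace Y. q y \<in> {x \<in> topspace X. p x \<in> U}} = U" if "openin Y U" for U
    using openin_subset[OF that] pq qt by auto
  show ?thesis
    unfolding frame_iso_def frame_hom_def
  proof (intro conjI ballI allI impI)
    show "(\<lambda>U. {x \<in> topspace X. p x \<in> U}) \<in> carrier (opens Y) \<rightarrow> carrier (opens X)"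
      using o by simp
    show "{x \<in> topspace X. p x \<in> \<top>\<^bsub>opens Y\<^esub>} = \<top>\<^bsub>opens X\<^esub>"
      using pt by (auto simp: top_opens)
    show "{x \<in> topspace X. p x \<in> U \<sqinter>\<^bsub>opens Y\<^esub> V} =
        {x \<in> topspace X. p x \<in> U} \<sqinter>\<^bsub>opens X\<^esub> {x \<in> topspace X. p x \<in> V}"
      if "U \<in> carrier (opens Y)" "V \<in> carrier (opens Y)" for U V
      using that o by (auto simp: meet_opens)
    show "{x \<in> topspace X. p x \<in> \<Squnion>\<^bsub>opens Y\<^esub>A} =
        \<Squnion>\<^bsub>opens X\<^esub>((\<lambda>U. {x \<in> topspace X. p x \<in> U}) ` A)" if "A \<subseteq> carrier (opens Y)" for A
    proof -
      have A: "A \<subseteq> Collect (openin Y)"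
        using that by simp
      then have A': "(\<lambda>U. {x \<in> topspace X. p x \<in> U}) ` A \<subseteq> Collect (openin X)"
        using o by auto
      show ?thesis
        unfolding sup_opens[OF A] sup_opens[OF A'] by blast
    qed
    show "bij_betw (\<lambda>U. {x \<in> topspace X. p x \<in> U}) (carrier (opens Y)) (carrier (opens X))"
      by (rule bij_betw_byWitness[where f' = "\<lambda>U. {y \<in> topspace Y. q y \<in> U}"])
        (use o o' inv inv' in auto)
  qed
qed

lemma frame_iso_forcing:
  assumes "countable (paxioms P)"
  shows "frame_iso (opens (model_space P)) (classifying_frame P) (forcing P)"
  by (rule frame_iso_inverse[OF complete_lattice_classifying_frame frame_iso_extent[OF assms]])
    (simp add: forcing_extent[OF assms])

lemma continuous_map_model_space:
  assumes h: "\<And>x. x \<in> topspace X \<Longrightarrow> h x \<in> models P"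
    and gen: "\<And>g. g \<in> basics P \<Longrightarrow> openin X {x \<in> topspace X. g \<in> h x}"
  shows "continuous_map X (model_space P) h"
  unfolding continuous_map
proof (intro conjI allI impI)
  show "h ` topspace X \<subseteq> topspace (model_space P)"
    using h by auto
  fix U
  assume U: "openin (model_space P) U"
  show "openin X {x \<in> topspace X. h x \<in> U}"
    unfolding openin_subopen[of X "{x \<in> topspace X. h x \<in> U}"]
  proof
    fix x
    assume "x \<in> {x \<in> topspace X. h x \<in> U}"
    then have x: "x \<in> topspace X" "h x \<in> U"
      by auto
    then obtain F where F: "finite F" "F \<subseteq> h x" "\<forall>S\<in>models P. F \<subseteq> S \<longrightarrow> S \<in> U"
      using U unfolding openin_model_space by blast
    define V where "V = (\<Inter>g\<in>F. {x \<in> topspace X. g \<in> h x}) \<inter> topspace X"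
    have "F \<subseteq> basics P"
      using F(2) h[OF x(1)] by (auto simp: models_def)
    then have "openin X V"
      unfolding V_def using F(1) gen by (intro openin_INT) blast+
    moreover have "x \<in> V"
      using x F(2) by (auto simp: V_def)
    moreover have "V \<subseteq> {x \<in> topspace X. h x \<in> U}"
      using F(3) h by (auto simp: V_def)
    ultimately show "\<exists>V. openin X V \<and> x \<in> V \<and> V \<subseteq> {x \<in> topspace X. h x \<in> U}"
      by blast
  qed
qed

lemma openin_mem_model: "openin (model_space P) {S \<in> models P. g \<in> S}"
proof -
  have "\<exists>F. finite F \<and> F \<subseteq> S \<and> (\<forall>S'\<in>models P. F \<subseteq> S' \<longrightarrow> S' \<in> {S \<in> models P. g \<in> S})"
    if "g \<in> S" for S
    using that by (intro exI[of _ "{g}"]) simp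
  then show ?thesis
    unfolding openin_model_space by simp
qed

text \<open>A frame homomorphism from a presented frame, given on generators, is the preimage map of the
  map between models that is read off from the generators. To know that the assignment \<open>f\<close> of
  generators respects the relations, it suffices that this map \<open>h\<close> takes models to models; all
  structure maps of the groupoid are treated in this way.\<close>

locale model_map =
  fixes P :: "('g, 'j) ptheory" and P' :: "('h, 'k) ptheory"
    and f :: "'g \<Rightarrow> 'h set set" and h :: "'h set \<Rightarrow> 'g set"
  assumes countable_axioms: "countable (paxioms P')"
    and f_closed: "g \<in> basics P \<Longrightarrow> pclosed P' (f g)"
    and h_model: "S \<in> models P' \<Longrightarrow> h S \<in> models P"
    and h_iff: "S \<in> models P' \<Longrightarrow> g \<in> basics P \<Longrightarrow> g \<in> h S \<longleftrightarrow> S \<in> extent P' (f g)"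
begin

lemma continuous: "continuous_map (model_space P') (model_space P) h"
proof (rule continuous_map_model_space)
  fix g
  assume g: "g \<in> basics P"
  have "{S \<in> models P'. g \<in> h S} = extent P' (f g)"
    using h_iff[OF _ g] by (auto simp: extent_def)
  then show "openin (model_space P') {S \<in> topspace (model_space P'). g \<in> h S}"
    using openin_extent[OF pclosedD(1)[OF f_closed[OF g]]] by simp
qed (simp add: h_model)

lemma
  assumes D: "pclosed P D"
  shows pclosed_frame_lift: "pclosed P' (frame_lift (classifying_frame P') f D)"
    and extent_frame_lift:
      "extent P' (frame_lift (classifying_frame P') f D) = {S \<in> models P'. h S \<in> extent P D}"
proof -
  interpret L: complete_lattice "classifying_frame P'"
    by (rule complete_lattice_classifying_frame)
  have fin: "finite F" and sub: "F \<subseteq> basics P" if "F \<in> D" for F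
    using that pclosedD(1)[OF D] by (auto simp: Fpow_def)
  have fF: "f ` F \<subseteq> Collect (pclosed P')" if "F \<in> D" for F
    using f_closed sub[OF that] by auto
  then have inf: "\<Sqinter>\<^bsub>classifying_frame P'\<^esub>(f ` F) \<in> Collect (pclosed P')" if "F \<in> D" for F
    using L.inf_closed[of "f ` F"] that by simp
  then have A: "(\<lambda>F. \<Sqinter>\<^bsub>classifying_frame P'\<^esub>(f ` F)) ` D \<subseteq> Collect (pclosed P')"
    by blast
  then show "pclosed P' (frame_lift (classifying_frame P') f D)"
    unfolding frame_lift_def using L.sup_closed by simp
  have "extent P' (frame_lift (classifying_frame P') f D) =
      (\<Union>F\<in>D. extent P' (\<Sqinter>\<^bsub>classifying_frame P'\<^esub>(f ` F)))"
    unfolding frame_lift_def by (simp add: extent_sup[OF A])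
  also have "\<dots> = (\<Union>F\<in>D. models P' \<inter> (\<Inter>g\<in>F. extent P' (f g)))"
    by (intro SUP_cong) (simp_all add: extent_finite_inf fF fin)
  also have "\<dots> = (\<Union>F\<in>D. {S \<in> models P'. F \<subseteq> h S})"
    using sub h_iff by (intro SUP_cong) (auto simp: subset_iff)
  also have "\<dots> = {S \<in> models P'. h S \<in> extent P D}"
    using h_model by (auto simp: extent_def)
  finally show "extent P' (frame_lift (classifying_frame P') f D) = {S \<in> models P'. h S \<in> extent P D}" .
qed

lemma forcing_preimage:
  assumes U: "openin (model_space P) U"
  shows "forcing P' {S \<in> models P'. h S \<in> U} = frame_lift (classifying_frame P') f (forcing P U)"
  using forcing_extent[OF countable_axioms pclosed_frame_lift[OF pclosed_forcing[of P U]]]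
  by (simp add: extent_frame_lift[OF pclosed_forcing[of P U]] extent_forcing[OF U])

end

section \<open>Models of the propositional theory of a geometric theory\<close>

lemma psat_PConj: "psat S (PConj \<phi>s) \<longleftrightarrow> (\<forall>\<phi>\<in>set \<phi>s. psat S \<phi>)"
  unfolding PConj_def by (induction \<phi>s) auto

lemma psat_prop_form_GConj:
  "psat S (prop_form (GConj \<phi>s) \<nu>) \<longleftrightarrow> (\<forall>\<phi>\<in>set \<phi>s. psat S (prop_form \<phi> \<nu>))"
  unfolding GConj_def by (induction \<phi>s) auto

lemma psat_all_sim:
  assumes "length ns = length Xs" "length ms = length Xs"
  shows "psat S (all_sim Xs ns ms) \<longleftrightarrow> (\<forall>i<length Xs. BSim (Xs ! i) (ns ! i) (ms ! i) \<in> S)"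
  using assms unfolding all_sim_def psat_PConj all_set_conv_all_nth by simp

text \<open>A set of basic propositions with this property is a structure for the signature of \<open>T\<close> whose
  sorts are subquotients of the natural numbers: \<open>BSim X n n\<close> says that \<open>n\<close> names an element of the
  sort \<open>X\<close>, and \<open>BSim X n m\<close> that \<open>n\<close> and \<open>m\<close> name the same element.\<close>

definition is_structure :: "('s, 'r, 'i) gtheory \<Rightarrow> ('s, 'r) bprop set \<Rightarrow> bool" where
  "is_structure T S \<longleftrightarrow> S \<subseteq> basics (prop_theory T) \<and>
     (\<forall>X n m. BSim X n m \<in> S \<longrightarrow> BSim X m n \<in> S) \<and>
     (\<forall>X n m l. BSim X n m \<in> S \<longrightarrow> BSim X m l \<in> S \<longrightarrow> BSim X n l \<in> S) \<and>
     (\<forall>R ns ms. BRel R ns \<in> S \<longrightarrow> length ms = length ns \<longrightarrow>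
        (\<forall>i<length ns. BSim (arity T R ! i) (ns ! i) (ms ! i) \<in> S) \<longrightarrow> BRel R ms \<in> S) \<and>
     (\<forall>R ns. BRel R ns \<in> S \<longrightarrow> (\<forall>i<length ns. BSim (arity T R ! i) (ns ! i) (ns ! i) \<in> S))"

lemma is_structureI:
  assumes "S \<subseteq> basics (prop_theory T)"
    and "\<And>X n m. BSim X n m \<in> S \<Longrightarrow> BSim X m n \<in> S"
    and "\<And>X n m l. BSim X n m \<in> S \<Longrightarrow> BSim X m l \<in> S \<Longrightarrow> BSim X n l \<in> S"
    and "\<And>R ns ms. BRel R ns \<in> S \<Longrightarrow> length ms = length ns \<Longrightarrow>
       (\<And>i. i < length ns \<Longrightarrow> BSim (arity T R ! i) (ns ! i) (ms ! i) \<in> S) \<Longrightarrow> BRel R ms \<in> S"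
    and "\<And>R ns i. BRel R ns \<in> S \<Longrightarrow> i < length ns \<Longrightarrow> BSim (arity T R ! i) (ns ! i) (ns ! i) \<in> S"
  shows "is_structure T S"
  unfolding is_structure_def
  by (intro conjI allI impI)
    (rule assms(1), erule assms(2), erule (1) assms(3), rule assms(4), assumption, assumption, simp,
     erule (1) assms(5))

lemma is_structureD:
  assumes "is_structure T S"
  shows "S \<subseteq> basics (prop_theory T)"
    and "BSim X n m \<in> S \<Longrightarrow> BSim X m n \<in> S"
    and "BSim X n m \<in> S \<Longrightarrow> BSim X m l \<in> S \<Longrightarrow> BSim X n l \<in> S"
    and "BRel R ns \<in> S \<Longrightarrow> length ms = length ns \<Longrightarrow>
       (\<And>i. i < length ns \<Longrightarrow> BSim (arity T R ! i) (ns ! i) (ms ! i) \<in> S) \<Longrightarrow> BRel R ms \<in> S"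
    and "BRel R ns \<in> S \<Longrightarrow> i < length ns \<Longrightarrow> BSim (arity T R ! i) (ns ! i) (ns ! i) \<in> S"
proof -
  show "S \<subseteq> basics (prop_theory T)"
    using assms unfolding is_structure_def by (elim conjE)
  show "BSim X n m \<in> S \<Longrightarrow> BSim X m n \<in> S"
    using assms unfolding is_structure_def by (elim conjE) metis
  show "BSim X n m \<in> S \<Longrightarrow> BSim X m l \<in> S \<Longrightarrow> BSim X n l \<in> S"
    using assms unfolding is_structure_def by (elim conjE) metis
  note rel = assms[unfolded is_structure_def, THEN conjunct2, THEN conjunct2, THEN conjunct2]
  show "BRel R ns \<in> S \<Longrightarrow> length ms = length ns \<Longrightarrow>
       (\<And>i. i < length ns \<Longrightarrow> BSim (arity T R ! i) (ns ! i) (ms ! i) \<in> S) \<Longrightarrow> BRel R ms \<in> S"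
    using rel[THEN conjunct1, rule_format, of R ns ms] .
  show "BRel R ns \<in> S \<Longrightarrow> i < length ns \<Longrightarrow> BSim (arity T R ! i) (ns ! i) (ns ! i) \<in> S"
    using rel[THEN conjunct2, rule_format] .
qed

fun satisfies :: "('s, 'r) bprop set \<Rightarrow> ('s, 'r, 'i) sequent \<Rightarrow> bool" where
  "satisfies S (Sequent \<Gamma> \<phi> \<psi>) \<longleftrightarrow>
     (\<forall>ns. length ns = length \<Gamma> \<longrightarrow>
        (\<forall>i<length \<Gamma>. BSim (snd (\<Gamma> ! i)) (ns ! i) (ns ! i) \<in> S) \<longrightarrow>
        psat S (prop_form \<phi> (assign \<Gamma> ns)) \<longrightarrow> psat S (prop_form \<psi> (assign \<Gamma> ns)))"

lemma basics_prop_theory: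
  "BSim X n m \<in> basics (prop_theory T) \<longleftrightarrow> X \<in> sorts T"
  "BRel R ns \<in> basics (prop_theory T) \<longleftrightarrow> R \<in> rels T \<and> length ns = length (arity T R)"
  by (auto simp: prop_theory_def)

text \<open>The axioms of \<^const>\<open>prop_theory\<close> come in families of this shape.\<close>

lemma ball_param:
  "(\<forall>(\<phi>, \<psi>)\<in>{(f x y, g x y) | x y. P x y}. Q \<phi> \<psi>) \<longleftrightarrow> (\<forall>x y. P x y \<longrightarrow> Q (f x y) (g x y))"
  "(\<forall>(\<phi>, \<psi>)\<in>{(f' x y z, g' x y z) | x y z. P' x y z}. Q \<phi> \<psi>) \<longleftrightarrow>
     (\<forall>x y z. P' x y z \<longrightarrow> Q (f' x y z) (g' x y z))"
  "(\<forall>(\<phi>, \<psi>)\<in>{(f'' x y z w, g'' x y z w) | x y z w. P'' x y z w}. Q \<phi> \<psi>) \<longleftrightarrow>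
     (\<forall>x y z w. P'' x y z w \<longrightarrow> Q (f'' x y z w) (g'' x y z w))"
  by blast+

text \<open>The first four families of axioms of \<open>P[T]\<close> describe structures on subquotients of the natural
  numbers, the last one says that such a structure satisfies the sequents of \<open>T\<close>.\<close>

lemma models_prop_theory:
  "S \<in> models (prop_theory T) \<longleftrightarrow> is_structure T S \<and> (\<forall>\<sigma>\<in>axioms T. satisfies S \<sigma>)"
proof (cases "S \<subseteq> basics (prop_theory T)")
  case False
  then show ?thesis
    by (simp add: models_def is_structure_def)
next
  case True
  then have sort: "BSim X n m \<in> S \<Longrightarrow> X \<in> sorts T"
    and rel: "BRel R ns \<in> S \<Longrightarrow> R \<in> rels T \<and> length ns = length (arity T R)" for X n m R ns
    by (auto dest!: subsetD simp: basics_prop_theory)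
  have "S \<in> models (prop_theory T) \<longleftrightarrow>
      (\<forall>X n m. X \<in> sorts T \<longrightarrow> BSim X n m \<in> S \<longrightarrow> BSim X m n \<in> S) \<and>
      (\<forall>X n m l. X \<in> sorts T \<longrightarrow> BSim X n m \<in> S \<and> BSim X m l \<in> S \<longrightarrow> BSim X n l \<in> S) \<and>
      (\<forall>R ns ms. R \<in> rels T \<and> length ns = length (arity T R) \<and> length ms = length (arity T R) \<longrightarrow>
         BRel R ns \<in> S \<and> psat S (all_sim (arity T R) ns ms :: (_, 'c + nat) pform) \<longrightarrow> BRel R ms \<in> S) \<and>
      (\<forall>R ns. R \<in> rels T \<and> length ns = length (arity T R) \<longrightarrow>
         BRel R ns \<in> S \<longrightarrow> psat S (all_sim (arity T R) ns ns :: (_, 'c + nat) pform)) \<and>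
      (\<forall>\<Gamma> \<phi> \<psi> ns. Sequent \<Gamma> \<phi> \<psi> \<in> axioms T \<and> length ns = length \<Gamma> \<longrightarrow>
         psat S (all_sim (map snd \<Gamma>) ns ns :: (_, 'c + nat) pform) \<and> psat S (prop_form \<phi> (assign \<Gamma> ns)) \<longrightarrow>
         psat S (prop_form \<psi> (assign \<Gamma> ns)))"
    using True unfolding models_def mem_Collect_eq prop_theory_def ptheory.simps
    unfolding ball_Un ball_param by simp
  also have "\<dots> \<longleftrightarrow> is_structure T S \<and> (\<forall>\<sigma>\<in>axioms T. satisfies S \<sigma>)"
    (is "?sym \<and> ?trans \<and> ?cong \<and> ?strict \<and> ?ax \<longleftrightarrow> _")
  proof -
    have 1: "?sym \<longleftrightarrow> (\<forall>X n m. BSim X n m \<in> S \<longrightarrow> BSim X m n \<in> S)"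
      using sort by blast
    have 2: "?trans \<longleftrightarrow> (\<forall>X n m l. BSim X n m \<in> S \<longrightarrow> BSim X m l \<in> S \<longrightarrow> BSim X n l \<in> S)"
      using sort by blast
    have 3: "?cong \<longleftrightarrow> (\<forall>R ns ms. BRel R ns \<in> S \<longrightarrow> length ms = length ns \<longrightarrow>
        (\<forall>i<length ns. BSim (arity T R ! i) (ns ! i) (ms ! i) \<in> S) \<longrightarrow> BRel R ms \<in> S)"
      using rel by (intro all_cong1) (auto simp: psat_all_sim)
    have 4: "?strict \<longleftrightarrow>
        (\<forall>R ns. BRel R ns \<in> S \<longrightarrow> (\<forall>i<length ns. BSim (arity T R ! i) (ns ! i) (ns ! i) \<in> S))"
      using rel by (intro all_cong1) (auto simp: psat_all_sim)
    have 5: "?ax \<longleftrightarrow> (\<forall>\<sigma>\<in>axioms T. satisfies S \<sigma>)"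
    proof
      assume ax: ?ax
      show "\<forall>\<sigma>\<in>axioms T. satisfies S \<sigma>"
      proof
        fix \<sigma>
        assume "\<sigma> \<in> axioms T"
        then show "satisfies S \<sigma>"
          using ax by (cases \<sigma>) (simp add: psat_all_sim)
      qed
    next
      assume ax: "\<forall>\<sigma>\<in>axioms T. satisfies S \<sigma>"
      show ?ax
      proof (intro allI impI, elim conjE)
        fix \<Gamma> \<phi> \<psi> ns
        assume "Sequent \<Gamma> \<phi> \<psi> \<in> axioms T" "length ns = length \<Gamma>"
          "psat S (all_sim (map snd \<Gamma>) ns ns :: (_, 'c + nat) pform)"
          "psat S (prop_form \<phi> (assign \<Gamma> ns))"
        then show "psat S (prop_form \<psi> (assign \<Gamma> ns))"
          using bspec[OF ax, of "Sequent \<Gamma> \<phi> \<psi>"] by (simp add: psat_all_sim)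
      qed
    qed
    show ?thesis
      unfolding 1 2 3 4 5 is_structure_def by (simp only: True simp_thms conj_assoc)
  qed
  finally show ?thesis .
qed

text \<open>Each axiom of \<open>T\<close> yields one axiom for each assignment of numbers to its finitely many free
  variables; the disjunctions that it contains, and those replacing quantifiers, do not multiply
  the axioms.\<close>

lemma countable_prop_theory:
  fixes T :: "('s, 'r, 'i) gtheory"
  assumes "countable_theory T"
  shows "countable (paxioms (prop_theory T))"
proof (rule countable_subset)
  let ?A = "(\<Union>X\<in>sorts T. \<Union>n. \<Union>m. {(PBasic (BSim X n m), PBasic (BSim X m n))}) \<union>
     (\<Union>X\<in>sorts T. \<Union>n. \<Union>m. \<Union>l.
        {(PAnd (PBasic (BSim X n m)) (PBasic (BSim X m l)), PBasic (BSim X n l))}) \<union>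
     (\<Union>R\<in>rels T. \<Union>ns. \<Union>ms.
        {(PAnd (PBasic (BRel R ns)) (all_sim (arity T R) ns ms), PBasic (BRel R ms))}) \<union>
     (\<Union>R\<in>rels T. \<Union>ns. {(PBasic (BRel R ns), all_sim (arity T R) ns ns)}) \<union>
     (\<Union>\<sigma>\<in>axioms T. \<Union>ns. case \<sigma> of Sequent \<Gamma> \<phi> \<psi> \<Rightarrow>
        {(PAnd (all_sim (map snd \<Gamma>) ns ns) (prop_form \<phi> (assign \<Gamma> ns)), prop_form \<psi> (assign \<Gamma> ns))})"
  show "paxioms (prop_theory T) \<subseteq> ?A"
    unfolding prop_theory_def ptheory.simps
  proof (intro Un_mono)
    show "{(PAnd (all_sim (map snd \<Gamma>) ns ns) (prop_form \<phi> (assign \<Gamma> ns)),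
        prop_form \<psi> (assign \<Gamma> ns)) | \<Gamma> \<phi> \<psi> ns. Sequent \<Gamma> \<phi> \<psi> \<in> axioms T \<and> length ns = length \<Gamma>}
      \<subseteq> (\<Union>\<sigma>\<in>axioms T. \<Union>ns. case \<sigma> of Sequent \<Gamma> \<phi> \<psi> \<Rightarrow>
        {(PAnd (all_sim (map snd \<Gamma>) ns ns) (prop_form \<phi> (assign \<Gamma> ns)), prop_form \<psi> (assign \<Gamma> ns))})"
      by (clarify, rule UN_I, assumption) (simp, blast)
  qed blast+
  show "countable ?A"
    using assms unfolding countable_theory_def
    by (intro countable_Un countable_UN countableI_type) (auto split: sequent.split)
qed

section \<open>Models with isomorphisms between them\<close>

text \<open>In terms of subquotients of the natural numbers, \<open>\<alpha>\<close> is a family of relations between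
  representatives that induces an isomorphism from the structure \<open>S\<close> to the structure \<open>S'\<close>.\<close>

definition is_iso :: "('s, 'r, 'i) gtheory \<Rightarrow> ('s, 'r) bprop set \<Rightarrow> ('s, 'r) bprop set \<Rightarrow>
    ('s \<Rightarrow> nat \<Rightarrow> nat \<Rightarrow> bool) \<Rightarrow> bool" where
  "is_iso T S S' \<alpha> \<longleftrightarrow>
     (\<forall>X n m. \<alpha> X n m \<longrightarrow> BSim X n n \<in> S \<and> BSim X m m \<in> S') \<and>
     (\<forall>X n m n' m'. \<alpha> X n m \<longrightarrow> BSim X n n' \<in> S \<longrightarrow> BSim X m m' \<in> S' \<longrightarrow> \<alpha> X n' m') \<and>
     (\<forall>X n m n' m'. \<alpha> X n m \<longrightarrow> \<alpha> X n' m' \<longrightarrow> BSim X n n' \<in> S \<longleftrightarrow> BSim X m m' \<in> S') \<and>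
     (\<forall>X n. BSim X n n \<in> S \<longrightarrow> (\<exists>m. \<alpha> X n m)) \<and>
     (\<forall>X m. BSim X m m \<in> S' \<longrightarrow> (\<exists>n. \<alpha> X n m)) \<and>
     (\<forall>R ns ms. R \<in> rels T \<longrightarrow> length ns = length (arity T R) \<longrightarrow> length ms = length (arity T R) \<longrightarrow>
        (\<forall>i<length (arity T R). \<alpha> (arity T R ! i) (ns ! i) (ms ! i)) \<longrightarrow>
        BRel R ns \<in> S \<longleftrightarrow> BRel R ms \<in> S')"

definition graph :: "nat \<Rightarrow> ('s, 'r) chain_prop set \<Rightarrow> 's \<Rightarrow> nat \<Rightarrow> nat \<Rightarrow> bool" where
  "graph j M X n m \<longleftrightarrow> BRel (Iso j X) [n, m] \<in> M"

lemma iso_chain_simps [simp]: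
  "sorts (iso_chain k T) = sorts T \<times> {1..k + 1}"
  "Copy j R \<in> rels (iso_chain k T) \<longleftrightarrow> j \<in> {1..k + 1} \<and> R \<in> rels T"
  "Iso j X \<in> rels (iso_chain k T) \<longleftrightarrow> j \<in> {1..k} \<and> X \<in> sorts T"
  "arity (iso_chain k T) (Copy j R) = map (\<lambda>X. (X, j)) (arity T R)"
  "arity (iso_chain k T) (Iso j X) = [(X, j), (X, Suc j)]"
  by (auto simp: iso_chain_def)

lemma countable_theory_iso_chain:
  fixes T :: "('s, 'r, 'i) gtheory"
  assumes "countable_theory T"
  shows "countable_theory (iso_chain k T)"
proof -
  have c: "countable (sorts T)" "countable (rels T)" "countable (axioms T)"
    using assms by (auto simp: countable_theory_def)
  have "rels (iso_chain k T) = (\<Union>j\<in>{1..k + 1}. Copy j ` rels T) \<union> (\<Union>j\<in>{1..k}. Iso j ` sorts T)"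
    unfolding iso_chain_def by auto
  then have "countable (rels (iso_chain k T))"
    by (simp add: c)
  moreover have "countable (axioms (iso_chain k T))"
    unfolding iso_chain_def gtheory.simps
    by (intro countable_Un countable_UN countable_image countable_finite c)
      (simp_all add: iso_sort_axioms_def iso_rel_axioms_def Let_def)
  ultimately show ?thesis
    by (simp add: countable_theory_def c)
qed

lemma psat_copy:
  "psat M (prop_form (map_gform (\<lambda>X. (X, j)) (Copy j) \<phi>) \<nu>) \<longleftrightarrow>
   psat (copy_prop j -` M) (prop_form \<phi> \<nu>)"
  by (induction \<phi> arbitrary: \<nu>) (auto split: sum.splits)

lemma satisfies_copy:
  "satisfies M (map_sequent (\<lambda>X. (X, j)) (Copy j) \<sigma>) \<longleftrightarrow> satisfies (copy_prop j -` M) \<sigma>"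
proof (cases \<sigma>)
  case (Sequent \<Gamma> \<phi> \<psi>)
  have "map fst (map (map_prod id (\<lambda>X. (X, j))) \<Gamma>) = map fst \<Gamma>"
    by simp
  then have "assign (map (map_prod id (\<lambda>X. (X, j))) \<Gamma>) = assign \<Gamma>"
    unfolding assign_def by (intro ext) simp
  then show ?thesis
    by (simp add: Sequent psat_copy cong: conj_cong imp_cong)
qed

lemma all_lists_Suc:
  "(\<forall>l. length l = Suc k \<longrightarrow> P l) \<longleftrightarrow> (\<forall>n l. length l = k \<longrightarrow> P (n # l))"
  by (metis length_Suc_conv)

text \<open>A sequent is only required to hold for numbers that denote elements. For arguments of \<open>\<alpha>\<close> this
  condition is automatic, because the relation is strict.\<close>

lemma satisfies_iso_sort_axioms:
  fixes M :: "('s, 'r) chain_prop set"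
  assumes strict: "\<And>n m. graph j M X n m \<Longrightarrow> BSim (X, j) n n \<in> M \<and> BSim (X, Suc j) m m \<in> M"
  shows "(\<forall>\<sigma>\<in>iso_sort_axioms j X :: (_, _, 'i) sequent set. satisfies M \<sigma>) \<longleftrightarrow>
     (\<forall>n m n' m'. graph j M X n m \<longrightarrow> graph j M X n' m' \<longrightarrow>
        BSim (X, j) n n' \<in> M \<longleftrightarrow> BSim (X, Suc j) m m' \<in> M) \<and>
     (\<forall>n. BSim (X, j) n n \<in> M \<longrightarrow> (\<exists>m. graph j M X n m)) \<and>
     (\<forall>m. BSim (X, Suc j) m m \<in> M \<longrightarrow> (\<exists>n. graph j M X n m))"
proof -
  define \<Gamma> where "\<Gamma> = [(0 :: nat, (X, j)), (1, (X, j)), (2, (X, Suc j)), (3, (X, Suc j))]"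
  define \<phi> :: "('s \<times> nat, ('s, 'r) chain_rel, 'i) gform"
    where "\<phi> = GConj [GRel (Iso j X) [0, 2], GRel (Iso j X) [1, 3], GEq (X, j) 0 1]"
  define \<psi> :: "('s \<times> nat, ('s, 'r) chain_rel, 'i) gform"
    where "\<psi> = GConj [GRel (Iso j X) [0, 2], GRel (Iso j X) [1, 3], GEq (X, Suc j) 2 3]"
  have ax: "(\<forall>\<sigma>\<in>iso_sort_axioms j X :: (_, _, 'i) sequent set. satisfies M \<sigma>) \<longleftrightarrow>
      satisfies M (Sequent \<Gamma> \<phi> \<psi>) \<and> satisfies M (Sequent \<Gamma> \<psi> \<phi>) \<and>
      satisfies M (Sequent [(2, (X, Suc j))] GTrue (GEx 0 (X, j) (GRel (Iso j X) [0, 2]))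
        :: (_, _, 'i) sequent) \<and>
      satisfies M (Sequent [(0, (X, j))] GTrue (GEx 2 (X, Suc j) (GRel (Iso j X) [0, 2]))
        :: (_, _, 'i) sequent)"
    by (simp add: iso_sort_axioms_def Let_def \<Gamma>_def \<phi>_def \<psi>_def del: satisfies.simps)
  have len: "length \<Gamma> = Suc (Suc (Suc (Suc 0)))"
    by (simp add: \<Gamma>_def)
  have \<phi>: "psat M (prop_form \<phi> (assign \<Gamma> [n, n', m, m'])) \<longleftrightarrow>
      graph j M X n m \<and> graph j M X n' m' \<and> BSim (X, j) n n' \<in> M"
    and \<psi>: "psat M (prop_form \<psi> (assign \<Gamma> [n, n', m, m'])) \<longleftrightarrow>
      graph j M X n m \<and> graph j M X n' m' \<and> BSim (X, Suc j) m m' \<in> M"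
    and sim: "(\<forall>i<Suc (Suc (Suc (Suc 0))).
        BSim (snd (\<Gamma> ! i)) ([n, n', m, m'] ! i) ([n, n', m, m'] ! i) \<in> M) \<longleftrightarrow>
      BSim (X, j) n n \<in> M \<and> BSim (X, j) n' n' \<in> M \<and>
      BSim (X, Suc j) m m \<in> M \<and> BSim (X, Suc j) m' m' \<in> M" for n n' m m'
    unfolding All_less_Suc2
    by (simp_all add: \<phi>_def \<psi>_def \<Gamma>_def psat_prop_form_GConj assign_def graph_def)
  have "satisfies M (Sequent \<Gamma> \<phi> \<psi>) \<longleftrightarrow> (\<forall>n n' m m'. graph j M X n m \<longrightarrow> graph j M X n' m' \<longrightarrow>
      BSim (X, j) n n' \<in> M \<longrightarrow> BSim (X, Suc j) m m' \<in> M)"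
    unfolding satisfies.simps len all_lists_Suc
    using strict by (simp only: length_0_conv simp_thms sim \<phi> \<psi>) blast
  moreover have "satisfies M (Sequent \<Gamma> \<psi> \<phi>) \<longleftrightarrow> (\<forall>n n' m m'. graph j M X n m \<longrightarrow> graph j M X n' m' \<longrightarrow>
      BSim (X, Suc j) m m' \<in> M \<longrightarrow> BSim (X, j) n n' \<in> M)"
    unfolding satisfies.simps len all_lists_Suc
    using strict by (simp only: length_0_conv simp_thms sim \<phi> \<psi>) blast
  moreover have "satisfies M (Sequent [(2, (X, Suc j))] GTrue
        (GEx 0 (X, j) (GRel (Iso j X) [0, 2])) :: (_, _, 'i) sequent) \<longleftrightarrow>
      (\<forall>m. BSim (X, Suc j) m m \<in> M \<longrightarrow> (\<exists>n. graph j M X n m))"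
    using strict[unfolded graph_def] by (simp add: all_lists_Suc assign_def graph_def) blast
  moreover have "satisfies M (Sequent [(0, (X, j))] GTrue
        (GEx 2 (X, Suc j) (GRel (Iso j X) [0, 2])) :: (_, _, 'i) sequent) \<longleftrightarrow>
      (\<forall>n. BSim (X, j) n n \<in> M \<longrightarrow> (\<exists>m. graph j M X n m))"
    using strict[unfolded graph_def] by (simp add: all_lists_Suc assign_def graph_def) blast
  ultimately show ?thesis
    unfolding ax by blast
qed

text \<open>An assignment in the context of the axioms on a relation symbol consists of the values of the
  variables of the source, followed by those of the target.\<close>

lemma all_lists_append:
  "(\<forall>l. length l = k + k' \<longrightarrow> P l) \<longleftrightarrow> (\<forall>ns ms. length ns = k \<longrightarrow> length ms = k' \<longrightarrow> P (ns @ ms))"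
proof
  assume *: "\<forall>ns ms. length ns = k \<longrightarrow> length ms = k' \<longrightarrow> P (ns @ ms)"
  have "P (take k l @ drop k l)" if "length l = k + k'" for l
    by (intro *[rule_format]) (simp_all add: that)
  then show "\<forall>l. length l = k + k' \<longrightarrow> P l"
    by simp
qed simp

lemma satisfies_iso_rel_axioms:
  fixes M :: "('s, 'r) chain_prop set"
  assumes strict: "\<And>X n m. graph j M X n m \<Longrightarrow> BSim (X, j) n n \<in> M \<and> BSim (X, Suc j) m m \<in> M"
  shows "(\<forall>\<sigma>\<in>iso_rel_axioms j R Xs :: (_, _, 'i) sequent set. satisfies M \<sigma>) \<longleftrightarrow>
     (\<forall>ns ms. length ns = length Xs \<longrightarrow> length ms = length Xs \<longrightarrow>
        (\<forall>i<length Xs. graph j M (Xs ! i) (ns ! i) (ms ! i)) \<longrightarrow>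
        BRel (Copy j R) ns \<in> M \<longleftrightarrow> BRel (Copy (Suc j) R) ms \<in> M)"
proof -
  let ?k = "length Xs"
  let ?xs = "[0..<?k]" and ?ys = "[?k..<2 * ?k]"
  define \<Gamma> where "\<Gamma> = zip ?xs (map (\<lambda>X. (X, j)) Xs) @ zip ?ys (map (\<lambda>X. (X, Suc j)) Xs)"
  define \<alpha> :: "('s \<times> nat, ('s, 'r) chain_rel, 'i) gform"
    where "\<alpha> = GConj (map (\<lambda>(X, x, y). GRel (Iso j X) [x, y]) (zip Xs (zip ?xs ?ys)))"
  have ax: "iso_rel_axioms j R Xs =
      {Sequent \<Gamma> (GAnd \<alpha> (GRel (Copy j R) ?xs)) (GAnd \<alpha> (GRel (Copy (Suc j) R) ?ys)),
       Sequent \<Gamma> (GAnd \<alpha> (GRel (Copy (Suc j) R) ?ys)) (GAnd \<alpha> (GRel (Copy j R) ?xs))}"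
    by (simp add: iso_rel_axioms_def Let_def \<Gamma>_def \<alpha>_def)
  have len: "length \<Gamma> = ?k + ?k"
    by (simp add: \<Gamma>_def)
  have \<Gamma>: "map fst \<Gamma> = [0..<?k + ?k]"
    by (simp add: \<Gamma>_def upt_add_eq_append[of 0 ?k ?k] mult_2)
  have sort: "snd (\<Gamma> ! i) = (Xs ! i, j)" "snd (\<Gamma> ! (?k + i)) = (Xs ! i, Suc j)" if "i < ?k" for i
    using that by (simp_all add: \<Gamma>_def nth_append)
  have sim: "(\<forall>i<?k + ?k. BSim (snd (\<Gamma> ! i)) ((ns @ ms) ! i) ((ns @ ms) ! i) \<in> M)"
    if l: "length ns = ?k" "length ms = ?k"
      and g: "\<forall>i<?k. graph j M (Xs ! i) (ns ! i) (ms ! i)" for ns ms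
  proof (intro allI impI)
    fix i
    assume i: "i < ?k + ?k"
    show "BSim (snd (\<Gamma> ! i)) ((ns @ ms) ! i) ((ns @ ms) ! i) \<in> M"
    proof (cases "i < ?k")
      case True
      then show ?thesis
        using strict[of "Xs ! i" "ns ! i" "ms ! i"] g l by (simp add: nth_append sort)
    next
      case False
      define i' where "i' = i - ?k"
      have "i = ?k + i'" "i' < ?k"
        using i False by (auto simp: i'_def)
      then show ?thesis
        using strict[of "Xs ! i'" "ns ! i'" "ms ! i'"] g l by (simp add: nth_append sort)
    qed
  qed
  have assign: "assign \<Gamma> l x = l ! x" if "length l = ?k + ?k" "x < ?k + ?k" for l x
    unfolding assign_def \<Gamma> using map_of_zip_nth[of "[0..<?k + ?k]" l x] that by simp
  have xs: "map (assign \<Gamma> (ns @ ms)) ?xs = ns" and ys: "map (assign \<Gamma> (ns @ ms)) ?ys = ms"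
    and \<alpha>: "psat M (prop_form \<alpha> (assign \<Gamma> (ns @ ms))) \<longleftrightarrow>
      (\<forall>i<?k. graph j M (Xs ! i) (ns ! i) (ms ! i))"
    if "length ns = ?k" "length ms = ?k" for ns ms
  proof -
    show "map (assign \<Gamma> (ns @ ms)) ?xs = ns" "map (assign \<Gamma> (ns @ ms)) ?ys = ms"
      using that by (auto intro!: nth_equalityI simp: assign nth_append)
    show "psat M (prop_form \<alpha> (assign \<Gamma> (ns @ ms))) \<longleftrightarrow>
      (\<forall>i<?k. graph j M (Xs ! i) (ns ! i) (ms ! i))"
      unfolding \<alpha>_def psat_prop_form_GConj all_set_conv_all_nth
      using that by (simp add: assign nth_append graph_def)
  qed
  show ?thesis
    unfolding ax ball_simps satisfies.simps len all_lists_append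
    using sim by (auto simp: xs ys \<alpha>)
qed

lemma mem_basics_iso_chain:
  "copy_prop j g \<in> basics (prop_theory (iso_chain k T)) \<longleftrightarrow>
     j \<in> {1..k + 1} \<and> g \<in> basics (prop_theory T)"
  by (cases g) (auto simp: basics_prop_theory)

lemma basics_iso_chain_cases:
  assumes "g \<in> basics (prop_theory (iso_chain k T))"
  obtains (copy) j g' where "j \<in> {1..k + 1}" "g' \<in> basics (prop_theory T)" "g = copy_prop j g'"
  | (iso) j X n m where "j \<in> {1..k}" "X \<in> sorts T" "g = BRel (Iso j X) [n, m]"
proof (cases g)
  case (BSim Y n m)
  obtain X j where "Y = (X, j)"
    by (cases Y)
  then show thesis
    using assms BSim by (intro copy[of j "BSim X n m"]) (auto simp: basics_prop_theory)
next
  case (BRel Q ns)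
  show thesis
  proof (cases Q)
    case (Copy j R)
    then show thesis
      using assms BRel by (intro copy[of j "BRel R ns"]) (auto simp: basics_prop_theory)
  next
    case (Iso j X)
    then obtain n m where "ns = [n, m]"
      using assms BRel by (auto simp: basics_prop_theory length_Suc_conv)
    then show thesis
      using assms BRel Iso by (intro iso[of j X n m]) (auto simp: basics_prop_theory)
  qed
qed

lemma is_structure_iso_chain:
  "is_structure (iso_chain k T) M \<longleftrightarrow> M \<subseteq> basics (prop_theory (iso_chain k T)) \<and>
     (\<forall>j\<in>{1..k + 1}. is_structure T (copy_prop j -` M)) \<and>
     (\<forall>j\<in>{1..k}.
        (\<forall>X n m. graph j M X n m \<longrightarrow> BSim (X, j) n n \<in> M \<and> BSim (X, Suc j) m m \<in> M) \<and>
        (\<forall>X n m n' m'. graph j M X n m \<longrightarrow> BSim (X, j) n n' \<in> M \<longrightarrow> BSim (X, Suc j) m m' \<in> M \<longrightarrow>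
           graph j M X n' m'))"
    (is "_ \<longleftrightarrow> ?basics \<and> ?copies \<and> ?graphs")
proof (cases ?basics)
  case True
  have arity: "arity (iso_chain k T) (Copy j R) ! i = (arity T R ! i, j)"
    if "BRel (Copy j R) ns \<in> M" "i < length ns" for j R ns i
    using subsetD[OF True that(1)] that(2) by (simp add: basics_prop_theory)
  show ?thesis
  proof
    assume "is_structure (iso_chain k T) M"
    note str = is_structureD[OF this]
    show "?basics \<and> ?copies \<and> ?graphs"
    proof (intro conjI ballI)
      fix j
      show "is_structure T (copy_prop j -` M)"
      proof (rule is_structureI)
        show "copy_prop j -` M \<subseteq> basics (prop_theory T)"
        proof
          fix g
          assume "g \<in> copy_prop j -` M"
          then show "g \<in> basics (prop_theory T)"
            using subsetD[OF True, of "copy_prop j g"] by (simp add: mem_basics_iso_chain)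
        qed
        show "BSim X m n \<in> copy_prop j -` M" if "BSim X n m \<in> copy_prop j -` M" for X n m
          using that str(2) by simp
        show "BSim X n l \<in> copy_prop j -` M"
          if "BSim X n m \<in> copy_prop j -` M" "BSim X m l \<in> copy_prop j -` M" for X n m l
          using that str(3)[of "(X, j)" n m l] by simp
        show "BRel R ms \<in> copy_prop j -` M"
          if ns: "BRel R ns \<in> copy_prop j -` M" "length ms = length ns"
            and sim: "\<And>i. i < length ns \<Longrightarrow> BSim (arity T R ! i) (ns ! i) (ms ! i) \<in> copy_prop j -` M"
          for R ns ms
        proof -
          have R: "BRel (Copy j R) ns \<in> M"
            using ns by simp
          have "BRel (Copy j R) ms \<in> M"
            by (rule str(4)[OF R ns(2)]) (use sim arity[OF R] in simp)
          then show ?thesis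
            by simp
        qed
        show "BSim (arity T R ! i) (ns ! i) (ns ! i) \<in> copy_prop j -` M"
          if ns: "BRel R ns \<in> copy_prop j -` M" "i < length ns" for R ns i
        proof -
          have R: "BRel (Copy j R) ns \<in> M"
            using ns by simp
          show ?thesis
            using str(5)[OF R ns(2)] arity[OF R ns(2)] by simp
        qed
      qed
    next
      fix j
      show "\<forall>X n m. graph j M X n m \<longrightarrow> BSim (X, j) n n \<in> M \<and> BSim (X, Suc j) m m \<in> M"
        unfolding graph_def using str(5)[of "Iso j _" "[_, _]" 0] str(5)[of "Iso j _" "[_, _]" 1]
        by simp
      show "\<forall>X n m n' m'. graph j M X n m \<longrightarrow> BSim (X, j) n n' \<in> M \<longrightarrow>
          BSim (X, Suc j) m m' \<in> M \<longrightarrow> graph j M X n' m'"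
        unfolding graph_def
      proof (intro allI impI)
        fix X n m n' m'
        assume g: "BRel (Iso j X) [n, m] \<in> M" and s: "BSim (X, j) n n' \<in> M" "BSim (X, Suc j) m m' \<in> M"
        show "BRel (Iso j X) [n', m'] \<in> M"
          by (rule str(4)[OF g]) (use s in \<open>auto simp: less_Suc_eq\<close>)
      qed
    qed (rule True)
  next
    assume *: "?basics \<and> ?copies \<and> ?graphs"
    note copies = conjunct1[OF conjunct2[OF *]] and graphs = conjunct2[OF conjunct2[OF *]]
    note copy = bspec[OF copies]
    have graph_strict: "BSim (X, j) n n \<in> M \<and> BSim (X, Suc j) m m \<in> M"
      if "j \<in> {1..k}" "graph j M X n m" for j X n m
      using bspec[OF graphs that(1)] that(2) by simp
    have graph_cong: "graph j M X n' m'"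
      if "j \<in> {1..k}" "graph j M X n m" "BSim (X, j) n n' \<in> M" "BSim (X, Suc j) m m' \<in> M" for j X n m n' m'
      using conjunct2[OF bspec[OF graphs that(1)]] that(2-4) by blast
    have sim: "j \<in> {1..k + 1}" if "BSim (X, j) n m \<in> M" for X j n m
      using subsetD[OF True that] by (simp add: basics_prop_theory)
    have rel: "j \<in> {1..k + 1}" if "BRel (Copy j R) ns \<in> M" for R j ns
      using subsetD[OF True that] by (simp add: basics_prop_theory)
    have iso: "j \<in> {1..k}" "\<exists>n m. ns = [n, m]" if "BRel (Iso j X) ns \<in> M" for X j ns
      using subsetD[OF True that] by (auto simp: basics_prop_theory length_Suc_conv)
    show "is_structure (iso_chain k T) M"
    proof (rule is_structureI)
      show "BSim Y m n \<in> M" if "BSim Y n m \<in> M" for Y n m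
        using that is_structureD(2)[OF copy[OF sim], of "fst Y" "snd Y" n m] by (cases Y) simp
      show "BSim Y n l \<in> M" if "BSim Y n m \<in> M" "BSim Y m l \<in> M" for Y n m l
        using that is_structureD(3)[OF copy[OF sim], of "fst Y" "snd Y" n m] by (cases Y) simp
      show "BRel Q ms \<in> M" if Q: "BRel Q ns \<in> M" and l: "length ms = length ns"
        and s: "\<And>i. i < length ns \<Longrightarrow> BSim (arity (iso_chain k T) Q ! i) (ns ! i) (ms ! i) \<in> M"
      for Q ns ms
      proof (cases Q)
        case (Copy j R)
        then have R: "BRel (Copy j R) ns \<in> M"
          using Q by simp
        have "BRel R ms \<in> copy_prop j -` M"
          by (rule is_structureD(4)[OF copy[OF rel[OF R]] _ l]) (use R s arity[OF R] in \<open>simp_all add: Copy\<close>)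
        then show ?thesis
          by (simp add: Copy)
      next
        case (Iso j X)
        then obtain n m where nm: "ns = [n, m]"
          using Q iso by blast
        then obtain n' m' where nm': "ms = [n', m']"
          using l by (auto simp: length_Suc_conv)
        have "graph j M X n' m'"
        proof (rule graph_cong)
          show "j \<in> {1..k}" "graph j M X n m"
            using Q iso by (auto simp: Iso nm graph_def)
          show "BSim (X, j) n n' \<in> M" "BSim (X, Suc j) m m' \<in> M"
            using s[of 0] s[of 1] by (simp_all add: Iso nm nm')
        qed
        then show ?thesis
          by (simp add: graph_def Iso nm')
      qed
      show "BSim (arity (iso_chain k T) Q ! i) (ns ! i) (ns ! i) \<in> M"
        if Q: "BRel Q ns \<in> M" and i: "i < length ns" for Q ns i
      proof (cases Q)
        case (Copy j R)
        then have R: "BRel (Copy j R) ns \<in> M"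
          using Q by simp
        have "BSim (arity T R ! i) (ns ! i) (ns ! i) \<in> copy_prop j -` M"
          by (rule is_structureD(5)[OF copy[OF rel[OF R]] _ i]) (use R in simp)
        then show ?thesis
          using arity[OF R i] by (simp add: Copy)
      next
        case (Iso j X)
        then obtain n m where nm: "ns = [n, m]"
          using Q iso by blast
        then have "BSim (X, j) n n \<in> M \<and> BSim (X, Suc j) m m \<in> M"
          using Q iso by (intro graph_strict) (auto simp: Iso graph_def)
        then show ?thesis
          using i by (auto simp: Iso nm less_Suc_eq)
      qed
    qed (rule True)
  qed
qed (simp add: is_structure_def)

text \<open>A model of the theory of chains of isomorphisms amounts to models of \<open>P[T]\<close> with isomorphisms
  between them, so that the structure maps of the groupoid can be described by operations on
  isomorphisms. Being strict and invariant under the equivalence of representatives is part of being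
  a structure on the one side and of being an isomorphism on the other; given strictness, the
  axioms on \<open>\<alpha>\<close> amount to the remaining conditions.\<close>

lemma models_iso_chain:
  "M \<in> models (prop_theory (iso_chain k T)) \<longleftrightarrow> M \<subseteq> basics (prop_theory (iso_chain k T)) \<and>
     (\<forall>j\<in>{1..k + 1}. copy_prop j -` M \<in> models (prop_theory T)) \<and>
     (\<forall>j\<in>{1..k}. is_iso T (copy_prop j -` M) (copy_prop (Suc j) -` M) (graph j M))"
proof (cases "M \<subseteq> basics (prop_theory (iso_chain k T))")
  case True
  define str where "str j \<longleftrightarrow>
    (\<forall>X n m. graph j M X n m \<longrightarrow> BSim (X, j) n n \<in> M \<and> BSim (X, Suc j) m m \<in> M) \<and>
    (\<forall>X n m n' m'. graph j M X n m \<longrightarrow> BSim (X, j) n n' \<in> M \<longrightarrow> BSim (X, Suc j) m m' \<in> M \<longrightarrow>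
       graph j M X n' m')" for j
  define bij where "bij j X \<longleftrightarrow>
    (\<forall>n m n' m'. graph j M X n m \<longrightarrow> graph j M X n' m' \<longrightarrow>
       BSim (X, j) n n' \<in> M \<longleftrightarrow> BSim (X, Suc j) m m' \<in> M) \<and>
    (\<forall>n. BSim (X, j) n n \<in> M \<longrightarrow> (\<exists>m. graph j M X n m)) \<and>
    (\<forall>m. BSim (X, Suc j) m m \<in> M \<longrightarrow> (\<exists>n. graph j M X n m))" for j X
  define pres where "pres j R \<longleftrightarrow>
    (\<forall>ns ms. length ns = length (arity T R) \<longrightarrow> length ms = length (arity T R) \<longrightarrow>
       (\<forall>i<length (arity T R). graph j M (arity T R ! i) (ns ! i) (ms ! i)) \<longrightarrow>
       BRel (Copy j R) ns \<in> M \<longleftrightarrow> BRel (Copy (Suc j) R) ms \<in> M)" for j R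
  \<comment> \<open>The axioms speak of the sorts of \<open>T\<close> only, but outside of them the relations are empty.\<close>
  have "\<not> graph j M X n m" "BSim (X, i) n m \<notin> M" if "X \<notin> sorts T" for i j X n m
    using that subsetD[OF True, of "BRel (Iso j X) [n, m]"] subsetD[OF True, of "BSim (X, i) n m"]
    by (auto simp: graph_def basics_prop_theory)
  then have bij_sort: "bij j X" if "X \<notin> sorts T" for j X
    using that by (simp add: bij_def)
  have is_iso: "is_iso T (copy_prop j -` M) (copy_prop (Suc j) -` M) (graph j M) \<longleftrightarrow>
      str j \<and> (\<forall>X. bij j X) \<and> (\<forall>R\<in>rels T. pres j R)" for j
    unfolding is_iso_def str_def bij_def pres_def
    by (simp only: vimage_eq copy_prop.simps all_conj_distrib conj_assoc Ball_def all_simps)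
  have sat: "(\<forall>\<sigma>\<in>iso_sort_axioms j X :: (_, _, 'c) sequent set. satisfies M \<sigma>) \<longleftrightarrow> bij j X"
    "(\<forall>\<sigma>\<in>iso_rel_axioms j R (arity T R) :: (_, _, 'c) sequent set. satisfies M \<sigma>) \<longleftrightarrow> pres j R"
    if "str j" for j X R
  proof -
    have strict: "BSim (X, j) n n \<in> M \<and> BSim (X, Suc j) m m \<in> M" if "graph j M X n m" for X n m
      using \<open>str j\<close> that by (simp add: str_def)
    show "(\<forall>\<sigma>\<in>iso_sort_axioms j X :: (_, _, 'c) sequent set. satisfies M \<sigma>) \<longleftrightarrow> bij j X"
      unfolding bij_def by (rule satisfies_iso_sort_axioms[OF strict])
    show "(\<forall>\<sigma>\<in>iso_rel_axioms j R (arity T R) :: (_, _, 'c) sequent set. satisfies M \<sigma>) \<longleftrightarrow> pres j R"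
      unfolding pres_def by (rule satisfies_iso_rel_axioms[OF strict])
  qed
  define iso_axs where "iso_axs j \<longleftrightarrow>
    (\<forall>X\<in>sorts T. \<forall>\<sigma>\<in>iso_sort_axioms j X :: (_, _, 'c) sequent set. satisfies M \<sigma>) \<and>
    (\<forall>R\<in>rels T. \<forall>\<sigma>\<in>iso_rel_axioms j R (arity T R) :: (_, _, 'c) sequent set. satisfies M \<sigma>)" for j
  have iso: "str j \<and> iso_axs j \<longleftrightarrow> is_iso T (copy_prop j -` M) (copy_prop (Suc j) -` M) (graph j M)" for j
  proof (cases "str j")
    case True
    then show ?thesis
      unfolding is_iso iso_axs_def using bij_sort by (auto simp: sat)
  qed (simp add: is_iso)
  have ax: "(\<forall>\<sigma>\<in>axioms (iso_chain k T). satisfies M \<sigma>) \<longleftrightarrow>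
      (\<forall>j\<in>{1..k + 1}. \<forall>\<sigma>\<in>axioms T. satisfies (copy_prop j -` M) \<sigma>) \<and> (\<forall>j\<in>{1..k}. iso_axs j)"
    unfolding iso_chain_def gtheory.simps ball_Un ball_UN ball_simps satisfies_copy iso_axs_def
    by (simp only: ball_conj_distrib conj_assoc)
  have "M \<in> models (prop_theory (iso_chain k T)) \<longleftrightarrow>
      (\<forall>j\<in>{1..k + 1}. is_structure T (copy_prop j -` M) \<and> (\<forall>\<sigma>\<in>axioms T. satisfies (copy_prop j -` M) \<sigma>)) \<and>
      (\<forall>j\<in>{1..k}. str j \<and> iso_axs j)"
    unfolding models_prop_theory is_structure_iso_chain ax str_def[symmetric]
    by (simp only: True simp_thms ball_conj_distrib conj_ac)
  then show ?thesis
    by (simp only: True simp_thms iso models_prop_theory)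
qed (simp add: models_def)

lemma is_isoI:
  assumes "\<And>X n m. \<alpha> X n m \<Longrightarrow> BSim X n n \<in> S \<and> BSim X m m \<in> S'"
    and "\<And>X n m n' m'. \<alpha> X n m \<Longrightarrow> BSim X n n' \<in> S \<Longrightarrow> BSim X m m' \<in> S' \<Longrightarrow> \<alpha> X n' m'"
    and "\<And>X n m n' m'. \<alpha> X n m \<Longrightarrow> \<alpha> X n' m' \<Longrightarrow> BSim X n n' \<in> S \<longleftrightarrow> BSim X m m' \<in> S'"
    and "\<And>X n. BSim X n n \<in> S \<Longrightarrow> \<exists>m. \<alpha> X n m"
    and "\<And>X m. BSim X m m \<in> S' \<Longrightarrow> \<exists>n. \<alpha> X n m"
    and "\<And>R ns ms. R \<in> rels T \<Longrightarrow> length ns = length (arity T R) \<Longrightarrow> length ms = length (arity T R) \<Longrightarrow>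
       (\<And>i. i < length (arity T R) \<Longrightarrow> \<alpha> (arity T R ! i) (ns ! i) (ms ! i)) \<Longrightarrow>
       BRel R ns \<in> S \<longleftrightarrow> BRel R ms \<in> S'"
  shows "is_iso T S S' \<alpha>"
  unfolding is_iso_def
  by (intro conjI allI impI)
    (drule assms(1), erule conjunct1, drule assms(1), erule conjunct2, erule (2) assms(2),
     erule (1) assms(3), erule assms(4), erule assms(5), rule assms(6), assumption+, simp)

lemma is_isoD:
  assumes "is_iso T S S' \<alpha>"
  shows "\<alpha> X n m \<Longrightarrow> BSim X n n \<in> S" and "\<alpha> X n m \<Longrightarrow> BSim X m m \<in> S'"
    and "\<alpha> X n m \<Longrightarrow> BSim X n n' \<in> S \<Longrightarrow> BSim X m m' \<in> S' \<Longrightarrow> \<alpha> X n' m'"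
    and "\<alpha> X n m \<Longrightarrow> \<alpha> X n' m' \<Longrightarrow> BSim X n n' \<in> S \<longleftrightarrow> BSim X m m' \<in> S'"
    and "BSim X n n \<in> S \<Longrightarrow> \<exists>m. \<alpha> X n m"
    and "BSim X m m \<in> S' \<Longrightarrow> \<exists>n. \<alpha> X n m"
    and "R \<in> rels T \<Longrightarrow> length ns = length (arity T R) \<Longrightarrow> length ms = length (arity T R) \<Longrightarrow>
       (\<And>i. i < length (arity T R) \<Longrightarrow> \<alpha> (arity T R ! i) (ns ! i) (ms ! i)) \<Longrightarrow>
       BRel R ns \<in> S \<longleftrightarrow> BRel R ms \<in> S'"
proof -
  note 1 = assms[unfolded is_iso_def]
  note 2 = conjunct2[OF 1]
  note 3 = conjunct2[OF 2]
  note 4 = conjunct2[OF 3]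
  note 5 = conjunct2[OF 4]
  note 6 = conjunct2[OF 5]
  show "\<alpha> X n m \<Longrightarrow> BSim X n n \<in> S" and "\<alpha> X n m \<Longrightarrow> BSim X m m \<in> S'"
    using conjunct1[OF 1] by simp_all
  show "\<alpha> X n m \<Longrightarrow> BSim X n n' \<in> S \<Longrightarrow> BSim X m m' \<in> S' \<Longrightarrow> \<alpha> X n' m'"
    using conjunct1[OF 2] by blast
  show "\<alpha> X n m \<Longrightarrow> \<alpha> X n' m' \<Longrightarrow> BSim X n n' \<in> S \<longleftrightarrow> BSim X m m' \<in> S'"
    using conjunct1[OF 3] by blast
  show "BSim X n n \<in> S \<Longrightarrow> \<exists>m. \<alpha> X n m"
    using conjunct1[OF 4] by blast
  show "BSim X m m \<in> S' \<Longrightarrow> \<exists>n. \<alpha> X n m"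
    using conjunct1[OF 5] by blast
  show "R \<in> rels T \<Longrightarrow> length ns = length (arity T R) \<Longrightarrow> length ms = length (arity T R) \<Longrightarrow>
       (\<And>i. i < length (arity T R) \<Longrightarrow> \<alpha> (arity T R ! i) (ns ! i) (ms ! i)) \<Longrightarrow>
       BRel R ns \<in> S \<longleftrightarrow> BRel R ms \<in> S'"
    using 6[rule_format, of R ns ms] .
qed

lemma is_structure_refl:
  assumes S: "is_structure T S" and "BSim X n m \<in> S"
  shows "BSim X n n \<in> S" "BSim X m m \<in> S"
  using is_structureD(3)[OF S assms(2) is_structureD(2)[OF S assms(2)]]
    is_structureD(3)[OF S is_structureD(2)[OF S assms(2)] assms(2)] .

lemma is_iso_identity:
  assumes S: "is_structure T S"
  shows "is_iso T S S (\<lambda>X n m. BSim X n m \<in> S)"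
proof (rule is_isoI)
  note sym = is_structureD(2)[OF S] and trans = is_structureD(3)[OF S]
  show "BSim X n n \<in> S \<and> BSim X m m \<in> S" if "BSim X n m \<in> S" for X n m
    using is_structure_refl[OF S that] by simp
  show "BSim X n' m' \<in> S" if "BSim X n m \<in> S" "BSim X n n' \<in> S" "BSim X m m' \<in> S" for X n m n' m'
    by (rule trans[OF sym[OF that(2)] trans[OF that(1,3)]])
  show "BSim X n n' \<in> S \<longleftrightarrow> BSim X m m' \<in> S" if "BSim X n m \<in> S" "BSim X n' m' \<in> S" for X n m n' m'
    using trans[OF sym[OF that(1)] trans[OF _ that(2)]] trans[OF that(1) trans[OF _ sym[OF that(2)]]]
    by (rule iffI)
  show "BRel R ns \<in> S \<longleftrightarrow> BRel R ms \<in> S"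
    if l: "length ns = length (arity T R)" "length ms = length (arity T R)"
      and s: "\<And>i. i < length (arity T R) \<Longrightarrow> BSim (arity T R ! i) (ns ! i) (ms ! i) \<in> S" for R ns ms
  proof
    show "BRel R ms \<in> S" if "BRel R ns \<in> S"
      by (rule is_structureD(4)[OF S that]) (use l s in simp_all)
    show "BRel R ns \<in> S" if "BRel R ms \<in> S"
      by (rule is_structureD(4)[OF S that]) (use l s sym in simp_all)
  qed
qed blast+

lemma is_iso_inverse:
  assumes \<alpha>: "is_iso T S S' \<alpha>"
  shows "is_iso T S' S (\<lambda>X n m. \<alpha> X m n)"
proof (rule is_isoI)
  show "BSim X n n \<in> S' \<and> BSim X m m \<in> S" if "\<alpha> X m n" for X n m
    using is_isoD(1,2)[OF \<alpha> that] by simp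
  show "\<alpha> X m' n'" if "\<alpha> X m n" "BSim X n n' \<in> S'" "BSim X m m' \<in> S" for X n m n' m'
    by (rule is_isoD(3)[OF \<alpha> that(1,3,2)])
  show "BSim X n n' \<in> S' \<longleftrightarrow> BSim X m m' \<in> S" if "\<alpha> X m n" "\<alpha> X m' n'" for X n m n' m'
    using is_isoD(4)[OF \<alpha> that] by simp
  show "BRel R ns \<in> S' \<longleftrightarrow> BRel R ms \<in> S"
    if "R \<in> rels T" "length ns = length (arity T R)" "length ms = length (arity T R)"
      "\<And>i. i < length (arity T R) \<Longrightarrow> \<alpha> (arity T R ! i) (ms ! i) (ns ! i)" for R ns ms
    using is_isoD(7)[OF \<alpha> that(1,3,2,4)] by simp
qed (use is_isoD(5,6)[OF \<alpha>] in blast)+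

lemma is_iso_compose:
  assumes \<alpha>: "is_iso T S S' \<alpha>" and \<beta>: "is_iso T S' S'' \<beta>"
  shows "is_iso T S S'' (\<lambda>X. \<alpha> X OO \<beta> X)"
proof (rule is_isoI)
  show "BSim X n n \<in> S \<and> BSim X m m \<in> S''" if "(\<alpha> X OO \<beta> X) n m" for X n m
    using that is_isoD(1)[OF \<alpha>] is_isoD(2)[OF \<beta>] by auto
  show "(\<alpha> X OO \<beta> X) n' m'"
    if g: "(\<alpha> X OO \<beta> X) n m" and s: "BSim X n n' \<in> S" "BSim X m m' \<in> S''" for X n m n' m'
  proof -
    obtain q where q: "\<alpha> X n q" "\<beta> X q m"
      using g by blast
    have "\<alpha> X n' q"
      by (rule is_isoD(3)[OF \<alpha> q(1) s(1) is_isoD(2)[OF \<alpha> q(1)]])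
    moreover have "\<beta> X q m'"
      by (rule is_isoD(3)[OF \<beta> q(2) is_isoD(1)[OF \<beta> q(2)] s(2)])
    ultimately show ?thesis
      by blast
  qed
  show "BSim X n n' \<in> S \<longleftrightarrow> BSim X m m' \<in> S''"
    if g: "(\<alpha> X OO \<beta> X) n m" "(\<alpha> X OO \<beta> X) n' m'" for X n m n' m'
  proof -
    obtain q q' where "\<alpha> X n q" "\<beta> X q m" "\<alpha> X n' q'" "\<beta> X q' m'"
      using g by blast
    then show ?thesis
      using is_isoD(4)[OF \<alpha>, of X n q n' q'] is_isoD(4)[OF \<beta>, of X q m q' m'] by simp
  qed
  show "\<exists>m. (\<alpha> X OO \<beta> X) n m" if n: "BSim X n n \<in> S" for X n
  proof -
    obtain q where q: "\<alpha> X n q"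
      using is_isoD(5)[OF \<alpha> n] by blast
    obtain m where "\<beta> X q m"
      using is_isoD(5)[OF \<beta> is_isoD(2)[OF \<alpha> q]] by blast
    then show ?thesis
      using q by blast
  qed
  show "\<exists>n. (\<alpha> X OO \<beta> X) n m" if m: "BSim X m m \<in> S''" for X m
  proof -
    obtain q where q: "\<beta> X q m"
      using is_isoD(6)[OF \<beta> m] by blast
    obtain n where "\<alpha> X n q"
      using is_isoD(6)[OF \<alpha> is_isoD(1)[OF \<beta> q]] by blast
    then show ?thesis
      using q by blast
  qed
  show "BRel R ns \<in> S \<longleftrightarrow> BRel R ms \<in> S''"
    if R: "R \<in> rels T" and l: "length ns = length (arity T R)" "length ms = length (arity T R)"
      and g: "\<And>i. i < length (arity T R) \<Longrightarrow>
        (\<alpha> (arity T R ! i) OO \<beta> (arity T R ! i)) (ns ! i) (ms ! i)" for R ns ms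
  proof -
    have "\<forall>i<length (arity T R). \<exists>q. \<alpha> (arity T R ! i) (ns ! i) q \<and> \<beta> (arity T R ! i) q (ms ! i)"
      using g by blast
    then obtain q where q: "\<And>i. i < length (arity T R) \<Longrightarrow> \<alpha> (arity T R ! i) (ns ! i) (q i)"
        "\<And>i. i < length (arity T R) \<Longrightarrow> \<beta> (arity T R ! i) (q i) (ms ! i)"
      by metis
    let ?qs = "map q [0..<length (arity T R)]"
    have "BRel R ns \<in> S \<longleftrightarrow> BRel R ?qs \<in> S'"
      by (rule is_isoD(7)[OF \<alpha> R l(1)]) (simp_all add: q)
    also have "\<dots> \<longleftrightarrow> BRel R ms \<in> S''"
      by (rule is_isoD(7)[OF \<beta> R _ l(2)]) (simp_all add: q)
    finally show ?thesis .
  qed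
qed

lemma identity_OO:
  assumes S: "is_structure T S" and \<alpha>: "is_iso T S S' \<alpha>"
  shows "(\<lambda>n m. BSim X n m \<in> S) OO \<alpha> X = \<alpha> X"
proof (intro ext iffI)
  fix n m
  assume "((\<lambda>n m. BSim X n m \<in> S) OO \<alpha> X) n m"
  then obtain q where q: "BSim X n q \<in> S" "\<alpha> X q m"
    by blast
  show "\<alpha> X n m"
    by (rule is_isoD(3)[OF \<alpha> q(2) is_structureD(2)[OF S q(1)] is_isoD(2)[OF \<alpha> q(2)]])
qed (use is_isoD(1)[OF \<alpha>] in blast)

lemma OO_identity:
  assumes S': "is_structure T S'" and \<alpha>: "is_iso T S S' \<alpha>"
  shows "\<alpha> X OO (\<lambda>n m. BSim X n m \<in> S') = \<alpha> X"
proof (intro ext iffI)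
  fix n m
  assume "(\<alpha> X OO (\<lambda>n m. BSim X n m \<in> S')) n m"
  then obtain q where q: "\<alpha> X n q" "BSim X q m \<in> S'"
    by blast
  show "\<alpha> X n m"
    by (rule is_isoD(3)[OF \<alpha> q(1) is_isoD(1)[OF \<alpha> q(1)] q(2)])
qed (use is_isoD(2)[OF \<alpha>] in blast)

text \<open>Representatives of the same element of the source have a common image, because \<open>\<alpha>\<close> is total and
  invariant; conversely, a common image identifies them, because \<open>\<alpha>\<close> is injective.\<close>

lemma OO_inverse:
  assumes S: "is_structure T S" and \<alpha>: "is_iso T S S' \<alpha>"
  shows "\<alpha> X OO (\<lambda>n m. \<alpha> X m n) = (\<lambda>n m. BSim X n m \<in> S)"
proof (intro ext iffI)
  fix n m
  assume "(\<alpha> X OO (\<lambda>n m. \<alpha> X m n)) n m"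
  then obtain q where q: "\<alpha> X n q" "\<alpha> X m q"
    by blast
  show "BSim X n m \<in> S"
    using is_isoD(4)[OF \<alpha> q] is_isoD(2)[OF \<alpha> q(1)] by simp
next
  fix n m
  assume nm: "BSim X n m \<in> S"
  obtain q where q: "\<alpha> X n q"
    using is_isoD(5)[OF \<alpha> is_structure_refl(1)[OF S nm]] by blast
  have "\<alpha> X m q"
    by (rule is_isoD(3)[OF \<alpha> q nm is_isoD(2)[OF \<alpha> q]])
  then show "(\<alpha> X OO (\<lambda>n m. \<alpha> X m n)) n m"
    using q by blast
qed


section \<open>Arrows and composable pairs\<close>

text \<open>The number \<open>1\<close> of the first copy must not be rewritten to a successor: the rules about copies
  are stated with numerals.\<close>

declare One_nat_def [simp del]

lemma models_iso_chain_1: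
  "M \<in> models (prop_theory (iso_chain 1 T)) \<longleftrightarrow> M \<subseteq> basics (prop_theory (iso_chain 1 T)) \<and>
     copy_prop 1 -` M \<in> models (prop_theory T) \<and> copy_prop 2 -` M \<in> models (prop_theory T) \<and>
     is_iso T (copy_prop 1 -` M) (copy_prop 2 -` M) (graph 1 M)"
proof -
  have "{1..1 + 1} = {1, 2::nat}" "{1..1} = {1::nat}" "Suc 1 = 2"
    by auto
  then show ?thesis
    unfolding models_iso_chain by simp
qed

lemma models_iso_chain_2:
  "M \<in> models (prop_theory (iso_chain 2 T)) \<longleftrightarrow> M \<subseteq> basics (prop_theory (iso_chain 2 T)) \<and>
     copy_prop 1 -` M \<in> models (prop_theory T) \<and> copy_prop 2 -` M \<in> models (prop_theory T) \<and>
     copy_prop 3 -` M \<in> models (prop_theory T) \<and>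
     is_iso T (copy_prop 1 -` M) (copy_prop 2 -` M) (graph 1 M) \<and>
     is_iso T (copy_prop 2 -` M) (copy_prop 3 -` M) (graph 2 M)"
proof -
  have "{1..2 + 1} = {1, 2, 3::nat}" "{1..2} = {1, 2::nat}" "Suc 1 = 2" "Suc 2 = 3"
    by auto
  then show ?thesis
    unfolding models_iso_chain by simp
qed

text \<open>Inverse to taking source, target and graph of a model of the theory of isomorphisms.\<close>

definition iso_code :: "('s, 'r) bprop set \<Rightarrow> ('s, 'r) bprop set \<Rightarrow> ('s \<Rightarrow> nat \<Rightarrow> nat \<Rightarrow> bool) \<Rightarrow>
    ('s, 'r) chain_prop set" where
  "iso_code S S' \<alpha> =
     copy_prop 1 ` S \<union> copy_prop 2 ` S' \<union> {BRel (Iso 1 X) [n, m] | X n m. \<alpha> X n m}"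

lemma copy_prop_eq_iff [simp]: "copy_prop j g = copy_prop j' g' \<longleftrightarrow> j = j' \<and> g = g'"
  by (cases g; cases g') auto

lemma copy_prop_neq_Iso [simp]: "copy_prop j g \<noteq> BRel (Iso i X) ns"
  by (cases g) auto

lemma source_iso_code [simp]: "copy_prop 1 -` iso_code S S' \<alpha> = S"
  and target_iso_code [simp]: "copy_prop 2 -` iso_code S S' \<alpha> = S'"
  by (auto simp: iso_code_def vimage_def image_iff)

lemma graph_iso_code [simp]: "graph 1 (iso_code S S' \<alpha>) = \<alpha>"
  by (intro ext) (auto simp: graph_def iso_code_def dest: sym)

lemma mem_iso_code:
  "copy_prop j g \<in> iso_code S S' \<alpha> \<longleftrightarrow> j = 1 \<and> g \<in> S \<or> j = 2 \<and> g \<in> S'"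
  "BRel (Iso j X) [n, m] \<in> iso_code S S' \<alpha> \<longleftrightarrow> j = 1 \<and> \<alpha> X n m"
  by (auto simp: iso_code_def image_iff dest: sym)

text \<open>Each basic proposition of the theory of isomorphisms belongs to one of the two copies of \<open>T\<close> or
  to the isomorphism.\<close>

lemma iso_code_eqI:
  assumes M: "M \<subseteq> basics (prop_theory (iso_chain 1 T))"
    and "copy_prop 1 -` M = S" "copy_prop 2 -` M = S'" "graph 1 M = \<alpha>"
  shows "M = iso_code S S' \<alpha>"
proof (rule Set.set_eqI)
  have copy_iff: "copy_prop 1 g \<in> M \<longleftrightarrow> g \<in> S" "copy_prop 2 g \<in> M \<longleftrightarrow> g \<in> S'" for g
    using assms(2,3) by blast+
  have iso_iff: "BRel (Iso 1 X) [n, m] \<in> M \<longleftrightarrow> \<alpha> X n m" for X n m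
    unfolding assms(4)[symmetric] graph_def ..
  have N: "g \<in> M \<longleftrightarrow> g \<in> iso_code S S' \<alpha>" if "g \<in> basics (prop_theory (iso_chain 1 T))" for g
    using that
  proof (cases rule: basics_iso_chain_cases)
    case (copy j g')
    then have "j = 1 \<or> j = 2"
      by auto
    then show ?thesis
      using copy_iff by (auto simp: copy mem_iso_code)
  next
    case (iso j X n m)
    then show ?thesis
      using iso_iff by (simp add: mem_iso_code)
  qed
  fix g
  show "g \<in> M \<longleftrightarrow> g \<in> iso_code S S' \<alpha>"
  proof
    assume "g \<in> iso_code S S' \<alpha>"
    then consider g' where "g' \<in> S" "g = copy_prop 1 g'" | g' where "g' \<in> S'" "g = copy_prop 2 g'"
      | X n m where "\<alpha> X n m" "g = BRel (Iso 1 X) [n, m]"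
      unfolding iso_code_def by blast
    then show "g \<in> M"
      by cases (simp_all add: copy_iff iso_iff)
  qed (use N M in blast)
qed

lemma iso_code_in_models:
  assumes S: "S \<in> models (prop_theory T)" and S': "S' \<in> models (prop_theory T)"
    and \<alpha>: "is_iso T S S' \<alpha>"
  shows "iso_code S S' \<alpha> \<in> models (prop_theory (iso_chain 1 T))"
proof -
  have b: "S \<subseteq> basics (prop_theory T)" "S' \<subseteq> basics (prop_theory T)"
    using S S' by (auto simp: models_def)
  have X: "X \<in> sorts T" if "\<alpha> X n m" for X n m
    using subsetD[OF b(1) is_isoD(1)[OF \<alpha> that]] by (simp add: basics_prop_theory)
  have "iso_code S S' \<alpha> \<subseteq> basics (prop_theory (iso_chain 1 T))"
    unfolding iso_code_def
  proof (intro Un_least image_subsetI subsetI)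
    show "copy_prop 1 g \<in> basics (prop_theory (iso_chain 1 T))" if "g \<in> S" for g
      using b that by (auto simp: mem_basics_iso_chain)
    show "copy_prop 2 g \<in> basics (prop_theory (iso_chain 1 T))" if "g \<in> S'" for g
      using b that by (auto simp: mem_basics_iso_chain)
    show "g \<in> basics (prop_theory (iso_chain 1 T))" if "g \<in> {BRel (Iso 1 X) [n, m] | X n m. \<alpha> X n m}" for g
      using that X by (auto simp: basics_prop_theory)
  qed
  then show ?thesis
    unfolding models_iso_chain_1 using S S' \<alpha> by simp
qed

lemma shift_copy_prop [simp]: "shift_prop (copy_prop j g) = copy_prop (Suc j) g"
  by (cases g) auto

lemma shift_prop_eq_copy_prop:
  "shift_prop g = copy_prop i h \<longleftrightarrow> (\<exists>j. i = Suc j \<and> g = copy_prop j h)"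
  by (cases g rule: shift_prop.cases; cases h) auto

lemma shift_prop_eq_Iso:
  "shift_prop g = BRel (Iso i X) ns \<longleftrightarrow> (\<exists>j. i = Suc j \<and> g = BRel (Iso j X) ns)"
  by (cases g rule: shift_prop.cases) auto

text \<open>The model of the theory of composable pairs given by two arrows \<open>M\<close> and \<open>N\<close>. The second copy
  of \<open>T\<close> is contributed by both of them, consistently if the target of \<open>M\<close> is the source of \<open>N\<close>.\<close>

definition pair_code :: "('s, 'r) chain_prop set \<Rightarrow> ('s, 'r) chain_prop set \<Rightarrow> ('s, 'r) chain_prop set" where
  "pair_code M N = M \<union> shift_prop ` N"

definition first_arrow :: "('s, 'r) chain_prop set \<Rightarrow> ('s, 'r) chain_prop set" where
  "first_arrow K = iso_code (copy_prop 1 -` K) (copy_prop 2 -` K) (graph 1 K)"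

definition second_arrow :: "('s, 'r) chain_prop set \<Rightarrow> ('s, 'r) chain_prop set" where
  "second_arrow K = iso_code (copy_prop 2 -` K) (copy_prop 3 -` K) (graph 2 K)"

lemma mem_pair_code:
  "copy_prop i g \<in> pair_code M N \<longleftrightarrow> copy_prop i g \<in> M \<or> (\<exists>j. i = Suc j \<and> copy_prop j g \<in> N)"
  "BRel (Iso i X) ns \<in> pair_code M N \<longleftrightarrow>
     BRel (Iso i X) ns \<in> M \<or> (\<exists>j. i = Suc j \<and> BRel (Iso j X) ns \<in> N)"
  unfolding pair_code_def Un_iff image_iff
  by (metis shift_prop_eq_copy_prop) (metis shift_prop_eq_Iso)

lemma mem_arrow:
  assumes "M \<subseteq> basics (prop_theory (iso_chain 1 T))"
  shows "copy_prop j g \<in> M \<Longrightarrow> j = 1 \<or> j = 2" and "BRel (Iso j X) ns \<in> M \<Longrightarrow> j = 1"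
  using subsetD[OF assms, of "copy_prop j g"] subsetD[OF assms, of "BRel (Iso j X) ns"]
  by (auto simp: mem_basics_iso_chain basics_prop_theory)

lemma pair_code_components:
  assumes M: "M \<subseteq> basics (prop_theory (iso_chain 1 T))" and N: "N \<subseteq> basics (prop_theory (iso_chain 1 T))"
    and st: "copy_prop 2 -` M = copy_prop 1 -` N"
  shows "copy_prop 1 -` pair_code M N = copy_prop 1 -` M"
    and "copy_prop 2 -` pair_code M N = copy_prop 2 -` M"
    and "copy_prop 3 -` pair_code M N = copy_prop 2 -` N"
    and "graph 1 (pair_code M N) = graph 1 M"
    and "graph 2 (pair_code M N) = graph 1 N"
proof -
  have [simp]: "1 = Suc j \<longleftrightarrow> j = 0" "2 = Suc j \<longleftrightarrow> j = 1" "3 = Suc j \<longleftrightarrow> j = 2" for j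
    by auto
  have st': "copy_prop 2 g \<in> M \<longleftrightarrow> copy_prop 1 g \<in> N" for g
    using st by blast
  have [simp]: "copy_prop 0 g \<notin> N" "copy_prop 3 g \<notin> M" "BRel (Iso 0 X) ns \<notin> N"
      "BRel (Iso 2 X) ns \<notin> M" for g X ns
    using mem_arrow(1)[OF N, of 0 g] mem_arrow(1)[OF M, of 3 g] mem_arrow(2)[OF N, of 0 X ns]
      mem_arrow(2)[OF M, of 2 X ns] by auto
  show "copy_prop 1 -` pair_code M N = copy_prop 1 -` M"
    and "copy_prop 2 -` pair_code M N = copy_prop 2 -` M"
    and "copy_prop 3 -` pair_code M N = copy_prop 2 -` N"
    by (auto simp: mem_pair_code st')
  show "graph 1 (pair_code M N) = graph 1 M" and "graph 2 (pair_code M N) = graph 1 N"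
    by (intro ext; auto simp: mem_pair_code graph_def)+
qed

lemma pair_code_in_models:
  assumes M: "M \<in> models (prop_theory (iso_chain 1 T))" and N: "N \<in> models (prop_theory (iso_chain 1 T))"
    and st: "copy_prop 2 -` M = copy_prop 1 -` N"
  shows "pair_code M N \<in> models (prop_theory (iso_chain 2 T))"
proof -
  note M' = M[unfolded models_iso_chain_1] and N' = N[unfolded models_iso_chain_1]
  have "g \<in> basics (prop_theory (iso_chain 2 T)) \<and> shift_prop g \<in> basics (prop_theory (iso_chain 2 T))"
    if "g \<in> basics (prop_theory (iso_chain 1 T))" for g
    using that
    by (cases rule: basics_iso_chain_cases) (auto simp: mem_basics_iso_chain basics_prop_theory)
  then have "pair_code M N \<subseteq> basics (prop_theory (iso_chain 2 T))"
    using M' N' unfolding pair_code_def by blast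
  then show ?thesis
    unfolding models_iso_chain_2 pair_code_components[OF conjunct1[OF M'] conjunct1[OF N'] st]
    using M' N' st by simp
qed

lemma arrows_pair_code:
  assumes M: "M \<in> models (prop_theory (iso_chain 1 T))" and N: "N \<in> models (prop_theory (iso_chain 1 T))"
    and st: "copy_prop 2 -` M = copy_prop 1 -` N"
  shows "first_arrow (pair_code M N) = M" and "second_arrow (pair_code M N) = N"
proof -
  have b: "M \<subseteq> basics (prop_theory (iso_chain 1 T))" "N \<subseteq> basics (prop_theory (iso_chain 1 T))"
    using M N unfolding models_iso_chain_1 by blast+
  note c = pair_code_components[OF b st]
  show "first_arrow (pair_code M N) = M"
    unfolding first_arrow_def c by (rule iso_code_eqI[OF b(1), symmetric]) simp_all
  show "second_arrow (pair_code M N) = N"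
    unfolding second_arrow_def c by (rule iso_code_eqI[OF b(2), symmetric]) (simp_all add: st)
qed

lemma pair_code_arrows:
  assumes K: "K \<in> models (prop_theory (iso_chain 2 T))"
  shows "pair_code (first_arrow K) (second_arrow K) = K"
proof (rule Set.set_eqI)
  have b: "K \<subseteq> basics (prop_theory (iso_chain 2 T))"
    using K unfolding models_iso_chain_2 by blast
  fix g
  show "g \<in> pair_code (first_arrow K) (second_arrow K) \<longleftrightarrow> g \<in> K"
  proof
    assume "g \<in> pair_code (first_arrow K) (second_arrow K)"
    then show "g \<in> K"
      by (auto simp: pair_code_def first_arrow_def second_arrow_def iso_code_def graph_def
          numeral_eq_Suc One_nat_def)
  next
    assume g: "g \<in> K"
    then have "g \<in> basics (prop_theory (iso_chain 2 T))"
      using b by blast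
    then show "g \<in> pair_code (first_arrow K) (second_arrow K)"
    proof (cases rule: basics_iso_chain_cases)
      case (copy j g')
      then consider "j = 1 \<or> j = 2" | "j = 3"
        by fastforce
      then show ?thesis
      proof cases
        case 1
        then show ?thesis
          using g by (auto simp: copy mem_pair_code first_arrow_def mem_iso_code)
      next
        case 2
        then have "copy_prop 2 g' \<in> second_arrow K"
          using g by (simp add: copy second_arrow_def mem_iso_code)
        then show ?thesis
          unfolding copy mem_pair_code 2 by (intro disjI2 exI[of _ 2]) simp
      qed
    next
      case (iso j X n m)
      then consider "j = 1" | "j = 2"
        by fastforce
      then show ?thesis
      proof cases
        case 1
        then show ?thesis
          using g by (simp add: iso mem_pair_code first_arrow_def mem_iso_code graph_def)
      next
        case 2
        then have "BRel (Iso 1 X) [n, m] \<in> second_arrow K"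
          using g by (simp add: iso second_arrow_def mem_iso_code graph_def)
        then show ?thesis
          unfolding iso mem_pair_code 2 by (intro disjI2 exI[of _ 1]) simp
      qed
    qed
  qed
qed

lemma arrows_in_models:
  assumes K: "K \<in> models (prop_theory (iso_chain 2 T))"
  shows "first_arrow K \<in> models (prop_theory (iso_chain 1 T))"
    and "second_arrow K \<in> models (prop_theory (iso_chain 1 T))"
  using K unfolding models_iso_chain_2 first_arrow_def second_arrow_def
  by (auto intro!: iso_code_in_models)

section \<open>The groupoid of models\<close>

definition model_groupoid ::
  "('s, 'r, 'i) gtheory \<Rightarrow> (('s, 'r) bprop set, ('s, 'r) chain_prop set) top_groupoid" where
  "model_groupoid T =
    \<lparr>objects = model_space (prop_theory T),
     arrows = model_space (prop_theory (iso_chain 1 T)),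
     source = (\<lambda>M. copy_prop 1 -` M),
     target = (\<lambda>M. copy_prop 2 -` M),
     identity = (\<lambda>S. iso_code S S (\<lambda>X n m. BSim X n m \<in> S)),
     inversion = (\<lambda>M. iso_code (copy_prop 2 -` M) (copy_prop 1 -` M) (\<lambda>X n m. graph 1 M X m n)),
     composition = (\<lambda>(M, N).
       iso_code (copy_prop 1 -` M) (copy_prop 2 -` N) (\<lambda>X. graph 1 M X OO graph 1 N X))\<rparr>"

lemma model_groupoid_simps [simp]:
  "objects (model_groupoid T) = model_space (prop_theory T)"
  "arrows (model_groupoid T) = model_space (prop_theory (iso_chain 1 T))"
  "source (model_groupoid T) M = copy_prop 1 -` M"
  "target (model_groupoid T) M = copy_prop 2 -` M"
  "identity (model_groupoid T) S = iso_code S S (\<lambda>X n m. BSim X n m \<in> S)"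
  "inversion (model_groupoid T) M =
     iso_code (copy_prop 2 -` M) (copy_prop 1 -` M) (\<lambda>X n m. graph 1 M X m n)"
  "composition (model_groupoid T) (M, N) =
     iso_code (copy_prop 1 -` M) (copy_prop 2 -` N) (\<lambda>X. graph 1 M X OO graph 1 N X)"
  by (simp_all add: model_groupoid_def)

lemma topspace_composable:
  "topspace (composable (model_groupoid T)) =
     {(M, N). M \<in> models (prop_theory (iso_chain 1 T)) \<and> N \<in> models (prop_theory (iso_chain 1 T)) \<and>
        copy_prop 2 -` M = copy_prop 1 -` N}"
  by (auto simp: composable_def)

text \<open>The structure maps other than composition send generators to generators.\<close>

lemma model_map_pgen:
  assumes "countable (paxioms P')"
    and "\<And>g. g \<in> basics P \<Longrightarrow> t g \<in> basics P'"
    and "\<And>S. S \<in> models P' \<Longrightarrow> h S \<in> models P"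
    and "\<And>S g. S \<in> models P' \<Longrightarrow> g \<in> basics P \<Longrightarrow> g \<in> h S \<longleftrightarrow> t g \<in> S"
  shows "model_map P P' (\<lambda>g. pgen P' (t g)) h"
  by unfold_locales (simp_all add: assms extent_pgen pclosed_pgen)

lemma countable_chain_axioms:
  "countable_theory T \<Longrightarrow> countable (paxioms (prop_theory (iso_chain k T)))"
  by (intro countable_prop_theory countable_theory_iso_chain)

lemma model_map_copy:
  assumes "countable_theory T" and j: "j \<in> {1..k + 1}"
  shows "model_map (prop_theory T) (prop_theory (iso_chain k T))
    (\<lambda>g. pgen (prop_theory (iso_chain k T)) (copy_prop j g)) (\<lambda>M. copy_prop j -` M)"
proof (rule model_map_pgen)
  show "copy_prop j g \<in> basics (prop_theory (iso_chain k T))" if "g \<in> basics (prop_theory T)" for g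
    using that j by (simp add: mem_basics_iso_chain)
  show "copy_prop j -` M \<in> models (prop_theory T)" if "M \<in> models (prop_theory (iso_chain k T))" for M
    using that j unfolding models_iso_chain by blast
qed (simp_all add: countable_chain_axioms assms(1))

lemma is_structure_model: "S \<in> models (prop_theory T) \<Longrightarrow> is_structure T S"
  by (simp add: models_prop_theory)

lemma arrow_simps:
  "ident_prop (copy_prop j g) = g"
  "invert_prop (copy_prop 1 g) = copy_prop 2 g"
  "invert_prop (copy_prop 2 g) = copy_prop 1 g"
  "j = 1 \<Longrightarrow> compose_gen P (copy_prop j g) = pgen P (copy_prop 1 g)"
  "j = 2 \<Longrightarrow> compose_gen P (copy_prop j g) = pgen P (copy_prop 3 g)"
  by (cases g; simp add: One_nat_def)+

lemma basics_arrow_cases: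
  assumes "g \<in> basics (prop_theory (iso_chain 1 T))"
  obtains (source) g' where "g' \<in> basics (prop_theory T)" "g = copy_prop 1 g'"
  | (target) g' where "g' \<in> basics (prop_theory T)" "g = copy_prop 2 g'"
  | (graph) X n m where "X \<in> sorts T" "g = BRel (Iso 1 X) [n, m]"
  using assms
proof (cases rule: basics_iso_chain_cases)
  case (copy j g')
  then have "j = 1 \<or> j = 2"
    by auto
  then show thesis
    using copy source target by blast
next
  case (iso j X n m)
  then have "j = 1"
    by simp
  then show thesis
    using iso graph by blast
qed

lemma model_map_identity:
  assumes "countable_theory T"
  shows "model_map (prop_theory (iso_chain 1 T)) (prop_theory T)
    (\<lambda>g. pgen (prop_theory T) (ident_prop g)) (\<lambda>S. iso_code S S (\<lambda>X n m. BSim X n m \<in> S))"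
proof (rule model_map_pgen)
  show "ident_prop g \<in> basics (prop_theory T)" if "g \<in> basics (prop_theory (iso_chain 1 T))" for g
    using that by (cases rule: basics_arrow_cases) (simp_all add: arrow_simps basics_prop_theory)
  show "g \<in> iso_code S S (\<lambda>X n m. BSim X n m \<in> S) \<longleftrightarrow> ident_prop g \<in> S"
    if "g \<in> basics (prop_theory (iso_chain 1 T))" for S g
    using that by (cases rule: basics_arrow_cases) (simp_all add: arrow_simps mem_iso_code)
qed (simp_all add: countable_prop_theory assms iso_code_in_models is_iso_identity is_structure_model)

lemma model_map_inversion:
  assumes "countable_theory T"
  shows "model_map (prop_theory (iso_chain 1 T)) (prop_theory (iso_chain 1 T))
    (\<lambda>g. pgen (prop_theory (iso_chain 1 T)) (invert_prop g))
    (\<lambda>M. iso_code (copy_prop 2 -` M) (copy_prop 1 -` M) (\<lambda>X n m. graph 1 M X m n))"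
proof (rule model_map_pgen)
  show "invert_prop g \<in> basics (prop_theory (iso_chain 1 T))"
    if "g \<in> basics (prop_theory (iso_chain 1 T))" for g
    using that by (cases rule: basics_arrow_cases)
      (simp_all add: arrow_simps mem_basics_iso_chain basics_prop_theory)
  show "g \<in> iso_code (copy_prop 2 -` M) (copy_prop 1 -` M) (\<lambda>X n m. graph 1 M X m n) \<longleftrightarrow>
      invert_prop g \<in> M" if "g \<in> basics (prop_theory (iso_chain 1 T))" for M g
    using that by (cases rule: basics_arrow_cases) (simp_all add: arrow_simps mem_iso_code graph_def)
  show "iso_code (copy_prop 2 -` M) (copy_prop 1 -` M) (\<lambda>X n m. graph 1 M X m n)
      \<in> models (prop_theory (iso_chain 1 T))" if "M \<in> models (prop_theory (iso_chain 1 T))" for M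
  proof -
    have "copy_prop 2 -` M \<in> models (prop_theory T)" "copy_prop 1 -` M \<in> models (prop_theory T)"
        "is_iso T (copy_prop 1 -` M) (copy_prop 2 -` M) (graph 1 M)"
      using that unfolding models_iso_chain_1 by blast+
    then show ?thesis
      by (rule iso_code_in_models[OF _ _ is_iso_inverse])
  qed
qed (rule countable_chain_axioms[OF assms])

lemma model_map_first_arrow:
  assumes "countable_theory T"
  shows "model_map (prop_theory (iso_chain 1 T)) (prop_theory (iso_chain 2 T))
    (pgen (prop_theory (iso_chain 2 T))) first_arrow"
proof (rule model_map_pgen[where t = "\<lambda>g. g"])
  show "g \<in> basics (prop_theory (iso_chain 2 T))" if "g \<in> basics (prop_theory (iso_chain 1 T))" for g
    using that by (cases rule: basics_arrow_cases) (simp_all add: mem_basics_iso_chain basics_prop_theory)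
  show "g \<in> first_arrow K \<longleftrightarrow> g \<in> K" if "g \<in> basics (prop_theory (iso_chain 1 T))" for K g
    using that by (cases rule: basics_arrow_cases) (simp_all add: first_arrow_def mem_iso_code graph_def)
qed (simp_all add: countable_chain_axioms assms arrows_in_models)

lemma model_map_second_arrow:
  assumes "countable_theory T"
  shows "model_map (prop_theory (iso_chain 1 T)) (prop_theory (iso_chain 2 T))
    (\<lambda>g. pgen (prop_theory (iso_chain 2 T)) (shift_prop g)) second_arrow"
proof (rule model_map_pgen)
  have [simp]: "Suc 1 = 2" "Suc 2 = 3"
    by simp_all
  show "shift_prop g \<in> basics (prop_theory (iso_chain 2 T))"
    if "g \<in> basics (prop_theory (iso_chain 1 T))" for g
    using that by (cases rule: basics_arrow_cases) (simp_all add: mem_basics_iso_chain basics_prop_theory)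
  show "g \<in> second_arrow K \<longleftrightarrow> shift_prop g \<in> K" if "g \<in> basics (prop_theory (iso_chain 1 T))" for K g
    using that by (cases rule: basics_arrow_cases) (simp_all add: second_arrow_def mem_iso_code graph_def)
qed (simp_all add: countable_chain_axioms assms arrows_in_models)

text \<open>On generators \<open>\<alpha>\<close>, composition is given by a join over the intermediate representatives \<open>q\<close>,
  whose extent is the relational composite.\<close>

lemma model_map_composition:
  assumes "countable_theory T"
  shows "model_map (prop_theory (iso_chain 1 T)) (prop_theory (iso_chain 2 T))
    (compose_gen (prop_theory (iso_chain 2 T)))
    (\<lambda>K. iso_code (copy_prop 1 -` K) (copy_prop 3 -` K) (\<lambda>X. graph 1 K X OO graph 2 K X))"
proof
  let ?P = "prop_theory (iso_chain 2 T)"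
  let ?h = "\<lambda>K. iso_code (copy_prop 1 -` K) (copy_prop 3 -` K) (\<lambda>X. graph 1 K X OO graph 2 K X)"
  interpret L: complete_lattice "classifying_frame ?P"
    by (rule complete_lattice_classifying_frame)
  have gen: "copy_prop j g \<in> basics ?P" if "g \<in> basics (prop_theory T)" "j \<in> {1, 3}" for j g
    using that by (auto simp: mem_basics_iso_chain)
  define D where "D X n p q = pgen ?P (BRel (Iso 1 X) [n, q]) \<sqinter>\<^bsub>classifying_frame ?P\<^esub>
      pgen ?P (BRel (Iso 2 X) [q, p])" for X n p q
  have iso: "pclosed ?P (pgen ?P (BRel (Iso j X) [n, m]))"
      "extent ?P (pgen ?P (BRel (Iso j X) [n, m])) = {K \<in> models ?P. graph j K X n m}"
    if "X \<in> sorts T" "j \<in> {1, 2}" for j X n m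
    using that by (auto simp: pclosed_pgen extent_pgen basics_prop_theory graph_def)
  have D: "pclosed ?P (D X n p q)"
      "extent ?P (D X n p q) = {K \<in> models ?P. graph 1 K X n q \<and> graph 2 K X q p}"
    if "X \<in> sorts T" for X n p q
  proof -
    show "pclosed ?P (D X n p q)"
      using L.meet_closed iso(1)[OF that] unfolding D_def by simp
    show "extent ?P (D X n p q) = {K \<in> models ?P. graph 1 K X n q \<and> graph 2 K X q p}"
      unfolding D_def by (subst extent_meet) (auto simp: iso that)
  qed
  have range: "range (D X n p) \<subseteq> Collect (pclosed ?P)" if "X \<in> sorts T" for X n p
    using D(1)[OF that] by blast
  have compose_gen: "compose_gen ?P (BRel (Iso 1 X) [n, p]) = \<Squnion>\<^bsub>classifying_frame ?P\<^esub>(range (D X n p))"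
    for X n p
    by (simp add: D_def)
  show "countable (paxioms ?P)"
    by (rule countable_chain_axioms[OF assms])
  show "pclosed ?P (compose_gen ?P g)" if "g \<in> basics (prop_theory (iso_chain 1 T))" for g
    using that
  proof (cases rule: basics_arrow_cases)
    case (graph X n p)
    then show ?thesis
      using L.sup_closed[of "range (D X n p)"] range by (simp add: compose_gen del: compose_gen.simps)
  qed (simp_all add: arrow_simps pclosed_pgen gen)
  show "?h K \<in> models (prop_theory (iso_chain 1 T))" if "K \<in> models ?P" for K
    using that unfolding models_iso_chain_2
    by (intro iso_code_in_models is_iso_compose[where S' = "copy_prop 2 -` K"]) blast+
  show "g \<in> ?h K \<longleftrightarrow> K \<in> extent ?P (compose_gen ?P g)"
    if K: "K \<in> models ?P" and "g \<in> basics (prop_theory (iso_chain 1 T))" for K g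
    using that(2)
  proof (cases rule: basics_arrow_cases)
    case (graph X n p)
    then have "K \<in> extent ?P (compose_gen ?P g) \<longleftrightarrow> (\<exists>q. graph 1 K X n q \<and> graph 2 K X q p)"
      using K by (simp add: compose_gen extent_sup[OF range] D del: compose_gen.simps)
    then show ?thesis
      by (auto simp: graph mem_iso_code)
  qed (simp_all add: arrow_simps extent_pgen gen mem_iso_code K)
qed

text \<open>A composable pair of arrows is the same as a model of the theory of composable pairs, and the
  topologies agree because each basic proposition of that theory speaks of one of the two arrows.\<close>

lemma homeomorphic_maps_composable:
  assumes "countable_theory T"
  shows "homeomorphic_maps (model_space (prop_theory (iso_chain 2 T))) (composable (model_groupoid T))
    (\<lambda>K. (first_arrow K, second_arrow K)) (\<lambda>(M, N). pair_code M N)"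
  unfolding homeomorphic_maps_def
proof (intro conjI ballI)
  let ?A = "model_space (prop_theory (iso_chain 1 T))"
  have "copy_prop 2 -` first_arrow K = copy_prop 1 -` second_arrow K" for K :: "('a, 'b) chain_prop set"
    by (simp add: first_arrow_def second_arrow_def)
  then show "continuous_map (model_space (prop_theory (iso_chain 2 T))) (composable (model_groupoid T))
      (\<lambda>K. (first_arrow K, second_arrow K))"
    unfolding composable_def continuous_map_in_subtopology continuous_map_pairwise comp_def
    using model_map.continuous[OF model_map_first_arrow[OF assms]]
      model_map.continuous[OF model_map_second_arrow[OF assms]] by auto
  show "continuous_map (composable (model_groupoid T)) (model_space (prop_theory (iso_chain 2 T)))
      (\<lambda>(M, N). pair_code M N)"
  proof (rule continuous_map_model_space)
    let ?C = "composable (model_groupoid T)"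
    show "(case x of (M, N) \<Rightarrow> pair_code M N) \<in> models (prop_theory (iso_chain 2 T))"
      if "x \<in> topspace ?C" for x
      using that by (auto simp: topspace_composable pair_code_in_models)
    have fst: "continuous_map ?C ?A fst" and snd: "continuous_map ?C ?A snd"
      unfolding composable_def
      by (auto intro: continuous_map_from_subtopology continuous_map_fst continuous_map_snd)
    have fst_open: "openin ?C {x \<in> topspace ?C. g \<in> fst x}" for g
      using openin_continuous_map_preimage[OF fst openin_mem_model[of _ g]]
      by (rule back_subst[of "openin ?C"]) (auto simp: topspace_composable)
    have snd_open: "openin ?C {x \<in> topspace ?C. g \<in> snd x}" for g
      using openin_continuous_map_preimage[OF snd openin_mem_model[of _ g]]
      by (rule back_subst[of "openin ?C"]) (auto simp: topspace_composable)
    fix g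
    have "openin ?C ({x \<in> topspace ?C. g \<in> fst x} \<union>
        (\<Union>g'\<in>{g'. g = shift_prop g'}. {x \<in> topspace ?C. g' \<in> snd x}))"
      using fst_open snd_open by (intro openin_Un openin_Union) auto
    then show "openin ?C {x \<in> topspace ?C. g \<in> (case x of (M, N) \<Rightarrow> pair_code M N)}"
      by (rule back_subst[of "openin ?C"]) (auto simp: pair_code_def)
  qed
  show "(case (first_arrow K, second_arrow K) of (M, N) \<Rightarrow> pair_code M N) = K"
    if "K \<in> topspace (model_space (prop_theory (iso_chain 2 T)))" for K
    using that by (simp add: pair_code_arrows)
  show "(first_arrow (case x of (M, N) \<Rightarrow> pair_code M N), second_arrow (case x of (M, N) \<Rightarrow> pair_code M N)) = x"
    if "x \<in> topspace (composable (model_groupoid T))" for x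
    using that by (auto simp: topspace_composable arrows_pair_code)
qed

lemma composition_arrows:
  "composition (model_groupoid T) (first_arrow K, second_arrow K) =
     iso_code (copy_prop 1 -` K) (copy_prop 3 -` K) (\<lambda>X. graph 1 K X OO graph 2 K X)"
  by (simp add: first_arrow_def second_arrow_def)

text \<open>The groupoid laws are identities between isomorphisms. Composition is continuous because it
  factors through the homeomorphism with the models of the theory of composable pairs.\<close>

lemma topological_groupoid_model_groupoid:
  assumes T: "countable_theory T"
  shows "topological_groupoid (model_groupoid T)"
proof
  let ?H = "model_groupoid T"
  show "continuous_map (arrows ?H) (objects ?H) (source ?H)"
    using model_map.continuous[OF model_map_copy[OF T, of 1 1]] by (simp add: model_groupoid_def)
  show "continuous_map (arrows ?H) (objects ?H) (target ?H)"
    using model_map.continuous[OF model_map_copy[OF T, of 2 1]] by (simp add: model_groupoid_def)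
  show "continuous_map (objects ?H) (arrows ?H) (identity ?H)"
    using model_map.continuous[OF model_map_identity[OF T]] by (simp add: model_groupoid_def)
  show "continuous_map (arrows ?H) (arrows ?H) (inversion ?H)"
    using model_map.continuous[OF model_map_inversion[OF T]] by (simp add: model_groupoid_def)
  show "continuous_map (composable ?H) (arrows ?H) (composition ?H)"
  proof (rule continuous_map_eq)
    let ?h = "\<lambda>K. iso_code (copy_prop 1 -` K) (copy_prop 3 -` K) (\<lambda>X. graph 1 K X OO graph 2 K X)"
    have "continuous_map (composable ?H) (model_space (prop_theory (iso_chain 2 T))) (\<lambda>(M, N). pair_code M N)"
      using homeomorphic_maps_composable[OF T] by (simp add: homeomorphic_maps_def)
    then show "continuous_map (composable ?H) (arrows ?H) (?h \<circ> (\<lambda>(M, N). pair_code M N))"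
      using continuous_map_compose model_map.continuous[OF model_map_composition[OF T]] by simp
    fix x
    assume "x \<in> topspace (composable ?H)"
    then obtain M N where x: "x = (M, N)" and "M \<in> models (prop_theory (iso_chain 1 T))"
        "N \<in> models (prop_theory (iso_chain 1 T))" "copy_prop 2 -` M = copy_prop 1 -` N"
      by (auto simp: topspace_composable)
    then show "(?h \<circ> (\<lambda>(M, N). pair_code M N)) x = composition ?H x"
      using composition_arrows[of T "pair_code M N"] by (simp add: arrows_pair_code)
  qed
  have arrow: "is_structure T (copy_prop 1 -` M)" "is_structure T (copy_prop 2 -` M)"
      "is_iso T (copy_prop 1 -` M) (copy_prop 2 -` M) (graph 1 M)"
      "iso_code (copy_prop 1 -` M) (copy_prop 2 -` M) (graph 1 M) = M"
    if "M \<in> topspace (arrows ?H)" for M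
    using that iso_code_eqI[of M T, symmetric] by (simp_all add: models_iso_chain_1 is_structure_model)
  fix f
  assume f: "f \<in> topspace (arrows ?H)"
  show "composition ?H (identity ?H (source ?H f), f) = f"
    using arrow[OF f] by (simp add: identity_OO del: vimage_eq)
  show "composition ?H (f, identity ?H (target ?H f)) = f"
    using arrow[OF f] by (simp add: OO_identity del: vimage_eq)
  show "composition ?H (f, inversion ?H f) = identity ?H (source ?H f)"
    using arrow[OF f] by (simp add: OO_inverse del: vimage_eq)
  show "composition ?H (inversion ?H f, f) = identity ?H (target ?H f)"
    using arrow[OF f] OO_inverse[OF arrow(2)[OF f] is_iso_inverse[OF arrow(3)[OF f]]]
    by (simp del: vimage_eq)
qed (simp_all add: topspace_composable relcompp_assoc)

theorem proposition4p8:
  fixes T :: "('s, 'r, 'i) gtheory"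
  assumes "geometric_theory T"
    and "countable_theory T"
  shows "spatial_groupoid (theory_groupoid T) \<and>
    (\<exists>H :: (('s, 'r) bprop set, ('s, 'r) chain_prop set) top_groupoid.
       topological_groupoid H \<and>
       localic_groupoid_iso (opens_groupoid H) (theory_groupoid T))"
proof
  note T = assms(2)
  note countable = countable_prop_theory[OF T] countable_chain_axioms[OF T]
  show "spatial_groupoid (theory_groupoid T)"
    unfolding spatial_groupoid_def theory_groupoid_def Let_def
    using countable by (auto intro: spatialI[OF frame_iso_extent])
  let ?H = "model_groupoid T"
  let ?P0 = "prop_theory T" and ?P1 = "prop_theory (iso_chain 1 T)" and ?P2 = "prop_theory (iso_chain 2 T)"
  \<comment> \<open>A composable pair is identified with a model of the theory of composable pairs.\<close>
  let ?f2 = "\<lambda>U. forcing ?P2 {K \<in> topspace (model_space ?P2). (first_arrow K, second_arrow K) \<in> U}"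
  have pair: "(first_arrow K, second_arrow K) \<in> topspace (composable ?H)" if "K \<in> models ?P2" for K
    using that homeomorphic_maps_composable[OF T]
    by (auto simp: homeomorphic_maps_def continuous_map_def)
  have "localic_groupoid_iso (opens_groupoid ?H) (theory_groupoid T)"
    unfolding localic_groupoid_iso_def
  proof (intro exI[of _ "forcing ?P0"] exI[of _ "forcing ?P1"] exI[of _ ?f2] conjI ballI)
    show "frame_iso (Obj (opens_groupoid ?H)) (Obj (theory_groupoid T)) (forcing ?P0)"
      "frame_iso (Mor (opens_groupoid ?H)) (Mor (theory_groupoid T)) (forcing ?P1)"
      by (simp_all add: opens_groupoid_def theory_groupoid_def Let_def frame_iso_forcing countable)
    show "frame_iso (Comp (opens_groupoid ?H)) (Comp (theory_groupoid T)) ?f2"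
      using frame_iso_trans[OF frame_iso_homeomorphic_maps[OF homeomorphic_maps_composable[OF T]]
          frame_iso_forcing[OF countable(2)]]
      by (simp add: opens_groupoid_def theory_groupoid_def Let_def)
  next
    fix U
    assume "U \<in> carrier (Obj (opens_groupoid ?H))"
    then have U: "openin (model_space ?P0) U"
      by (simp add: opens_groupoid_def)
    show "forcing ?P1 (src (opens_groupoid ?H) U) = src (theory_groupoid T) (forcing ?P0 U)"
      using model_map.forcing_preimage[OF model_map_copy[OF T, of 1 1] U]
      by (simp add: opens_groupoid_def theory_groupoid_def Let_def)
    show "forcing ?P1 (tgt (opens_groupoid ?H) U) = tgt (theory_groupoid T) (forcing ?P0 U)"
      using model_map.forcing_preimage[OF model_map_copy[OF T, of 2 1] U]
      by (simp add: opens_groupoid_def theory_groupoid_def Let_def)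
  next
    fix U
    assume "U \<in> carrier (Mor (opens_groupoid ?H))"
    then have U: "openin (model_space ?P1) U"
      by (simp add: opens_groupoid_def)
    show "forcing ?P0 (ident (opens_groupoid ?H) U) = ident (theory_groupoid T) (forcing ?P1 U)"
      using model_map.forcing_preimage[OF model_map_identity[OF T] U]
      by (simp add: opens_groupoid_def theory_groupoid_def Let_def)
    show "forcing ?P1 (invert (opens_groupoid ?H) U) = invert (theory_groupoid T) (forcing ?P1 U)"
      using model_map.forcing_preimage[OF model_map_inversion[OF T] U]
      by (simp add: opens_groupoid_def theory_groupoid_def Let_def)
    show "?f2 (compose (opens_groupoid ?H) U) = compose (theory_groupoid T) (forcing ?P1 U)"
      using model_map.forcing_preimage[OF model_map_composition[OF T] U]
      by (simp add: opens_groupoid_def theory_groupoid_def Let_def composition_arrows pair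
          cong: conj_cong del: model_groupoid_simps(7))
    show "?f2 (proj1 (opens_groupoid ?H) U) = proj1 (theory_groupoid T) (forcing ?P1 U)"
      using model_map.forcing_preimage[OF model_map_first_arrow[OF T] U]
      by (simp add: opens_groupoid_def theory_groupoid_def Let_def pair cong: conj_cong)
    show "?f2 (proj2 (opens_groupoid ?H) U) = proj2 (theory_groupoid T) (forcing ?P1 U)"
      using model_map.forcing_preimage[OF model_map_second_arrow[OF T] U]
      by (simp add: opens_groupoid_def theory_groupoid_def Let_def pair cong: conj_cong)
  qed
  then show "\<exists>H :: (('s, 'r) bprop set, ('s, 'r) chain_prop set) top_groupoid.
      topological_groupoid H \<and> localic_groupoid_iso (opens_groupoid H) (theory_groupoid T)"
    using topological_groupoid_model_groupoid[OF T] by blast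
qed

end
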